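(* Let $d\ge3$ be an integer and let $G_n$ be a random $d$-regular graph on $n$ vertices. Let $q\ge2$. Then the quenched and annealed pressures per particle are equal, i.e., for all $\beta\ge0$ and $B\ge0$, with $w=e^\beta-1$, $$\lim_{n\to\infty}\frac1n\mathbb E\big[\log Z_{G_n}(q,w,B)\big]=\lim_{n\to\infty}\frac1n\log\mathbb E\big[Z_{G_n}(q,w,B)\big]=\varphi(w,B).$$
   Context: $G_n$ is uniformly distributed over the $d$-regular graphs on $n$ labelled vertices (with $n\to\infty$ along values such that $nd$ is even). For a finite graph $G$ and $\omega\in\{0,1\}^{E(G)}$, $\mathscr C(\omega)$ is the collection of connected components of $(V(G),\{e:\omega_e=1\})$ (isolated vertices are components), $|C|$ is the number of vertices of $C$, and $$Z_G(q,w,B)=\sum_{\omega\in\{0,1\}^{E(G)}}\prod_{e\in E(G)}w^{\omega_e}\prod_{C\in\mathscr C(\omega)}\big(1+(q-1)e^{-B|C|}\big).$$ The function $\varphi$ is $$\varphi(w,B)=\frac{\beta^*d}{2}+\frac12\log\big(e^{-B}(q-1)\big)+\varphi^{\mathrm{Ising}}(\beta^*,B^* ),$$ $$\beta^*=\frac14\log\big((1+w)(1+w/(q-1))\big),\qquad B^*=\frac d4\log\Big(\frac{1+w}{1+w/(q-1)}\Big)+\frac12\log\Big(\frac{e^B}{q-1}\Big).$$ Here $\varphi^{\mathrm{Ising}}(\beta,b)$ is the limit in probability of $\frac1n\log Z^{\mathrm{Ising}}_{G_n}(\beta,b)$ for $d$-regular graphs $G_n$ on $n$ vertices that converge locally in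 probability to the infinite $d$-regular tree, where $Z^{\mathrm{Ising}}_{G}(\beta,b)=\sum_{\sigma\in\{-1,1\}^{V(G)}}\exp\big(\beta\sum_{\{u,v\}\in E(G)}\sigma_u\sigma_v+b\sum_{v}\sigma_v\big)$; this limit is known to exist and depends only on $d,\beta,b$. *)

theory Defs
  imports "HOL-Probability.Probability"
begin

text \<open>
  A graph is given by a vertex set \<open>V\<close> and a set \<open>E\<close> of two-element edges.
\<close>

definition simple_graph :: "'a set \<Rightarrow> 'a set set \<Rightarrow> bool" where
  "simple_graph V E \<longleftrightarrow> (\<forall>e\<in>E. e \<subseteq> V \<and> card e = 2)"

definition adj_rel :: "'a set set \<Rightarrow> 'a rel" where
  "adj_rel E = {(u, v). {u, v} \<in> E}"

definition clusters :: "'a set \<Rightarrow> 'a set set \<Rightarrow> 'a set set" where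
  "clusters V F = V // {(u, v) \<in> V \<times> V. (u, v) \<in> (adj_rel F)\<^sup>*}"

definition rc_partition ::
    "'a set \<Rightarrow> 'a set set \<Rightarrow> real \<Rightarrow> real \<Rightarrow> real \<Rightarrow> real" where
  "rc_partition V E q w B =
     (\<Sum>\<omega> \<in> E \<rightarrow>\<^sub>E {0, 1 :: nat}.
        (\<Prod>e\<in>E. w ^ \<omega> e) *
        (\<Prod>C\<in>clusters V {e \<in> E. \<omega> e = 1}. 1 + (q - 1) * exp (- B * real (card C))))"

text \<open>For an edge \<open>e = {u, v}\<close>, the product over \<open>x \<in> e\<close> of \<open>\<sigma> x\<close> is \<open>\<sigma> u * \<sigma> v\<close>.\<close>

definition ising_partition :: "'a set \<Rightarrow> 'a set set \<Rightarrow> real \<Rightarrow> real \<Rightarrow> real" where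
  "ising_partition V E \<beta> b =
     (\<Sum>\<sigma> \<in> V \<rightarrow>\<^sub>E {-1, 1 :: real}.
        exp (\<beta> * (\<Sum>e\<in>E. \<Prod>x\<in>e. \<sigma> x) + b * (\<Sum>v\<in>V. \<sigma> v)))"

definition regular_graphs :: "nat \<Rightarrow> nat \<Rightarrow> nat set set set" where
  "regular_graphs d n =
     {E. simple_graph {..<n} E \<and> (\<forall>v<n. card {e \<in> E. v \<in> e} = d)}"

text \<open>
  \<open>regular_graphs d n\<close> is nonempty whenever \<open>n > d\<close> and \<open>n * d\<close> is even, hence
  eventually along the filter \<open>admissible d\<close>; the law below is only meaningful for such \<open>n\<close>.
\<close>

definition random_regular_graph :: "nat \<Rightarrow> nat \<Rightarrow> nat set set pmf" where
  "random_regular_graph d n = pmf_of_set (regular_graphs d n)"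

definition admissible :: "nat \<Rightarrow> nat filter" where
  "admissible d = inf sequentially (principal {n. even (n * d)})"

text \<open>
  Convergence in probability to a constant; the random variables \<open>X n\<close> may live on
  different probability spaces.
\<close>

definition tendsto_in_prob ::
    "(nat \<Rightarrow> 'b pmf) \<Rightarrow> (nat \<Rightarrow> 'b \<Rightarrow> real) \<Rightarrow> real \<Rightarrow> nat filter \<Rightarrow> bool" where
  "tendsto_in_prob M X c F \<longleftrightarrow>
     (\<forall>\<epsilon>>0. ((\<lambda>n. measure_pmf.prob (M n) {x. \<bar>X n x - c\<bar> > \<epsilon>}) \<longlongrightarrow> 0) F)"

text \<open>The ball of radius \<open>r\<close> around \<open>v\<close> is the induced subgraph on the vertices at graph
  distance at most \<open>r\<close> from \<open>v\<close>.\<close>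

definition nbhd_verts :: "'a set set \<Rightarrow> nat \<Rightarrow> 'a \<Rightarrow> 'a set" where
  "nbhd_verts E r v = {u. \<exists>k\<le>r. (v, u) \<in> adj_rel E ^^ k}"

definition nbhd_edges :: "'a set set \<Rightarrow> nat \<Rightarrow> 'a \<Rightarrow> 'a set set" where
  "nbhd_edges E r v = {e \<in> E. e \<subseteq> nbhd_verts E r v}"

definition rooted_iso ::
    "'a set \<Rightarrow> 'a set set \<Rightarrow> 'a \<Rightarrow> 'b set \<Rightarrow> 'b set set \<Rightarrow> 'b \<Rightarrow> bool" where
  "rooted_iso V E x V' E' x' \<longleftrightarrow>
     (\<exists>f. bij_betw f V V' \<and> f x = x' \<and>
        (\<forall>u\<in>V. \<forall>v\<in>V. {u, v} \<in> E \<longleftrightarrow> {f u, f v} \<in> E'))"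

definition nbhd_iso :: "'a set set \<Rightarrow> nat \<Rightarrow> 'a \<Rightarrow> 'b set \<Rightarrow> 'b set set \<Rightarrow> 'b \<Rightarrow> bool" where
  "nbhd_iso E r v H EH h \<longleftrightarrow>
     rooted_iso (nbhd_verts E r v) (nbhd_edges E r v) v H EH h"

text \<open>
  The infinite \<open>d\<close>-regular tree rooted at \<open>[]\<close>: vertices are the words coding the path from
  the root, which has \<open>d\<close> children, while every other vertex has \<open>d - 1\<close> children.
\<close>

definition tree_verts :: "nat \<Rightarrow> nat list set" where
  "tree_verts d = {xs. \<forall>i<length xs. xs ! i < (if i = 0 then d else d - 1)}"

definition tree_edges :: "nat \<Rightarrow> nat list set set" where
  "tree_edges d = {{xs, xs @ [i]} | xs i. xs @ [i] \<in> tree_verts d}"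

text \<open>
  Local convergence in probability: for every radius \<open>r\<close> and every finite rooted graph
  \<open>(H, EH, h)\<close>, the proportion of vertices whose \<open>r\<close>-ball is isomorphic to \<open>(H, EH, h)\<close>
  converges in probability to the probability that the \<open>r\<close>-ball around the root of the limit
  is. The limit is deterministic here, so that this probability is 0 or 1.
\<close>

definition locally_tree_like :: "nat \<Rightarrow> (nat \<Rightarrow> nat set set pmf) \<Rightarrow> bool" where
  "locally_tree_like d G \<longleftrightarrow>
     (\<forall>r (H :: nat set) EH h. finite H \<longrightarrow> simple_graph H EH \<longrightarrow> h \<in> H \<longrightarrow>
        tendsto_in_prob G
          (\<lambda>n E. real (card {v. v < n \<and> nbhd_iso E r v H EH h}) / real n)
          (of_bool (nbhd_iso (tree_edges d) r [] H EH h))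
          (admissible d))"

definition is_ising_pressure :: "nat \<Rightarrow> real \<Rightarrow> real \<Rightarrow> real \<Rightarrow> bool" where
  "is_ising_pressure d \<beta> b c \<longleftrightarrow>
     (\<forall>G. (\<forall>\<^sub>F n in admissible d. set_pmf (G n) \<subseteq> regular_graphs d n) \<longrightarrow>
        locally_tree_like d G \<longrightarrow>
        tendsto_in_prob G (\<lambda>n E. ln (ising_partition {..<n} E \<beta> b) / real n) c (admissible d))"

definition ising_pressure :: "nat \<Rightarrow> real \<Rightarrow> real \<Rightarrow> real" where
  "ising_pressure d \<beta> b = (THE c. is_ising_pressure d \<beta> b c)"

definition beta_star :: "real \<Rightarrow> real \<Rightarrow> real" where
  "beta_star q w = 1 / 4 * ln ((1 + w) * (1 + w / (q - 1)))"

definition B_star :: "nat \<Rightarrow> real \<Rightarrow> real \<Rightarrow> real \<Rightarrow> real" where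
  "B_star d q w B =
     real d / 4 * ln ((1 + w) / (1 + w / (q - 1))) + 1 / 2 * ln (exp B / (q - 1))"

definition rc_pressure :: "nat \<Rightarrow> real \<Rightarrow> real \<Rightarrow> real \<Rightarrow> real" where
  "rc_pressure d q w B =
     beta_star q w * real d / 2 + 1 / 2 * ln (exp (- B) * (q - 1))
     + ising_pressure d (beta_star q w) (B_star d q w B)"

end

theory Submission
  imports Defs "HOL-Complex_Analysis.Complex_Analysis"
begin

text \<open>
  Expanding the cluster weights over the sets of clusters that receive the second summand compares
  the random cluster model with a two-spin model: since a connected cluster \<open>C\<close> has at least
  \<open>|C| - 1\<close> edges and \<open>q - 1 \<ge> 1\<close>, the two-spin partition function is a lower bound, and only the
  clusters that are large or contain a cycle prevent equality. On regular graphs the two-spin model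
  is the Ising model with parameters \<open>\<beta>\<^sup>*\<close> and \<open>B\<^sup>*\<close>.

  By the Lee-Yang theorem the ratio of the partition functions with a vertex occupied and vacant is,
  as a function of the activity \<open>z\<close>, analytic and bounded by 1 on the unit disc. Its low-order
  Taylor coefficients only depend on a ball around the vertex, so by a Schwarz lemma argument the
  ratio itself does, up to an error exponentially small in the radius. Integrating over the activity,
  the pressures of any two regular graphs that look like the tree around most vertices are close.

  A switching argument shows that a random regular graph fails to look like the tree around most
  vertices only with superexponentially small probability. As the partition function is at most
  exponentially large, such graphs do not contribute to the annealed pressure either.
\<close>

section \<open>The Lee-Yang theorem\<close>

text \<open>\<open>ising_pressure\<close> is a definite description, so existence and uniqueness of
  the limit have to be proved along the way; no formula for it is derived, the value being the limit
  of a Cauchy sequence of pressures of increasingly tree-like graphs. The obstacle is phase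
  coexistence: where the Ising model on the tree has several Gibbs states, local structure does not
  determine vertex marginals. Lee-Yang avoids it by keeping the activity \<open>z\<close> inside the
  unit disc, where the marginals are forced to be local; integration starts at activity 0, where the
  pressure vanishes. Activities above 1 are reflected by a global spin flip, and
  \<open>z = 1\<close> is reached by a Lipschitz bound that does not involve the marginals. The
  annealed limit asks for more than convergence in probability, since an event of exponentially
  small probability could dominate the mean of the partition function. The superexponential decay
  comes from a factorial: \<open>m\<close> disjoint short cycles can be ordered in \<open>m!\<close>
  ways, while destroying one of them by a switching costs only a bounded factor.\<close>

definition cut :: "'a set set \<Rightarrow> 'a set \<Rightarrow> nat" where
  "cut E S = card {e \<in> E. e \<inter> S \<noteq> {} \<and> \<not> e \<subseteq> S}"

lemma cut_insert:
  assumes "finite E" "e \<notin> E"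
  shows "cut (insert e E) S = cut E S + of_bool (e \<inter> S \<noteq> {} \<and> \<not> e \<subseteq> S)"
proof -
  have "{f \<in> insert e E. f \<inter> S \<noteq> {} \<and> \<not> f \<subseteq> S} =
      (if e \<inter> S \<noteq> {} \<and> \<not> e \<subseteq> S then insert e {f \<in> E. f \<inter> S \<noteq> {} \<and> \<not> f \<subseteq> S}
       else {f \<in> E. f \<inter> S \<noteq> {} \<and> \<not> f \<subseteq> S})"
    by auto
  with assms show ?thesis by (simp add: cut_def)
qed

text \<open>This is the two-variable step of Lee-Yang. A linear polynomial without zeros in the
  closed disc has a constant term strictly larger in modulus than its slope, so the hypothesis turns
  into inequalities between norms of coefficients. After squaring, the goal reads
  \<open>X + a\<^sup>2 * Y + a * T > 0\<close>, while the hypothesis provides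
  \<open>X + Y + T > 0\<close>, \<open>X + Y - T > 0\<close> and \<open>X > Y\<close>.\<close>

lemma bilinear_torus_contraction:
  fixes A B C D :: complex and a :: real
  assumes nz: "\<And>x y. norm x \<le> 1 \<Longrightarrow> norm y \<le> 1 \<Longrightarrow> A + B * x + C * y + D * x * y \<noteq> 0"
    and a: "0 \<le> a" "a \<le> 1" and xy: "norm x = 1" "norm y = 1"
  shows "A + of_real a * (B * x + C * y) + D * x * y \<noteq> 0"
proof -
  have lt: "norm Q < norm P" if "\<And>x. norm x \<le> 1 \<Longrightarrow> P + Q * x \<noteq> 0" for P Q :: complex
  proof (rule ccontr)
    assume "\<not> norm Q < norm P"
    hence le: "norm P \<le> norm Q" by simp
    show False
    proof (cases "Q = 0")
      case True thus ?thesis using le that[of 0] by simp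
    next
      case False
      have "norm (- P / Q) \<le> 1" using le False by (simp add: norm_divide field_simps)
      from that[OF this] False show False by simp
    qed
  qed
  have h1: "norm (B + D * t) < norm (A + C * t)" if "norm t = 1" for t
  proof (rule lt)
    fix x :: complex assume "norm x \<le> 1"
    from nz[OF this, of t] that show "A + C * t + (B + D * t) * x \<noteq> 0"
      by (simp add: algebra_simps)
  qed
  have h2: "norm (C + D * t) < norm (A + B * t)" if "norm t = 1" for t
  proof (rule lt)
    fix x :: complex assume "norm x \<le> 1"
    from nz[of t x] this that show "A + B * t + (C + D * t) * x \<noteq> 0"
      by (simp add: algebra_simps)
  qed
  have sq: "(norm (P + Q * t))\<^sup>2 = (norm P)\<^sup>2 + (norm Q)\<^sup>2 + 2 * Re (cnj P * Q * t)"
    if "norm t = 1" for P Q t :: complex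
  proof -
    have "(norm (P + Q * t))\<^sup>2 = (norm P)\<^sup>2 + (norm (Q * t))\<^sup>2 + 2 * Re (cnj P * (Q * t))"
      by (simp only: cmod_power2) (simp add: power2_eq_square algebra_simps)
    with that show ?thesis by (simp add: norm_mult mult.assoc)
  qed
  define X Y where "X = (norm A)\<^sup>2 - (norm D)\<^sup>2" and "Y = (norm C)\<^sup>2 - (norm B)\<^sup>2"
  define T where "T = 2 * Re (cnj A * C * y) - 2 * Re (cnj B * D * y)"
  have l1: "X + Y + T > 0"
    using power_strict_mono[OF h1[OF xy(2)], of 2] sq[OF xy(2), of B D] sq[OF xy(2), of A C]
    by (simp add: X_def Y_def T_def)
  have "norm (-y) = 1" using xy by simp
  have l2: "X + Y - T > 0"
    using power_strict_mono[OF h1[OF \<open>norm (-y) = 1\<close>], of 2] sq[OF \<open>norm (-y) = 1\<close>, of B D]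
      sq[OF \<open>norm (-y) = 1\<close>, of A C]
    by (simp add: X_def Y_def T_def)
  \<comment> \<open>Averaging over the opposite points 1 and -1 of the circle removes the cross
    terms.\<close>
  have l3: "X - Y > 0"
  proof -
    have o: "norm (1::complex) = 1" "norm (-1::complex) = 1" by auto
    show ?thesis
    using power_strict_mono[OF h2[OF o(1)], of 2] sq[OF o(1), of C D] sq[OF o(1), of A B]
      power_strict_mono[OF h2[OF o(2)], of 2] sq[OF o(2), of C D] sq[OF o(2), of A B]
    by (simp add: X_def Y_def)
  qed
  \<comment> \<open>The quantity equals \<open>a * (X + Y + T) + (1 - a) * (X - a * Y)\<close>, a
    nonnegative term plus, for \<open>a < 1\<close>, a positive one.\<close>
  have main: "X + a\<^sup>2 * Y + a * T > 0"
  proof (cases "a = 1")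
    case True thus ?thesis using l1 by simp
  next
    case False
    have "a * T \<ge> a * (- (X + Y))" using l1 a by (intro mult_left_mono) auto
    moreover have "(1 - a) * (X - a * Y) > 0"
    proof (rule mult_pos_pos)
      have "X + Y > 0" using l1 l2 by simp
      hence "(1 - a) * X + a * (X - Y) > 0"
        using l3 a False by (intro add_pos_nonneg mult_pos_pos) auto
      thus "X - a * Y > 0" by (simp add: algebra_simps)
    qed (use a False in auto)
    ultimately show ?thesis by (simp add: algebra_simps power2_eq_square)
  qed
  have "(norm (A + (a * C) * y))\<^sup>2 - (norm (a * B + D * y))\<^sup>2 = X + a\<^sup>2 * Y + a * T"
    using sq[OF xy(2), of A "a * C"] sq[OF xy(2), of "a * B" D] a
    by (simp add: X_def Y_def T_def norm_mult power_mult_distrib algebra_simps)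
  with main have "(norm (a * B + D * y))\<^sup>2 < (norm (A + (a * C) * y))\<^sup>2" by simp
  hence "norm (a * B + D * y) < norm (A + (a * C) * y)" by (rule power_less_imp_less_base) simp
  hence "norm ((a * B + D * y) * x) < norm (A + (a * C) * y)" using xy by (simp add: norm_mult)
  hence "A + (a * C) * y + (a * B + D * y) * x \<noteq> 0"
    by (metis add_eq_0_iff less_irrefl norm_minus_cancel)
  thus ?thesis by (simp add: algebra_simps)
qed

text \<open>Scaling the variables moves a zero in the open bidisc to the torus.\<close>

lemma bilinear_contraction:
  fixes A B C D :: complex and a :: real
  assumes nz: "\<And>x y. norm x < 1 \<Longrightarrow> norm y < 1 \<Longrightarrow> A + B * x + C * y + D * x * y \<noteq> 0"
    and a: "0 \<le> a" "a \<le> 1" and xy: "norm x < 1" "norm y < 1"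
  shows "A + of_real a * (B * x + C * y) + D * x * y \<noteq> 0"
proof -
  define x' y' where "x' = (if x = 0 then 1 else sgn x)" and "y' = (if y = 0 then 1 else sgn y)"
  have n: "norm x' = 1" "norm y' = 1" by (auto simp: x'_def y'_def norm_sgn)
  have e: "x = norm x * x'" "y = norm y * y'" by (auto simp: x'_def y'_def sgn_eq)
  have "A + of_real a * ((B * norm x) * x' + (C * norm y) * y') + (D * norm x * norm y) * x' * y' \<noteq> 0"
  proof (rule bilinear_torus_contraction[OF _ a n])
    fix s t :: complex assume st: "norm s \<le> 1" "norm t \<le> 1"
    have "norm (norm x * s) < 1" "norm (norm y * t) < 1"
      using st xy mult_left_mono[of "norm s" 1 "norm x"] mult_left_mono[of "norm t" 1 "norm y"]
      by (auto simp: norm_mult)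
    from nz[OF this] show "A + B * norm x * s + C * norm y * t + D * norm x * norm y * s * t \<noteq> 0"
      by (simp add: algebra_simps)
  qed
  thus ?thesis using e by (metis (no_types, lifting) mult.assoc mult.commute)
qed

lemma sum_Pow_insert:
  assumes "finite V" "u \<notin> V"
  shows "(\<Sum>S\<in>Pow (insert u V). f S) = (\<Sum>S\<in>Pow V. f S) + (\<Sum>S\<in>Pow V. f (insert u S))"
proof -
  have "sum f (Pow (insert u V)) = sum f (Pow V) + sum f (insert u ` Pow V)"
    unfolding Pow_insert using assms by (intro sum.union_disjoint) auto
  also have "sum f (insert u ` Pow V) = (\<Sum>S\<in>Pow V. f (insert u S))"
    using assms by (subst sum.reindex) (auto simp: inj_on_def)
  finally show ?thesis .
qed

text \<open>Induction on the edges. Adding an edge \<open>{u, v}\<close> multiplies by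
  \<open>a\<close> exactly the coefficients of sets containing one of the two endpoints; with the
  other variables frozen the polynomial is bilinear in \<open>x u\<close> and \<open>x v\<close>, so
  \<open>bilinear_contraction\<close> applies. This is why each vertex carries its own variable, a
  freedom used again to single out one vertex and to empty a region.\<close>

lemma lee_yang:
  fixes x :: "'a \<Rightarrow> complex" and a :: real
  assumes "finite V" "finite E" and "\<forall>e\<in>E. e \<subseteq> V \<and> card e = 2" and a: "0 \<le> a" "a \<le> 1"
    and "\<forall>u\<in>V. norm (x u) < 1"
  shows "(\<Sum>S\<in>Pow V. of_real (a ^ cut E S) * (\<Prod>u\<in>S. x u)) \<noteq> 0"
  using assms(2,3,6)
proof (induction E arbitrary: x rule: finite_induct)
  case empty
  have "(\<Sum>S\<in>Pow V. \<Prod>u\<in>S. x u) = (\<Prod>u\<in>V. 1 + x u)"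
    using prod_add[OF assms(1), of x "\<lambda>_. 1"] by (simp add: add.commute)
  also have "\<dots> \<noteq> 0"
  proof -
    have "1 + x u \<noteq> 0" if "u \<in> V" for u
      using empty that by (metis add_eq_0_iff less_irrefl norm_minus_cancel norm_one)
    thus ?thesis using assms(1) by simp
  qed
  finally show ?case by (simp add: cut_def)
next
  case (insert e E)
  from insert.prems obtain u v where e: "e = {u, v}" "u \<noteq> v" "u \<in> V" "v \<in> V"
    by (auto simp: card_2_iff)
  define W where "W = V - {u, v}"
  have V: "V = insert u (insert v W)" and W: "finite W" "u \<notin> insert v W" "v \<notin> W"
    using e assms(1) by (auto simp: W_def)
  define A where "A = (\<Sum>S\<in>Pow W. of_real (a ^ cut E S) * (\<Prod>u\<in>S. x u))"
  define B where "B = (\<Sum>S\<in>Pow W. of_real (a ^ cut E (insert u S)) * (\<Prod>u\<in>S. x u))"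
  define C where "C = (\<Sum>S\<in>Pow W. of_real (a ^ cut E (insert v S)) * (\<Prod>u\<in>S. x u))"
  define D where "D = (\<Sum>S\<in>Pow W. of_real (a ^ cut E (insert u (insert v S))) * (\<Prod>u\<in>S. x u))"
  have fin: "finite S" if "S \<subseteq> W" for S using that W finite_subset by blast
  have split: "(\<Sum>S\<in>Pow V. of_real (c S) * (\<Prod>u\<in>S. y u)) =
     (\<Sum>S\<in>Pow W. of_real (c S) * (\<Prod>u\<in>S. y u)) +
     y u * (\<Sum>S\<in>Pow W. of_real (c (insert u S)) * (\<Prod>u\<in>S. y u)) +
     y v * (\<Sum>S\<in>Pow W. of_real (c (insert v S)) * (\<Prod>u\<in>S. y u)) +
     y u * y v * (\<Sum>S\<in>Pow W. of_real (c (insert u (insert v S))) * (\<Prod>u\<in>S. y u))"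
    for c :: "'a set \<Rightarrow> real" and y :: "'a \<Rightarrow> complex"
  proof -
    have *: "(\<Prod>u\<in>insert u S. y u) = y u * (\<Prod>u\<in>S. y u)"
      "(\<Prod>u\<in>insert v S. y u) = y v * (\<Prod>u\<in>S. y u)"
      "(\<Prod>u\<in>insert u (insert v S). y u) = y u * y v * (\<Prod>u\<in>S. y u)" if "S \<subseteq> W" for S
    proof -
      have "u \<notin> S" "v \<notin> S" "u \<noteq> v" "finite S" using that W fin by auto
      thus "(\<Prod>u\<in>insert u S. y u) = y u * (\<Prod>u\<in>S. y u)"
        "(\<Prod>u\<in>insert v S. y u) = y v * (\<Prod>u\<in>S. y u)"
        "(\<Prod>u\<in>insert u (insert v S). y u) = y u * y v * (\<Prod>u\<in>S. y u)"
        by simp_all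
    qed
    show ?thesis
      unfolding V using W
      by (simp add: sum_Pow_insert * sum_distrib_left algebra_simps cong: sum.cong_simp)
  qed
  have "A + of_real a * (B * x u + C * x v) + D * x u * x v \<noteq> 0"
  proof (rule bilinear_contraction[OF _ a])
    fix s t :: complex assume st: "norm s < 1" "norm t < 1"
    define y where "y = x(u := s, v := t)"
    have yx: "(\<Prod>u\<in>S. y u) = (\<Prod>u\<in>S. x u)" if "S \<subseteq> W" for S
      using that W by (intro prod.cong) (auto simp: y_def)
    have yuv: "y u = s" "y v = t" using e by (auto simp: y_def)
    have "(\<Sum>S\<in>Pow V. of_real (a ^ cut E S) * (\<Prod>u\<in>S. y u)) \<noteq> 0"
      using insert.prems st by (intro insert.IH) (auto simp: y_def)
    thus "A + B * s + C * t + D * s * t \<noteq> 0"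
      unfolding split yuv
        by (simp add: yx A_def B_def C_def D_def algebra_simps cong: sum.cong_simp)
  qed (use insert.prems e in auto)
  moreover have "cut (insert e E) S = cut E S"
    "cut (insert e E) (insert u S) = Suc (cut E (insert u S))"
    "cut (insert e E) (insert v S) = Suc (cut E (insert v S))"
    "cut (insert e E) (insert u (insert v S)) = cut E (insert u (insert v S))" if "S \<subseteq> W" for S
    using that W e insert.hyps by (auto simp: cut_insert)
  ultimately show ?case
    unfolding split
    by (simp add: A_def B_def C_def D_def sum_distrib_left algebra_simps cong: sum.cong_simp)
qed

section \<open>Locality of vertex ratios\<close>

text \<open>Up to a prefactor this is the Ising partition function in lattice-gas form,
  \<open>S\<close> being the occupied vertices. The activity ranges over any real normed field, so
  that the same polynomial serves on the complex disc and on the reals.\<close>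

definition cutsum :: "'a set set \<Rightarrow> real \<Rightarrow> 'a set set \<Rightarrow> 'b::real_normed_field \<Rightarrow> 'b" where
  "cutsum E a U z = (\<Sum>S\<in>U. of_real (a ^ cut E S) * z ^ card S)"

text \<open>\<open>B\<close> restricts the occupied vertices while the cuts are counted in all of
  \<open>E\<close>: the vertices outside \<open>B\<close> are vacant rather than deleted.\<close>

abbreviation Zin where "Zin E a B v \<equiv> cutsum E a {S. S \<subseteq> B \<and> v \<in> S}"
abbreviation Zout where "Zout E a B v \<equiv> cutsum E a {S. S \<subseteq> B \<and> v \<notin> S}"

lemma cutsum_of_real: "cutsum E a U (of_real s) = of_real (cutsum E a U s)"
  by (simp add: cutsum_def)

text \<open>In the Lee-Yang polynomial the variable is set to 0 outside \<open>B\<close>, to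
  \<open>z\<close> on \<open>B\<close> and to a free \<open>t\<close> at \<open>v\<close>. What
  remains is affine in \<open>t\<close>, of the form \<open>Zout + t * W\<close>, and has no zero
  with \<open>norm t < 1\<close>, so \<open>norm W\<close> cannot exceed the norm of
  \<open>Zout\<close>; restoring the activity of \<open>v\<close> gives \<open>Zin\<close> as
  \<open>z * W\<close>.\<close>

lemma ratio_bound_complex:
  fixes z :: complex
  assumes V: "finite V" and E: "finite E" "\<forall>e\<in>E. e \<subseteq> V \<and> card e = 2" and a: "0 \<le> a" "a \<le> 1"
    and B: "B \<subseteq> V" "v \<in> B" and z: "norm z < 1"
  shows "Zout E a B v z \<noteq> 0" and "norm (Zin E a B v z) \<le> norm z * norm (Zout E a B v z)"
proof -
  define x where "x t u = (if u = v then t else if u \<in> B then z else 0)" for t u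
  define W where "W = (\<Sum>S\<in>{S. S \<subseteq> B \<and> v \<in> S}. of_real (a ^ cut E S) * z ^ (card S - 1))"
  have finB: "finite B" using B V finite_subset by blast
  have "(\<Sum>S\<in>Pow V. of_real (a ^ cut E S) * (\<Prod>u\<in>S. x t u)) = Zout E a B v z + t * W" for t
  proof -
    have 0: "(\<Prod>u\<in>S. x t u) = 0" if "S \<in> Pow V - Pow B" for S
    proof -
      from that obtain u where "u \<in> S" "u \<notin> B" by auto
      moreover have "finite S" using that V finite_subset by auto
      ultimately show ?thesis using B by (auto simp: x_def)
    qed
    have "(\<Sum>S\<in>Pow V. of_real (a ^ cut E S) * (\<Prod>u\<in>S. x t u)) =
        (\<Sum>S\<in>Pow B. of_real (a ^ cut E S) * (\<Prod>u\<in>S. x t u))"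
      using B V by (intro sum.mono_neutral_right) (auto simp: 0)
    also have "Pow B = {S. S \<subseteq> B \<and> v \<notin> S} \<union> {S. S \<subseteq> B \<and> v \<in> S}" by auto
    also have "(\<Sum>S\<in>\<dots>. of_real (a ^ cut E S) * (\<Prod>u\<in>S. x t u)) =
       (\<Sum>S\<in>{S. S \<subseteq> B \<and> v \<notin> S}. of_real (a ^ cut E S) * (\<Prod>u\<in>S. x t u)) +
       (\<Sum>S\<in>{S. S \<subseteq> B \<and> v \<in> S}. of_real (a ^ cut E S) * (\<Prod>u\<in>S. x t u))"
      by (rule sum.union_disjoint) (use finB in auto)
    also have "(\<Sum>S\<in>{S. S \<subseteq> B \<and> v \<notin> S}. of_real (a ^ cut E S) * (\<Prod>u\<in>S. x t u)) = Zout E a B v z"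
      unfolding cutsum_def
    proof (rule sum.cong[OF refl])
      fix S assume S: "S \<in> {S. S \<subseteq> B \<and> v \<notin> S}"
      have "(\<Prod>u\<in>S. x t u) = (\<Prod>u\<in>S. z)" using S by (intro prod.cong) (auto simp: x_def)
      thus "of_real (a ^ cut E S) * (\<Prod>u\<in>S. x t u) = of_real (a ^ cut E S) * z ^ card S" by simp
    qed
    also have "(\<Sum>S\<in>{S. S \<subseteq> B \<and> v \<in> S}. of_real (a ^ cut E S) * (\<Prod>u\<in>S. x t u)) = t * W"
      unfolding W_def sum_distrib_left
    proof (rule sum.cong[OF refl])
      fix S assume S: "S \<in> {S. S \<subseteq> B \<and> v \<in> S}"
      have fS: "finite S" using S finB finite_subset by auto
      have "(\<Prod>u\<in>S. x t u) = x t v * (\<Prod>u\<in>S - {v}. x t u)"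
        using S fS by (subst prod.remove) auto
      also have "(\<Prod>u\<in>S - {v}. x t u) = (\<Prod>u\<in>S - {v}. z)"
        using S by (intro prod.cong) (auto simp: x_def)
      finally show "of_real (a ^ cut E S) * (\<Prod>u\<in>S. x t u) =
          t * (of_real (a ^ cut E S) * z ^ (card S - 1))"
        using S fS by (simp add: x_def)
    qed
    finally show ?thesis .
  qed
  moreover have "(\<Sum>S\<in>Pow V. of_real (a ^ cut E S) * (\<Prod>u\<in>S. x t u)) \<noteq> 0" if "norm t < 1" for t
    by (rule lee_yang[OF V E a]) (use that z in \<open>auto simp: x_def\<close>)
  ultimately have nz: "Zout E a B v z + t * W \<noteq> 0" if "norm t < 1" for t
    using that by simp
  from nz[of 0] show nz0: "Zout E a B v z \<noteq> 0" by simp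
  have le: "norm W \<le> norm (Zout E a B v z)"
  proof (rule ccontr)
    assume *: "\<not> ?thesis"
    hence W: "W \<noteq> 0" by auto
    have "norm (- Zout E a B v z / W) < 1" using * W by (simp add: norm_divide)
    from nz[OF this] W show False by simp
  qed
  have "Zin E a B v z = z * W"
    unfolding cutsum_def W_def sum_distrib_left
  proof (rule sum.cong[OF refl])
    fix S assume S: "S \<in> {S. S \<subseteq> B \<and> v \<in> S}"
    hence "card S > 0" using finB finite_subset card_gt_0_iff by fastforce
    thus "of_real (a ^ cut E S) * z ^ card S = z * (of_real (a ^ cut E S) * z ^ (card S - 1))"
      by (cases "card S") auto
  qed
  thus "norm (Zin E a B v z) \<le> norm z * norm (Zout E a B v z)"
    using le by (simp add: norm_mult mult_left_mono)
qed

section \<open>Exchanging two configurations on a component\<close>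

definition comp :: "'a set set \<Rightarrow> 'a set \<Rightarrow> 'a \<Rightarrow> 'a set" where
  "comp E U v = {u. (v, u) \<in> (adj_rel E \<inter> U \<times> U)\<^sup>*}"

lemma comp_subset: "v \<in> U \<Longrightarrow> comp E U v \<subseteq> U"
proof
  fix u assume v: "v \<in> U" and "u \<in> comp E U v"
  hence "(v, u) \<in> (adj_rel E \<inter> U \<times> U)\<^sup>*" by (simp add: comp_def)
  thus "u \<in> U" by (induction rule: rtrancl_induct) (use v in auto)
qed

lemma comp_closed:
  assumes "u \<in> comp E U v" "v \<in> U" "w \<in> U" "{u, w} \<in> E"
  shows "w \<in> comp E U v"
proof -
  have "u \<in> U" using comp_subset[OF assms(2)] assms(1) by auto
  hence "(u, w) \<in> adj_rel E \<inter> U \<times> U" using assms by (auto simp: adj_rel_def)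
  thus ?thesis using assms(1) by (auto simp: comp_def intro: rtrancl_into_rtrancl)
qed

lemma rtrancl_subset_relpow_card:
  assumes "finite R" "card R \<le> r" "R \<subseteq> A" "(v, u) \<in> R\<^sup>*"
  shows "\<exists>k\<le>r. (v, u) \<in> A ^^ k"
proof -
  from assms(1,4) obtain k where "k \<le> card R" "(v, u) \<in> R ^^ k"
    by (auto simp: rtrancl_finite_eq_relpow)
  moreover have "R ^^ j \<subseteq> A ^^ j" for j by (induction j) (use assms(3) in auto)
  ultimately show ?thesis using assms(2) by (intro exI[of _ k]) auto
qed

lemma card_Int_Times_le:
  assumes "finite U" "card U \<le> k"
  shows "finite (R \<inter> U \<times> U)" "card (R \<inter> U \<times> U) \<le> k\<^sup>2"
proof -
  show "finite (R \<inter> U \<times> U)" using assms by auto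
  have "card (R \<inter> U \<times> U) \<le> card (U \<times> U)" using assms by (intro card_mono) auto
  also have "\<dots> = card U * card U" by (simp add: card_cartesian_product)
  also have "\<dots> \<le> k * k" using assms by (intro mult_le_mono) auto
  finally show "card (R \<inter> U \<times> U) \<le> k\<^sup>2" by (simp add: power2_eq_square)
qed

text \<open>A path inside a set of \<open>k\<close> vertices uses at most \<open>k\<^sup>2\<close> adjacent pairs; this crude bound on
  distances is enough, as the radius only has to tend to infinity with \<open>k\<close>.\<close>

lemma comp_subset_ball:
  assumes "finite U" "card U \<le> k"
  shows "comp E U v \<subseteq> nbhd_verts E (k\<^sup>2) v"
  using rtrancl_subset_relpow_card[OF card_Int_Times_le[OF assms, of "adj_rel E"], of "adj_rel E" v]
  by (auto simp: comp_def nbhd_verts_def)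

definition swap :: "'a set \<Rightarrow> 'a set \<times> 'a set \<Rightarrow> 'a set \<times> 'a set" where
  "swap C = (\<lambda>(S, T). ((S - C) \<union> (T \<inter> C), (T - C) \<union> (S \<inter> C)))"

lemma swap_swap: "swap C (swap C p) = p"
  by (auto simp: swap_def split: prod.splits)

lemma swap_Un: "fst (swap C p) \<union> snd (swap C p) = fst p \<union> snd p"
  by (auto simp: swap_def split: prod.splits)

lemma card_swap:
  assumes "finite S" "finite T"
  shows "card (fst (swap C (S, T))) + card (snd (swap C (S, T))) = card S + card T"
proof -
  have 1: "card (fst (swap C (S, T))) = card (S - C) + card (T \<inter> C)"
    unfolding swap_def using assms by (simp, subst card_Un_disjoint) auto
  have 2: "card (snd (swap C (S, T))) = card (T - C) + card (S \<inter> C)"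
    unfolding swap_def using assms by (simp, subst card_Un_disjoint) auto
  have 3: "card S = card (S - C) + card (S \<inter> C)" "card T = card (T - C) + card (T \<inter> C)"
    using assms by (subst card_Un_disjoint[symmetric]; auto intro: arg_cong[where f = card])+
  from 1 2 3 show ?thesis by simp
qed

lemma cut_conv_sum:
  assumes "finite E"
  shows "cut E S = (\<Sum>e\<in>E. of_bool (e \<inter> S \<noteq> {} \<and> \<not> e \<subseteq> S))"
  using assms by (simp add: cut_def sum.If_cases of_bool_def Int_def)

text \<open>An edge leaving the component \<open>C\<close> of \<open>S \<union> T\<close> ends at a
  vertex vacant in both configurations, so the exchange only permutes the two contributions of that
  edge.\<close>

lemma cut_swap:
  assumes E: "finite E" "\<forall>e\<in>E. card e = 2" and v: "v \<in> S \<union> T" and C: "C = comp E (S \<union> T) v"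
  shows "cut E (fst (swap C (S, T))) + cut E (snd (swap C (S, T))) = cut E S + cut E T"
  unfolding cut_conv_sum[OF E(1)] sum.distrib[symmetric]
proof (rule sum.cong[OF refl])
  fix e assume e: "e \<in> E"
  then obtain x y where xy: "e = {x, y}" "x \<noteq> y" using E by (auto simp: card_2_iff)
  have cl1: "x \<in> C \<Longrightarrow> y \<in> S \<union> T \<Longrightarrow> y \<in> C" using comp_closed[of x E "S \<union> T" v y] v e xy C by auto
  have cl2: "y \<in> C \<Longrightarrow> x \<in> S \<union> T \<Longrightarrow> x \<in> C"
    using comp_closed[of y E "S \<union> T" v x] v e xy C by (auto simp: insert_commute)
  have cr: "e \<inter> X \<noteq> {} \<and> \<not> e \<subseteq> X \<longleftrightarrow> (x \<in> X) \<noteq> (y \<in> X)" for X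
    by (auto simp: xy)
  have m: "u \<in> fst (swap C (S, T)) \<longleftrightarrow> (if u \<in> C then u \<in> T else u \<in> S)"
      "u \<in> snd (swap C (S, T)) \<longleftrightarrow> (if u \<in> C then u \<in> S else u \<in> T)" for u
    by (auto simp: swap_def)
  show "of_bool (e \<inter> fst (swap C (S, T)) \<noteq> {} \<and> \<not> e \<subseteq> fst (swap C (S, T))) +
        of_bool (e \<inter> snd (swap C (S, T)) \<noteq> {} \<and> \<not> e \<subseteq> snd (swap C (S, T))) =
        of_bool (e \<inter> S \<noteq> {} \<and> \<not> e \<subseteq> S) + (of_bool (e \<inter> T \<noteq> {} \<and> \<not> e \<subseteq> T) :: nat)"
    unfolding cr m using cl1 cl2
    by (cases "x \<in> C"; cases "y \<in> C"; auto)
qed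

text \<open>Exchanging the two configurations on the component of \<open>v\<close> cancels all pairs for which this
  component stays inside \<open>B\<close>, hence all low-order terms.\<close>

lemma cross_difference:
  assumes V: "finite V" and E: "finite E" "\<forall>e\<in>E. card e = 2"
    and B: "B \<subseteq> V" "nbhd_verts E (k\<^sup>2) v \<subseteq> B"
  obtains Q :: "complex \<Rightarrow> complex" where "Q holomorphic_on UNIV"
    "\<And>z. Zin E a V v z * Zout E a B v z - Zout E a V v z * Zin E a B v z = z ^ k * Q z"
proof -
  define PI where "PI = {S. S \<subseteq> V \<and> v \<in> S} \<times> {S. S \<subseteq> B \<and> v \<notin> S}"
  define PO where "PO = {S. S \<subseteq> V \<and> v \<notin> S} \<times> {S. S \<subseteq> B \<and> v \<in> S}"
  define K where "K p = comp E (fst p \<union> snd p) v" for p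
  define ord where "ord p = card (fst p) + card (snd p)" for p :: "'a set \<times> 'a set"
  define wt where "wt p = complex_of_real (a ^ (cut E (fst p) + cut E (snd p)))" for p
  define near where "near p \<longleftrightarrow> K p \<subseteq> B" for p
  have finB: "finite B" using B V finite_subset by blast
  have fin: "finite PI" "finite PO" using V finB by (auto simp: PI_def PO_def)
  have memf: "finite (fst p) \<and> finite (snd p) \<and> v \<in> fst p \<union> snd p" if "p \<in> PI \<union> PO" for p
    using that V finB finite_subset by (fastforce simp: PI_def PO_def)
  have prodI: "Zin E a V v z * Zout E a B v z = (\<Sum>p\<in>PI. wt p * z ^ ord p)" for z :: complex
    unfolding cutsum_def PI_def sum_product sum.cartesian_product
    by (intro sum.cong) (auto simp: wt_def ord_def power_add)
  have prodO: "Zout E a V v z * Zin E a B v z = (\<Sum>p\<in>PO. wt p * z ^ ord p)" for z :: complex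
    unfolding cutsum_def PO_def sum_product sum.cartesian_product
    by (intro sum.cong) (auto simp: wt_def ord_def power_add)
  have sw: "K (swap (K p) p) = K p" "ord (swap (K p) p) = ord p" "wt (swap (K p) p) = wt p"
    if "p \<in> PI \<union> PO" for p
  proof -
    show "K (swap (K p) p) = K p" by (simp add: K_def swap_Un)
    show "ord (swap (K p) p) = ord p"
      using card_swap[of "fst p" "snd p"] memf[OF that] by (simp add: ord_def)
    show "wt (swap (K p) p) = wt p"
      using cut_swap[OF E, of v "fst p" "snd p" "K p"] memf[OF that] by (simp add: wt_def K_def)
  qed
  have vK: "v \<in> K p" for p by (simp add: K_def comp_def)
  have swIO: "swap (K p) p \<in> PO" if "p \<in> PI" "near p" for p
    using that vK[of p] B by (auto simp: PI_def PO_def swap_def near_def)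
  have swOI: "swap (K p) p \<in> PI" if "p \<in> PO" "near p" for p
    using that vK[of p] B by (auto simp: PI_def PO_def swap_def near_def)
  \<comment> \<open>\<open>K p\<close> depends only on the union of the pair, which the exchange
    preserves, so the exchange is an involution. It moves \<open>v\<close> to the other
    configuration, and when \<open>K p\<close> lies in \<open>B\<close> the configuration confined
    to \<open>B\<close> remains so.\<close>
  have nearsum: "(\<Sum>p\<in>{p\<in>PI. near p}. wt p * z ^ ord p) = (\<Sum>p\<in>{p\<in>PO. near p}. wt p * z ^ ord p)"
    for z
    by (rule sum.reindex_bij_witness[where i = "\<lambda>p. swap (K p) p" and j = "\<lambda>p. swap (K p) p"])
       (use swIO swOI in \<open>auto simp: sw swap_swap near_def\<close>)
  \<comment> \<open>A component that leaves \<open>B\<close> leaves the ball of radius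
    \<open>k\<^sup>2\<close>, which takes more than \<open>k\<close> vertices occupied in at least
    one of the two configurations.\<close>
  have far: "ord p \<ge> k" if "p \<in> PI \<union> PO" "\<not> near p" for p
  proof (rule ccontr)
    assume "\<not> ord p \<ge> k"
    moreover have "card (fst p \<union> snd p) \<le> ord p" unfolding ord_def by (rule card_Un_le)
    ultimately have "card (fst p \<union> snd p) \<le> k" by simp
    from comp_subset_ball[OF _ this, of E v] memf[OF that(1)] B that show False
      by (auto simp: near_def K_def)
  qed
  define Q where "Q z = (\<Sum>p\<in>{p\<in>PI. \<not> near p}. wt p * z ^ (ord p - k)) -
     (\<Sum>p\<in>{p\<in>PO. \<not> near p}. wt p * z ^ (ord p - k))" for z
  have split: "sum f P = sum f {p\<in>P. near p} + sum f {p\<in>P. \<not> near p}" if "finite P"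
    for P and f :: "'a set \<times> 'a set \<Rightarrow> complex"
    using that by (subst sum.union_disjoint[symmetric]) (auto intro: sum.cong)
  have fac: "(\<Sum>p\<in>{p\<in>P. \<not> near p}. wt p * z ^ ord p) =
      z ^ k * (\<Sum>p\<in>{p\<in>P. \<not> near p}. wt p * z ^ (ord p - k))" if "P \<subseteq> PI \<union> PO" for P z
    unfolding sum_distrib_left
  proof (rule sum.cong[OF refl])
    fix p assume "p \<in> {p \<in> P. \<not> near p}"
    hence "k \<le> ord p" using that by (intro far) auto
    hence "z ^ ord p = z ^ k * z ^ (ord p - k)" by (simp add: power_add[symmetric])
    thus "wt p * z ^ ord p = z ^ k * (wt p * z ^ (ord p - k))" by simp
  qed
  show ?thesis
  proof (rule that[of Q])
    show "Q holomorphic_on UNIV" unfolding Q_def by (intro holomorphic_intros)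
    show "Zin E a V v z * Zout E a B v z - Zout E a V v z * Zin E a B v z = z ^ k * Q z" for z
      unfolding prodI prodO split[OF fin(1)] split[OF fin(2)] nearsum Q_def right_diff_distrib
      by (simp add: fac)
  qed
qed

text \<open>Schwarz lemma for a zero of order \<open>k\<close>: the maximum modulus principle bounds
  \<open>f\<close> itself by \<open>M / \<rho> ^ k\<close> inside the circle of radius
  \<open>\<rho> < 1\<close>, and \<open>\<rho>\<close> then tends to 1.\<close>

lemma bound_power_factor:
  fixes f :: "complex \<Rightarrow> complex"
  assumes f: "f holomorphic_on ball 0 1" and M: "\<And>z. norm z < 1 \<Longrightarrow> norm (z ^ k * f z) \<le> M"
    and z: "norm z < 1"
  shows "norm (z ^ k * f z) \<le> M * norm z ^ k"
proof -
  have le: "norm (f z) \<le> M / \<rho> ^ k" if \<rho>: "norm z < \<rho>" "\<rho> < 1" for \<rho>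
  proof (rule maximum_modulus_frontier[of f "ball 0 \<rho>"])
    have \<rho>0: "\<rho> > 0" using \<rho> norm_ge_zero[of z] by linarith
    show "f holomorphic_on interior (ball 0 \<rho>)"
      using f \<rho> by (auto intro: holomorphic_on_subset)
    have "continuous_on (ball 0 1) f" using f holomorphic_on_imp_continuous_on by blast
    moreover have "cball (0::complex) \<rho> \<subseteq> ball 0 1" using \<rho> by auto
    ultimately show "continuous_on (closure (ball 0 \<rho>)) f"
      using \<rho>0 by (auto intro: continuous_on_subset)
    show "z \<in> ball 0 \<rho>" using \<rho> by simp
    fix w assume "w \<in> frontier (ball (0::complex) \<rho>)"
    hence w: "norm w = \<rho>" using \<rho>0 by (simp add: frontier_ball)
    from M[of w] w \<rho> show "norm (f w) \<le> M / \<rho> ^ k"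
      using \<rho>0 by (simp add: norm_mult norm_power field_simps)
  qed auto
  have "((\<lambda>\<rho>::real. M / \<rho> ^ k) \<longlongrightarrow> M / 1 ^ k) (at_left 1)"
    by (intro tendsto_intros) auto
  moreover have "eventually (\<lambda>\<rho>. \<rho> \<in> {norm z<..<1}) (at_left 1)"
    using z by (rule eventually_at_left_real)
  hence "eventually (\<lambda>\<rho>. norm (f z) \<le> M / \<rho> ^ k) (at_left 1)"
    by eventually_elim (use le in auto)
  ultimately have "norm (f z) \<le> M / 1 ^ k"
    by (intro tendsto_lowerbound) auto
  from mult_right_mono[OF this, of "norm z ^ k"] show ?thesis
    by (simp add: norm_mult norm_power mult.commute)
qed

text \<open>The difference of the two ratios vanishes to order \<open>k\<close> at 0 by
  \<open>cross_difference\<close>, and has modulus at most 2 because each ratio is bounded by 1 on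
  the disc. The estimate is independent of the size of the graph.\<close>

lemma ratio_local_complex:
  fixes z :: complex
  assumes V: "finite V" and E: "finite E" "\<forall>e\<in>E. e \<subseteq> V \<and> card e = 2" and a: "0 \<le> a" "a \<le> 1"
    and B: "B \<subseteq> V" "v \<in> B" "nbhd_verts E (k\<^sup>2) v \<subseteq> B" and z: "norm z < 1"
  shows "norm (Zin E a V v z / Zout E a V v z - Zin E a B v z / Zout E a B v z) \<le> 2 * norm z ^ k"
proof -
  from cross_difference[OF V E(1) _ B(1,3), of a] E obtain Q :: "complex \<Rightarrow> complex"
    where Q: "Q holomorphic_on UNIV"
    "\<And>z. Zin E a V v z * Zout E a B v z - Zout E a V v z * Zin E a B v z = z ^ k * Q z"
    by blast
  define f where "f w = Q w / (Zout E a V v w * Zout E a B v w)" for w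
  have vV: "v \<in> V" using B by auto
  note rV = ratio_bound_complex[OF V E a order_refl vV]
    and rB = ratio_bound_complex[OF V E a B(1,2)]
  have eq: "Zin E a V v w / Zout E a V v w - Zin E a B v w / Zout E a B v w = w ^ k * f w"
    if "norm w < 1" for w
    using rV(1)[OF that] rB(1)[OF that] Q(2)[of w] by (simp add: f_def field_simps)
  have q: "norm (Zin E a X v w / Zout E a X v w) \<le> 1"
    if "norm w < 1" "X = V \<or> X = B" for w :: complex and X
  proof -
    have "Zout E a X v w \<noteq> 0" "norm (Zin E a X v w) \<le> norm w * norm (Zout E a X v w)"
      using that rV[of w] rB[of w] by auto
    moreover have "norm w * norm (Zout E a X v w) \<le> 1 * norm (Zout E a X v w)"
      using that by (intro mult_right_mono) auto
    ultimately have "norm (Zin E a X v w) \<le> norm (Zout E a X v w)" by linarith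
    thus ?thesis using \<open>Zout E a X v w \<noteq> 0\<close> by (simp add: norm_divide)
  qed
  have "norm (z ^ k * f z) \<le> 2 * norm z ^ k"
  proof (rule bound_power_factor[OF _ _ z])
    have "Zout E a V v w * Zout E a B v w \<noteq> 0" if "w \<in> ball 0 1" for w :: complex
      using that rV(1)[of w] rB(1)[of w] by simp
    moreover have "(\<lambda>w. Zout E a V v w * Zout E a B v w) holomorphic_on ball 0 1"
      unfolding cutsum_def by (intro holomorphic_intros)
    moreover have "Q holomorphic_on ball 0 1" using Q(1) holomorphic_on_subset by blast
    ultimately show "f holomorphic_on ball 0 1"
      unfolding f_def by (intro holomorphic_on_divide) auto
    fix w :: complex assume w: "norm w < 1"
    show "norm (w ^ k * f w) \<le> 2"
      unfolding eq[OF w, symmetric]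
      using norm_triangle_ineq4[of "Zin E a V v w / Zout E a V v w"
        "Zin E a B v w / Zout E a B v w"]
        q[OF w, of V] q[OF w, of B] by simp
  qed
  thus ?thesis using eq[OF z] by simp
qed

lemma Zout_pos:
  fixes s :: real
  assumes "finite B" "0 \<le> a" "0 \<le> s"
  shows "Zout E a B v s \<ge> 1" "Zin E a B v s \<ge> 0"
proof -
  have "(\<Sum>S\<in>{{}}. a ^ cut E S * s ^ card S) \<le> (\<Sum>S\<in>{S. S \<subseteq> B \<and> v \<notin> S}. a ^ cut E S * s ^ card S)"
    using assms by (intro sum_mono2) auto
  thus "Zout E a B v s \<ge> 1" by (simp add: cutsum_def) (simp add: cut_def)
  show "Zin E a B v s \<ge> 0" unfolding cutsum_def using assms by (intro sum_nonneg) auto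
qed

lemma ratio_bound:
  fixes s :: real
  assumes V: "finite V" and E: "finite E" "\<forall>e\<in>E. e \<subseteq> V \<and> card e = 2" and a: "0 \<le> a" "a \<le> 1"
    and B: "B \<subseteq> V" "v \<in> B" and s: "0 \<le> s" "s < 1"
  shows "Zin E a B v s \<le> s * Zout E a B v s"
proof -
  have finB: "finite B" using B V finite_subset by blast
  have "norm (complex_of_real s) < 1" using s by simp
  from ratio_bound_complex(2)[OF V E a B this] show ?thesis
    using Zout_pos[OF finB a(1) s(1), of E v] s by (simp add: cutsum_of_real)
qed

lemma ratio_local:
  fixes s :: real
  assumes V: "finite V" and E: "finite E" "\<forall>e\<in>E. e \<subseteq> V \<and> card e = 2" and a: "0 \<le> a" "a \<le> 1"
    and B: "B \<subseteq> V" "v \<in> B" "nbhd_verts E (k\<^sup>2) v \<subseteq> B" and s: "0 \<le> s" "s < 1"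
  shows "\<bar>Zin E a V v s / Zout E a V v s - Zin E a B v s / Zout E a B v s\<bar> \<le> 2 * s ^ k"
proof -
  have "norm (complex_of_real s) < 1" using s by simp
  from ratio_local_complex[OF V E a B this] show ?thesis
    using s unfolding cutsum_of_real of_real_divide[symmetric] of_real_diff[symmetric] norm_of_real
    by simp
qed

section \<open>Dependence of the pressure on local structure\<close>

definition edges_in :: "'a set set \<Rightarrow> 'a set \<Rightarrow> nat" where
  "edges_in E S = card {e \<in> E. e \<subseteq> S}"

lemma regular_graphsD:
  assumes "E \<in> regular_graphs d n"
  shows "finite E" "\<forall>e\<in>E. e \<subseteq> {..<n} \<and> card e = 2" "\<And>v. v < n \<Longrightarrow> card {e \<in> E. v \<in> e} = d"
proof -
  show "\<forall>e\<in>E. e \<subseteq> {..<n} \<and> card e = 2" "\<And>v. v < n \<Longrightarrow> card {e \<in> E. v \<in> e} = d"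
    using assms by (auto simp: regular_graphs_def simple_graph_def)
  hence "E \<subseteq> Pow {..<n}" by auto
  thus "finite E" by (rule finite_subset) auto
qed

text \<open>Counting edge ends in \<open>S\<close>. This trades cuts, which see the edges leaving a
  ball, for edges inside \<open>S\<close>, which the induced subgraph on the ball
  determines.\<close>

lemma cut_regular:
  assumes E: "E \<in> regular_graphs d n" and S: "S \<subseteq> {..<n}"
  shows "cut E S + 2 * edges_in E S = d * card S"
proof -
  note r = regular_graphsD[OF E]
  have finS: "finite S" using S finite_subset by blast
  have "d * card S = (\<Sum>v\<in>S. card {e \<in> E. v \<in> e})"
    using r(3) S by (simp add: subset_iff)
  also have "\<dots> = (\<Sum>v\<in>S. \<Sum>e\<in>E. of_bool (v \<in> e))"
    using r(1) by (intro sum.cong) (auto simp: of_bool_def sum.If_cases Int_def)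
  also have "\<dots> = (\<Sum>e\<in>E. \<Sum>v\<in>S. of_bool (v \<in> e))" by (rule sum.swap)
  also have "\<dots> = (\<Sum>e\<in>E. of_bool (e \<inter> S \<noteq> {} \<and> \<not> e \<subseteq> S) + 2 * of_bool (e \<subseteq> S))"
  proof (rule sum.cong[OF refl])
    fix e assume "e \<in> E"
    then obtain x y where xy: "e = {x, y}" "x \<noteq> y" using r(2) by (auto simp: card_2_iff)
    have "(\<Sum>v\<in>S. of_bool (v \<in> e)) = card (S \<inter> e)"
      using finS by (simp add: of_bool_def sum.If_cases)
    also have "\<dots> = (\<Sum>v\<in>e. of_bool (v \<in> S))"
      using xy by (auto simp: Int_insert_right)
    finally show
      "(\<Sum>v\<in>S. of_bool (v \<in> e)) = of_bool (e \<inter> S \<noteq> {} \<and> \<not> e \<subseteq> S) + 2 * (of_bool (e \<subseteq> S) :: nat)"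
      using xy by auto
  qed
  also have "\<dots> = cut E S + 2 * edges_in E S"
    using r(1)
    by (simp add: sum.distrib cut_conv_sum edges_in_def sum_distrib_left[symmetric])
       (simp add: of_bool_def sum.If_cases Int_def)
  finally show ?thesis by simp
qed

section \<open>Tree-like balls and the ratio on the tree\<close>

definition good :: "nat \<Rightarrow> nat \<Rightarrow> 'a set set \<Rightarrow> 'a \<Rightarrow> bool" where
  "good d r E v \<longleftrightarrow>
     nbhd_iso E r v (nbhd_verts (tree_edges d) r []) (nbhd_edges (tree_edges d) r []) []"

definition nbad :: "nat \<Rightarrow> nat \<Rightarrow> nat \<Rightarrow> nat set set \<Rightarrow> nat" where
  "nbad d r n E = card {v. v < n \<and> \<not> good d r E v}"

text \<open>The exponent is the cut of \<open>S\<close> as given by \<open>cut_regular\<close>, as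
  if every vertex had degree \<open>d\<close>: boundary vertices may have smaller degree inside the
  ball, and their outer neighbours count as vacant. For a set of vertices of a
  \<open>d\<close>-regular graph the subtraction of natural numbers does not truncate.\<close>

definition ballsum :: "nat \<Rightarrow> 'a set set \<Rightarrow> real \<Rightarrow> 'a set set \<Rightarrow> real \<Rightarrow> real" where
  "ballsum d E a U s = (\<Sum>S\<in>U. a ^ (d * card S - 2 * edges_in E S) * s ^ card S)"

definition tree_ratio :: "nat \<Rightarrow> nat \<Rightarrow> real \<Rightarrow> real \<Rightarrow> real" where
  "tree_ratio d r a s =
     (let B = nbhd_verts (tree_edges d) r []; E = nbhd_edges (tree_edges d) r [] in
       ballsum d E a {S. S \<subseteq> B \<and> [] \<in> S} s / ballsum d E a {S. S \<subseteq> B \<and> [] \<notin> S} s)"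

lemma edges_in_iso:
  assumes f: "bij_betw f B B'" and iso: "\<forall>u\<in>B. \<forall>v\<in>B. {u, v} \<in> E \<longleftrightarrow> {f u, f v} \<in> E'"
    and E: "\<forall>e\<in>E. card e = 2" and E': "\<forall>e\<in>E'. card e = 2" and S: "S \<subseteq> B"
  shows "edges_in E S = edges_in E' (f ` S)"
proof -
  have inj: "inj_on f B" and im: "f ` B = B'" using f by (auto simp: bij_betw_def)
  have "bij_betw ((`) f) {e \<in> E. e \<subseteq> S} {e \<in> E'. e \<subseteq> f ` S}"
  proof (rule bij_betw_imageI)
    show "inj_on ((`) f) {e \<in> E. e \<subseteq> S}"
      using inj_on_image_Pow[OF inj] S by (rule_tac inj_on_subset) auto
    show "(`) f ` {e \<in> E. e \<subseteq> S} = {e \<in> E'. e \<subseteq> f ` S}"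
    proof (intro equalityI subsetI)
      fix e' assume "e' \<in> (`) f ` {e \<in> E. e \<subseteq> S}"
      then obtain e where e: "e \<in> E" "e \<subseteq> S" "e' = f ` e" by auto
      then obtain x y where "e = {x, y}" using E by (auto simp: card_2_iff)
      with e iso S show "e' \<in> {e \<in> E'. e \<subseteq> f ` S}" by auto
    next
      fix e' assume e': "e' \<in> {e \<in> E'. e \<subseteq> f ` S}"
      then obtain x y where xy: "e' = {x, y}" using E' by (auto simp: card_2_iff)
      with e' obtain u v where "x = f u" "y = f v" "u \<in> S" "v \<in> S" by auto
      with xy e' iso S have "{u, v} \<in> {e \<in> E. e \<subseteq> S}" "e' = f ` {u, v}" by auto
      thus "e' \<in> (`) f ` {e \<in> E. e \<subseteq> S}" by blast
    qed
  qed
  thus ?thesis unfolding edges_in_def by (rule bij_betw_same_card)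
qed

lemma ballsum_iso:
  assumes f: "bij_betw f B B'" and iso: "\<forall>u\<in>B. \<forall>v\<in>B. {u, v} \<in> E \<longleftrightarrow> {f u, f v} \<in> E'"
    and E: "\<forall>e\<in>E. card e = 2" and E': "\<forall>e\<in>E'. card e = 2"
    and P: "\<And>S. S \<subseteq> B \<Longrightarrow> P S \<longleftrightarrow> P' (f ` S)"
  shows "ballsum d E a {S. S \<subseteq> B \<and> P S} s = ballsum d E' a {S. S \<subseteq> B' \<and> P' S} s"
proof -
  have inj: "inj_on f B" and im: "f ` B = B'" using f by (auto simp: bij_betw_def)
  show ?thesis unfolding ballsum_def
  proof (rule sum.reindex_bij_betw[where h = "(`) f", symmetric, THEN trans, symmetric])
    show "bij_betw ((`) f) {S. S \<subseteq> B \<and> P S} {S. S \<subseteq> B' \<and> P' S}"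
    proof (rule bij_betw_imageI)
      show "inj_on ((`) f) {S. S \<subseteq> B \<and> P S}"
        using inj_on_image_Pow[OF inj] by (rule inj_on_subset) auto
      show "(`) f ` {S. S \<subseteq> B \<and> P S} = {S. S \<subseteq> B' \<and> P' S}"
      proof (intro equalityI subsetI)
        fix T assume "T \<in> {S. S \<subseteq> B' \<and> P' S}"
        moreover from this obtain S where "S \<subseteq> B" "T = f ` S"
          unfolding im[symmetric] by (auto simp: subset_image_iff)
        ultimately show "T \<in> (`) f ` {S. S \<subseteq> B \<and> P S}" using P by auto
      qed (use P im in auto)
    qed
    show "(\<Sum>S | S \<subseteq> B \<and> P S. a ^ (d * card (f ` S) - 2 * edges_in E' (f ` S)) * s ^ card (f ` S)) =
      (\<Sum>S | S \<subseteq> B \<and> P S. a ^ (d * card S - 2 * edges_in E S) * s ^ card S)"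
    proof (rule sum.cong[OF refl])
      fix S assume "S \<in> {S. S \<subseteq> B \<and> P S}"
      hence S: "S \<subseteq> B" by auto
      have "card (f ` S) = card S" using inj S by (meson card_image inj_on_subset)
      thus "a ^ (d * card (f ` S) - 2 * edges_in E' (f ` S)) * s ^ card (f ` S) =
        a ^ (d * card S - 2 * edges_in E S) * s ^ card S"
        using edges_in_iso[OF f iso E E' S] by simp
    qed
  qed
qed

lemma tree_edges_card: "\<forall>e\<in>tree_edges d. card e = 2"
  by (auto simp: tree_edges_def card_2_iff)

lemma nbhd_verts_subset:
  assumes E: "\<forall>e\<in>E. e \<subseteq> V" and v: "v \<in> V"
  shows "nbhd_verts E r v \<subseteq> V"
proof -
  have "u \<in> V" if "(v, u) \<in> adj_rel E ^^ k" for u k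
    using that
  proof (induction k arbitrary: u)
    case 0 thus ?case using v by simp
  next
    case (Suc k)
    then obtain w where "(w, u) \<in> adj_rel E" by auto
    thus ?case using E by (auto simp: adj_rel_def)
  qed
  thus ?thesis by (auto simp: nbhd_verts_def)
qed

lemma self_in_nbhd: "v \<in> nbhd_verts E r v"
  by (auto simp: nbhd_verts_def intro!: exI[of _ 0])

text \<open>All cuts of subsets of the ball are expressed by edges inside the ball, and the
  isomorphism with the tree ball carries these over. The ratio is therefore the same at all good
  vertices of all \<open>d\<close>-regular graphs.\<close>

lemma good_ratio:
  assumes E: "E \<in> regular_graphs d n" and v: "v < n" and g: "good d r E v"
  defines "B \<equiv> nbhd_verts E r v"
  shows "Zin E a B v s / Zout E a B v s = tree_ratio d r a s"
proof -
  note r = regular_graphsD[OF E]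
  have B: "B \<subseteq> {..<n}" unfolding B_def using r v by (intro nbhd_verts_subset) auto
  from g obtain f where f: "bij_betw f B (nbhd_verts (tree_edges d) r [])" "f v = []"
    and iso: "\<forall>u\<in>B. \<forall>w\<in>B. {u, w} \<in> nbhd_edges E r v \<longleftrightarrow> {f u, f w} \<in> nbhd_edges (tree_edges d) r []"
    unfolding good_def nbhd_iso_def rooted_iso_def B_def by blast
  have vB: "v \<in> B" unfolding B_def by (rule self_in_nbhd)
  have *: "cutsum E a {S. S \<subseteq> B \<and> P S} s = ballsum d (nbhd_edges E r v) a {S. S \<subseteq> B \<and> P S} s" for P
    unfolding cutsum_def ballsum_def
  proof (rule sum.cong[OF refl])
    fix S assume "S \<in> {S. S \<subseteq> B \<and> P S}"
    hence S: "S \<subseteq> B" by auto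
    have "edges_in (nbhd_edges E r v) S = edges_in E S"
      unfolding edges_in_def nbhd_edges_def using S
        by (intro arg_cong[where f = card]) (auto simp: B_def)
    moreover have "cut E S + 2 * edges_in E S = d * card S"
      using cut_regular[OF E, of S] S B by auto
    ultimately have "cut E S = d * card S - 2 * edges_in (nbhd_edges E r v) S" by simp
    thus "of_real (a ^ cut E S) * s ^ card S =
      a ^ (d * card S - 2 * edges_in (nbhd_edges E r v) S) * s ^ card S" by simp
  qed
  have inj: "inj_on f B" using f by (auto simp: bij_betw_def)
  have P: "v \<in> S \<longleftrightarrow> [] \<in> f ` S" if "S \<subseteq> B" for S
    using inj vB that f(2) by (metis inj_on_image_mem_iff)
  have c: "\<forall>e\<in>nbhd_edges E r v. card e = 2" "\<forall>e\<in>nbhd_edges (tree_edges d) r []. card e = 2"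
    using r(2) tree_edges_card by (auto simp: nbhd_edges_def)
  show ?thesis
    unfolding * tree_ratio_def Let_def
    using ballsum_iso[OF f(1) iso c, of "\<lambda>S. v \<in> S" "\<lambda>S. [] \<in> S" d a s]
      ballsum_iso[OF f(1) iso c, of "\<lambda>S. v \<notin> S" "\<lambda>S. [] \<notin> S" d a s] P
    by simp
qed

section \<open>The pressure as a function of the activity\<close>

definition psi :: "nat \<Rightarrow> nat set set \<Rightarrow> real \<Rightarrow> real \<Rightarrow> real" where
  "psi n E a s = ln (cutsum E a (Pow {..<n}) s) / real n"

lemma cutsum_Pow_split:
  assumes "finite V"
  shows "cutsum E a (Pow V) s = Zin E a V v s + Zout E a V v s"
proof -
  have "Pow V = {S. S \<subseteq> V \<and> v \<in> S} \<union> {S. S \<subseteq> V \<and> v \<notin> S}" by auto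
  thus ?thesis unfolding cutsum_def using assms by (simp, subst sum.union_disjoint) auto
qed

lemma cutsum_ge_1:
  assumes "finite V" "0 \<le> a" "(0::real) \<le> s"
  shows "cutsum E a (Pow V) s \<ge> 1"
  using Zout_pos[OF assms, of E undefined] cutsum_Pow_split[OF assms(1), of E a s undefined] by simp

text \<open>Counting pairs of a vertex and a set containing it: the logarithmic derivative in
  \<open>s\<close> is the expected number of occupied vertices divided by \<open>s\<close>.\<close>

lemma cutsum_has_derivative:
  assumes V: "finite V" and s: "s > (0::real)"
  shows "(cutsum E a (Pow V) has_real_derivative (\<Sum>v\<in>V. Zin E a V v s) / s) (at s)"
proof -
  have "(cutsum E a (Pow V) has_real_derivative
      (\<Sum>S\<in>Pow V. a ^ cut E S * (real (card S) * s ^ (card S - 1)))) (at s)"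
    unfolding cutsum_def by (auto intro!: derivative_eq_intros sum.cong)
  also have "(\<Sum>S\<in>Pow V. a ^ cut E S * (real (card S) * s ^ (card S - 1))) =
      (\<Sum>v\<in>V. Zin E a V v s) / s"
  proof -
    have "(\<Sum>v\<in>V. Zin E a V v s) = (\<Sum>v\<in>V. \<Sum>S\<in>Pow V. of_bool (v \<in> S) * (a ^ cut E S * s ^ card S))"
    proof (rule sum.cong[OF refl])
      fix v
      show "Zin E a V v s = (\<Sum>S\<in>Pow V. of_bool (v \<in> S) * (a ^ cut E S * s ^ card S))"
        unfolding cutsum_def using V by (intro sum.mono_neutral_cong_left) auto
    qed
    also have "\<dots> = (\<Sum>S\<in>Pow V. \<Sum>v\<in>V. of_bool (v \<in> S) * (a ^ cut E S * s ^ card S))"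
      by (rule sum.swap)
    also have "\<dots> = (\<Sum>S\<in>Pow V. s * (a ^ cut E S * (real (card S) * s ^ (card S - 1))))"
    proof (rule sum.cong[OF refl])
      fix S assume "S \<in> Pow V"
      hence "V \<inter> S = S" by auto
      hence "(\<Sum>v\<in>V. of_bool (v \<in> S) * (a ^ cut E S * s ^ card S)) = real (card S) * (a ^ cut E S * s ^ card S)"
        using V by (simp add: sum_distrib_right[symmetric] of_bool_def sum.If_cases)
      thus "(\<Sum>v\<in>V. of_bool (v \<in> S) * (a ^ cut E S * s ^ card S)) =
          s * (a ^ cut E S * (real (card S) * s ^ (card S - 1)))"
        by (cases "card S") auto
    qed
    finally show ?thesis using s by (simp add: sum_distrib_left[symmetric])
  qed
  finally show ?thesis .
qed

text \<open>A ratio \<open>R\<close> of occupied to vacant weight means an occupation probability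
  \<open>R / (1 + R)\<close> of the root. The cap makes the bound by \<open>s\<close> hold by
  definition, even where there is no good vertex to transfer it from a graph; true densities obey
  the same bound.\<close>

definition tree_density :: "nat \<Rightarrow> nat \<Rightarrow> real \<Rightarrow> real \<Rightarrow> real" where
  "tree_density d r a s = min s (tree_ratio d r a s / (1 + tree_ratio d r a s))"

lemma tree_ratio_nonneg: "0 \<le> a \<Longrightarrow> 0 \<le> s \<Longrightarrow> tree_ratio d r a s \<ge> 0"
  unfolding tree_ratio_def Let_def ballsum_def by (intro divide_nonneg_nonneg sum_nonneg) auto

lemma density_diff:
  fixes x y :: real
  assumes "0 \<le> x" "0 \<le> y"
  shows "\<bar>x / (1 + x) - y / (1 + y)\<bar> \<le> \<bar>x - y\<bar>"
proof -
  have "x / (1 + x) - y / (1 + y) = (x - y) / ((1 + x) * (1 + y))"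
    using assms by (simp add: field_simps)
  moreover have "1 \<le> (1 + x) * (1 + y)" using assms by (simp add: algebra_simps)
  hence "\<bar>x - y\<bar> / ((1 + x) * (1 + y)) \<le> \<bar>x - y\<bar> / 1" by (intro divide_left_mono) auto
  ultimately show ?thesis using assms by (simp add: abs_mult)
qed

text \<open>Both bounds carry a power of \<open>s\<close> because the density is divided by
  \<open>s\<close> in the derivative of the pressure; the first keeps bad vertices harmless near
  \<open>s = 0\<close>. In the second, \<open>x / (1 + x)\<close> is 1-Lipschitz, and capping at
  \<open>s\<close> cannot move away from \<open>p\<close>, which is itself at most
  \<open>s\<close>.\<close>

lemma vertex_density:
  assumes E: "E \<in> regular_graphs d n" and v: "v < n" and a: "0 \<le> a" "a \<le> 1" and s: "0 \<le> s" "s < 1"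
  defines "p \<equiv> Zin E a {..<n} v s / cutsum E a (Pow {..<n}) s"
  shows "\<bar>p - tree_density d (k\<^sup>2) a s\<bar> \<le> s"
    and "good d (k\<^sup>2) E v \<Longrightarrow> \<bar>p - tree_density d (k\<^sup>2) a s\<bar> \<le> 2 * s ^ k"
proof -
  note r = regular_graphsD[OF E]
  define R where "R = Zin E a {..<n} v s / Zout E a {..<n} v s"
  note pos = Zout_pos[OF finite_lessThan a(1) s(1), of E n v]
  have le: "Zin E a {..<n} v s \<le> s * Zout E a {..<n} v s"
    by (rule ratio_bound[OF _ r(1,2) a]) (use v s in auto)
  have R: "0 \<le> R" "R \<le> s" using pos le by (auto simp: R_def field_simps)
  have p: "p = R / (1 + R)"
    using pos unfolding p_def R_def cutsum_Pow_split[OF finite_lessThan, of _ _ _ _ v]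
    by (simp add: field_simps)
  have "R / (1 + R) \<le> R / 1" using R by (intro divide_left_mono) auto
  hence ps: "0 \<le> p" "p \<le> s" using R by (auto simp: p)
  have T: "tree_ratio d (k\<^sup>2) a s \<ge> 0" using a s by (intro tree_ratio_nonneg) auto
  hence td: "0 \<le> tree_density d (k\<^sup>2) a s" "tree_density d (k\<^sup>2) a s \<le> s"
    using s by (auto simp: tree_density_def)
  show "\<bar>p - tree_density d (k\<^sup>2) a s\<bar> \<le> s" using ps td by linarith
  assume g: "good d (k\<^sup>2) E v"
  have "\<bar>R - Zin E a (nbhd_verts E (k\<^sup>2) v) v s / Zout E a (nbhd_verts E (k\<^sup>2) v) v s\<bar> \<le> 2 * s ^ k"
    unfolding R_def
    by (rule ratio_local[OF _ r(1,2) a])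
       (use s v r self_in_nbhd nbhd_verts_subset[of E "{..<n}" v "k\<^sup>2"] in auto)
  hence "\<bar>R - tree_ratio d (k\<^sup>2) a s\<bar> \<le> 2 * s ^ k"
    unfolding good_ratio[OF E v g] .
  hence "\<bar>p - tree_ratio d (k\<^sup>2) a s / (1 + tree_ratio d (k\<^sup>2) a s)\<bar> \<le> 2 * s ^ k"
    using density_diff[OF R(1) T] p by linarith
  thus "\<bar>p - tree_density d (k\<^sup>2) a s\<bar> \<le> 2 * s ^ k"
    using ps unfolding tree_density_def min_def by (smt (verit))
qed

text \<open>Up to the division by \<open>s\<close>, the derivative is the average density. A good
  vertex contributes an error of at most \<open>2 * s ^ (k - 1)\<close>, a bad one at most 1, so the
  error sees the graph only through its fraction of bad vertices.\<close>

lemma psi_derivative: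
  assumes E: "E \<in> regular_graphs d n" and n: "n > 0" and a: "0 \<le> a" "a \<le> 1" and s: "0 < s" "s < 1"
    and k: "k > 0"
  obtains D where "((\<lambda>s. psi n E a s) has_real_derivative D) (at s)"
    and "\<bar>D - tree_density d (k\<^sup>2) a s / s\<bar> \<le> 2 * s ^ (k - 1) + real (nbad d (k\<^sup>2) n E) / real n"
proof -
  define P where "P = cutsum E a (Pow {..<n}) s"
  have P: "P \<ge> 1" unfolding P_def using a s by (intro cutsum_ge_1) auto
  define p where "p v = Zin E a {..<n} v s / P" for v
  define t where "t = tree_density d (k\<^sup>2) a s"
  define D where "D = (\<Sum>v<n. Zin E a {..<n} v s) / s / P / real n"
  have "((\<lambda>s. psi n E a s) has_real_derivative D) (at s)"
  proof -
    have "((\<lambda>s. ln (cutsum E a (Pow {..<n}) s)) has_real_derivative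
        1 / P * ((\<Sum>v<n. Zin E a {..<n} v s) / s)) (at s)"
      using DERIV_chain2[OF DERIV_ln_divide cutsum_has_derivative[of "{..<n}" s E a]] P s
      by (simp add: P_def)
    hence "((\<lambda>s. psi n E a s) has_real_derivative
        1 / P * ((\<Sum>v<n. Zin E a {..<n} v s) / s) / real n) (at s)"
      unfolding psi_def by (rule DERIV_cdivide)
    thus ?thesis by (simp add: D_def mult_ac)
  qed
  moreover have "\<bar>D - t / s\<bar> \<le> 2 * s ^ (k - 1) + real (nbad d (k\<^sup>2) n E) / real n"
  proof -
    have "D - t / s = (\<Sum>v<n. (p v - t) / s) / real n"
      using n s P by (simp add: D_def p_def sum_divide_distrib[symmetric] sum_subtractf field_simps)
    also have "\<bar>\<dots>\<bar> \<le> (\<Sum>v<n. \<bar>(p v - t) / s\<bar>) / real n"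
      unfolding abs_divide[of _ "real n"] abs_of_nat by (intro divide_right_mono sum_abs) simp
    also have "\<dots> \<le> (\<Sum>v<n. 2 * s ^ (k - 1) + of_bool (\<not> good d (k\<^sup>2) E v)) / real n"
    proof (intro divide_right_mono sum_mono)
      fix v assume "v \<in> {..<n}"
      hence v: "v < n" by simp
      note vd = vertex_density[OF E v a _ s(2), of k, folded P_def, folded p_def t_def]
      show "\<bar>(p v - t) / s\<bar> \<le> 2 * s ^ (k - 1) + of_bool (\<not> good d (k\<^sup>2) E v)"
      proof (cases "good d (k\<^sup>2) E v")
        case True
        have "\<bar>p v - t\<bar> \<le> 2 * s ^ k" using vd(2)[OF _ True] s by simp
        also have "\<dots> = 2 * s ^ (k - 1) * s" using k by (cases k) auto
        finally show ?thesis using s True by (simp add: divide_le_eq)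
      next
        case False
        have "\<bar>p v - t\<bar> / s \<le> 1" using vd(1) s by (simp add: divide_le_eq)
        moreover have "0 \<le> 2 * s ^ (k - 1)" using s by simp
        ultimately have "\<bar>p v - t\<bar> / s \<le> 2 * s ^ (k - 1) + 1" by linarith
        thus ?thesis using s False by simp
      qed
    qed simp
    also have "\<dots> = 2 * s ^ (k - 1) + real (nbad d (k\<^sup>2) n E) / real n"
    proof -
      have "(\<Sum>v<n. of_bool (\<not> good d (k\<^sup>2) E v)) = real (nbad d (k\<^sup>2) n E)"
        by (simp add: nbad_def of_bool_def sum.If_cases Int_def lessThan_def conj_commute)
      thus ?thesis using n by (simp add: sum.distrib add_divide_distrib)
    qed
    finally show ?thesis .
  qed
  ultimately show ?thesis using that t_def by blast
qed

text \<open>At activity 0 only the empty set contributes, so both pressures vanish there and the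
  mean value theorem bounds their difference at \<open>z\<close> by the difference of the
  derivatives. The errors are uniform on the way because \<open>z < 1\<close>.\<close>

lemma psi_close_lt_1:
  assumes a: "0 \<le> a" "a \<le> 1" and z: "0 < z" "z < 1" and \<eta>: "\<eta> > 0"
  shows "\<exists>r. \<exists>\<epsilon>::real. \<epsilon> > 0 \<and> (\<forall>n E n' E'. n > 0 \<longrightarrow> E \<in> regular_graphs d n \<longrightarrow> real (nbad d r n E) \<le> \<epsilon> * real n \<longrightarrow>
      n' > 0 \<longrightarrow> E' \<in> regular_graphs d n' \<longrightarrow> real (nbad d r n' E') \<le> \<epsilon> * real n' \<longrightarrow>
      \<bar>psi n E a z - psi n' E' a z\<bar> \<le> \<eta>)"
proof -
  \<comment> \<open>The two graphs contribute \<open>2 * z ^ k0\<close> each, which together must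
    stay below half of \<open>\<eta>\<close>; the other half goes to the two fractions of bad
    vertices, at most \<open>\<eta> / 4\<close> each. The shift from \<open>k0\<close> to
    \<open>k\<close> pays for the division by \<open>s\<close>.\<close>
  have "(\<lambda>k. 4 * z ^ k) \<longlonglongrightarrow> 4 * 0" using z by (intro tendsto_intros LIMSEQ_realpow_zero) auto
  hence "eventually (\<lambda>k. 4 * z ^ k < \<eta> / 2) sequentially"
    using \<eta> by (intro order_tendstoD(2)[of _ 0]) auto
  then obtain k0 where k0: "4 * z ^ k0 < \<eta> / 2" by (auto simp: eventually_sequentially)
  define k where "k = Suc k0"
  show ?thesis
  proof (rule exI[of _ "k\<^sup>2"], rule exI[of _ "\<eta> / 4"], intro conjI allI impI)
    show "\<eta> / 4 > 0" using \<eta> by simp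
    fix n n' :: nat and E E'
    assume n: "n > 0" "n' > 0" and E: "E \<in> regular_graphs d n" "E' \<in> regular_graphs d n'"
      and b: "real (nbad d (k\<^sup>2) n E) \<le> \<eta> / 4 * n" "real (nbad d (k\<^sup>2) n' E') \<le> \<eta> / 4 * n'"
    define g where "g s = psi n E a s - psi n' E' a s" for s
    have d: "\<exists>D. (g has_real_derivative D) (at s) \<and> \<bar>D\<bar> \<le> \<eta>" if s: "0 < s" "s < z" for s
    proof -
      have s': "0 < s" "s < 1" using s z by auto
      have kp: "k > 0" by (simp add: k_def)
      obtain D1 where D1: "((\<lambda>s. psi n E a s) has_real_derivative D1) (at s)"
        "\<bar>D1 - tree_density d (k\<^sup>2) a s / s\<bar> \<le> 2 * s ^ (k - 1) + real (nbad d (k\<^sup>2) n E) / real n"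
        using psi_derivative[OF E(1) n(1) a s' kp] .
      obtain D2 where D2: "((\<lambda>s. psi n' E' a s) has_real_derivative D2) (at s)"
        "\<bar>D2 - tree_density d (k\<^sup>2) a s / s\<bar> \<le> 2 * s ^ (k - 1) + real (nbad d (k\<^sup>2) n' E') / real n'"
        using psi_derivative[OF E(2) n(2) a s' kp] .
      have "s ^ (k - 1) \<le> z ^ k0" using s by (auto simp: k_def intro: power_mono)
      moreover have "real (nbad d (k\<^sup>2) n E) / real n \<le> \<eta> / 4"
        "real (nbad d (k\<^sup>2) n' E') / real n' \<le> \<eta> / 4"
        using b n by (auto simp: field_simps)
      ultimately have "\<bar>D1 - D2\<bar> \<le> \<eta>" using D1(2) D2(2) k0 by linarith
      thus ?thesis unfolding g_def using DERIV_diff[OF D1(1) D2(1)] by blast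
    qed
    have pos: "cutsum F a (Pow {..<m}) s \<noteq> 0" if "s \<ge> 0" for F :: "nat set set" and m and s :: real
      using cutsum_ge_1[of "{..<m}" a s F] a that by auto
    have "continuous_on {0..z} g"
      unfolding g_def psi_def cutsum_def
      by (intro continuous_intros) (use pos n in \<open>auto simp: cutsum_def\<close>)
    then obtain l c where lc: "0 < c" "c < z" "(g has_real_derivative l) (at c)"
      "g z - g 0 = (z - 0) * l"
      using MVT[of 0 z g] z d by (metis real_differentiable_def)
    have "g 0 = 0"
    proof -
      have "cutsum F a (Pow {..<m}) 0 = (1::real)" for F :: "nat set set" and m
      proof -
        have "cutsum F a (Pow {..<m}) (0::real) = (\<Sum>S\<in>{{}}. of_real (a ^ cut F S) * 0 ^ card S)"
          unfolding cutsum_def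
          by (intro sum.mono_neutral_right) (auto simp: card_gt_0_iff intro: finite_subset)
        thus ?thesis by (simp add: cut_def)
      qed
      thus ?thesis by (simp add: g_def psi_def)
    qed
    moreover have "\<bar>l\<bar> \<le> \<eta>" using d[OF lc(1,2)] lc(3) DERIV_unique by blast
    hence "z * \<bar>l\<bar> \<le> 1 * \<eta>" using z by (intro mult_mono) auto
    ultimately show "\<bar>psi n E a z - psi n' E' a z\<bar> \<le> \<eta>"
      using lc(4) z by (simp add: g_def abs_mult)
  qed
qed

lemma cut_Compl:
  assumes "\<forall>e\<in>E. e \<subseteq> V \<and> card e = 2"
  shows "cut E (V - S) = cut E S"
  unfolding cut_def by (rule arg_cong[where f = card]) (use assms in \<open>fastforce simp: card_2_iff\<close>)

text \<open>Complementing the occupied set preserves cuts, so a global spin flip maps activity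
  \<open>z\<close> to \<open>1 / z\<close> at the price of the factor \<open>z ^ n\<close>.\<close>

lemma psi_inverse:
  assumes E: "E \<in> regular_graphs d n" and n: "n > 0" and a: "0 \<le> a" and z: "z > 0"
  shows "psi n E a z = ln z + psi n E a (1 / z)"
proof -
  have "cutsum E a (Pow {..<n}) z = z ^ n * cutsum E a (Pow {..<n}) (1 / z)"
  proof -
    have "cutsum E a (Pow {..<n}) z = (\<Sum>S\<in>Pow {..<n}. a ^ cut E ({..<n} - S) * z ^ card ({..<n} - S))"
      unfolding cutsum_def of_real_eq_id id_def
      by (rule sum.reindex_bij_witness[where i = "\<lambda>S. {..<n} - S" and j = "\<lambda>S. {..<n} - S"])
         (auto simp: double_diff)
    also have "\<dots> = (\<Sum>S\<in>Pow {..<n}. z ^ n * (a ^ cut E S * (1 / z) ^ card S))"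
    proof (rule sum.cong[OF refl])
      fix S assume S: "S \<in> Pow {..<n}"
      hence f: "finite S" using finite_subset by auto
      have "card S \<le> n" using S card_mono[of "{..<n}" S] by auto
      hence "z ^ (n - card S) = z ^ n * (1 / z) ^ card S"
        using z by (simp add: power_diff power_divide)
      moreover have "card ({..<n} - S) = n - card S" using S f by (subst card_Diff_subset) auto
      ultimately show
        "a ^ cut E ({..<n} - S) * z ^ card ({..<n} - S) = z ^ n * (a ^ cut E S * (1 / z) ^ card S)"
        using cut_Compl[OF regular_graphsD(2)[OF E]] by simp
    qed
    finally show ?thesis by (simp add: cutsum_def sum_distrib_left)
  qed
  moreover have "cutsum E a (Pow {..<n}) (1 / z) \<ge> 1" using a z by (intro cutsum_ge_1) auto
  ultimately show ?thesis
    using z n by (simp add: psi_def ln_mult ln_realpow add_divide_distrib)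
qed

text \<open>A configuration has at most \<open>n\<close> occupied vertices, so raising the activity
  multiplies each term by at most \<open>(t / s) ^ n\<close>. This remains valid at activity 1,
  where the analytic argument stops.\<close>

lemma psi_lipschitz:
  assumes n: "n > 0" and a: "0 \<le> a" and s: "0 < s" "s \<le> t"
  shows "psi n E a s \<le> psi n E a t" "psi n E a t \<le> psi n E a s + ln (t / s)"
proof -
  have 1: "cutsum E a (Pow {..<n}) s \<ge> 1" "cutsum E a (Pow {..<n}) t \<ge> 1"
    using a s by (auto intro!: cutsum_ge_1)
  have "cutsum E a (Pow {..<n}) s \<le> cutsum E a (Pow {..<n}) t"
    unfolding cutsum_def using a s by (auto intro!: sum_mono mult_left_mono power_mono)
  thus "psi n E a s \<le> psi n E a t" using 1 by (simp add: psi_def divide_right_mono)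
  have "cutsum E a (Pow {..<n}) t \<le> (t / s) ^ n * cutsum E a (Pow {..<n}) s"
    unfolding cutsum_def sum_distrib_left
  proof (rule sum_mono)
    fix S assume S: "S \<in> Pow {..<n}"
    have "card S \<le> n" using S card_mono[of "{..<n}" S] by auto
    moreover have "1 \<le> t / s" using s by simp
    ultimately have "(t / s) ^ card S \<le> (t / s) ^ n" by (rule power_increasing)
    hence "(t / s) ^ card S * s ^ card S \<le> (t / s) ^ n * s ^ card S"
      using s by (intro mult_right_mono) auto
    hence "t ^ card S \<le> (t / s) ^ n * s ^ card S" using s by (simp add: power_divide)
    hence "a ^ cut E S * t ^ card S \<le> a ^ cut E S * ((t / s) ^ n * s ^ card S)"
      using a by (intro mult_left_mono) auto
    thus "of_real (a ^ cut E S) * t ^ card S \<le> (t / s) ^ n * (of_real (a ^ cut E S) * s ^ card S)"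
      by (simp add: mult_ac)
  qed
  hence "ln (cutsum E a (Pow {..<n}) t) \<le> ln ((t / s) ^ n * cutsum E a (Pow {..<n}) s)"
    using 1 by (intro ln_mono) auto
  also have "\<dots> = n * ln (t / s) + ln (cutsum E a (Pow {..<n}) s)"
    using 1 s by (subst ln_mult) (auto simp: ln_realpow)
  finally show "psi n E a t \<le> psi n E a s + ln (t / s)"
    using n by (simp add: psi_def field_simps)
qed

text \<open>Activities above 1 are reflected by \<open>psi_inverse\<close>. At \<open>z = 1\<close>
  the disc bound gives nothing, and the comparison is made at a slightly smaller activity.\<close>

lemma psi_close:
  assumes a: "0 \<le> a" "a \<le> 1" and z: "0 < z" and \<eta>: "\<eta> > 0"
  shows "\<exists>r. \<exists>\<epsilon>::real. \<epsilon> > 0 \<and> (\<forall>n E n' E'. n > 0 \<longrightarrow> E \<in> regular_graphs d n \<longrightarrow> real (nbad d r n E) \<le> \<epsilon> * real n \<longrightarrow>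
      n' > 0 \<longrightarrow> E' \<in> regular_graphs d n' \<longrightarrow> real (nbad d r n' E') \<le> \<epsilon> * real n' \<longrightarrow>
      \<bar>psi n E a z - psi n' E' a z\<bar> \<le> \<eta>)"
proof -
  consider "z < 1" | "z = 1" | "z > 1" by linarith
  thus ?thesis
  proof cases
    case 1
    show ?thesis by (rule psi_close_lt_1[OF a z 1 \<eta>])
  next
    case 2
    \<comment> \<open>By monotonicity the pressure at 1 exceeds the one at \<open>s\<close> by at
      least 0 and at most \<open>\<eta> / 2\<close>. As both graphs err in the same direction, only
      \<open>\<eta> / 2\<close> is added to their difference.\<close>
    define s where "s = exp (- \<eta> / 2)"
    have s: "0 < s" "s < 1" using \<eta> by (auto simp: s_def)
    have ls: "ln (1 / s) = \<eta> / 2" by (simp add: s_def ln_div)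
    from psi_close_lt_1[OF a s, of "\<eta> / 2" d] \<eta> obtain r and \<epsilon> :: real where "\<epsilon> > 0"
      and *: "\<forall>n E n' E'. n > 0 \<longrightarrow> E \<in> regular_graphs d n \<longrightarrow> real (nbad d r n E) \<le> \<epsilon> * real n \<longrightarrow>
        n' > 0 \<longrightarrow> E' \<in> regular_graphs d n' \<longrightarrow> real (nbad d r n' E') \<le> \<epsilon> * real n' \<longrightarrow>
        \<bar>psi n E a s - psi n' E' a s\<bar> \<le> \<eta> / 2"
      by auto
    have "\<bar>psi n E a z - psi n' E' a z\<bar> \<le> \<eta>"
      if "n > 0" "E \<in> regular_graphs d n" "real (nbad d r n E) \<le> \<epsilon> * real n"
        "n' > 0" "E' \<in> regular_graphs d n'" "real (nbad d r n' E') \<le> \<epsilon> * real n'" for n E n' E'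
    proof -
      have "\<bar>psi n E a s - psi n' E' a s\<bar> \<le> \<eta> / 2" using * that by blast
      moreover have "s \<le> 1" using s by simp
      note psi_lipschitz[OF that(1) a(1) s(1) this, of E] psi_lipschitz[OF that(4) a(1) s(1) this, of E']
      ultimately show ?thesis using ls unfolding 2 by linarith
    qed
    with \<open>\<epsilon> > 0\<close> show ?thesis by blast
  next
    case 3
    have z': "0 < 1 / z" "1 / z < 1" using 3 by auto
    from psi_close_lt_1[OF a z' \<eta>, of d] show ?thesis
      using psi_inverse[OF _ _ a(1) z] by (metis (no_types, lifting) add_diff_cancel_left)
  qed
qed

section \<open>Non-backtracking walks and cycles\<close>

definition nbrs :: "'a set set \<Rightarrow> 'a \<Rightarrow> 'a set" where
  "nbrs E u = {w. {u, w} \<in> E}"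

abbreviation walk :: "'a set set \<Rightarrow> 'a list \<Rightarrow> bool" where
  "walk E \<equiv> successively (\<lambda>a b. {a, b} \<in> E)"

definition nonback :: "'a list \<Rightarrow> bool" where
  "nonback ws \<longleftrightarrow> (\<forall>i. Suc (Suc i) < length ws \<longrightarrow> ws ! i \<noteq> ws ! Suc (Suc i))"

text \<open>The list fixes a starting vertex and a direction, so one cycle has several
  representations. The closing edge between last and first vertex is the one that switchings
  remove.\<close>

definition cyc :: "'a set set \<Rightarrow> 'a list \<Rightarrow> bool" where
  "cyc E c \<longleftrightarrow> distinct c \<and> length c \<ge> 3 \<and> walk E c \<and> {last c, hd c} \<in> E"

text \<open>The closest repetition in the walk is at distance at least 3, since distance 1 would be
  a loop and distance 2 a backtracking step; by minimality the vertices from one occurrence up to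
  the next are distinct and form the cycle.\<close>

lemma nonback_cycle:
  assumes w: "walk E ws" and nb: "nonback ws" and nd: "\<not> distinct ws" and loop: "\<And>a. {a} \<notin> E"
  obtains c where "cyc E c" "set c \<subseteq> set ws" "length c < length ws"
proof -
  have e: "{ws ! i, ws ! Suc i} \<in> E" if "Suc i < length ws" for i
    using w that by (simp add: successively_conv_nth)
  define P where "P l \<longleftrightarrow> l > 0 \<and> (\<exists>i. i + l < length ws \<and> ws ! i = ws ! (i + l))" for l
  from nd obtain i j where "i < length ws" "j < length ws" "i \<noteq> j" "ws ! i = ws ! j"
    by (auto simp: distinct_conv_nth)
  hence "P (max i j - min i j)" by (auto simp: P_def max_def min_def intro: exI[of _ "min i j"])
  define l where "l = (LEAST l. P l)"
  have "P l" unfolding l_def by (rule LeastI) fact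
  then obtain i where i: "i + l < length ws" "ws ! i = ws ! (i + l)" "l > 0" by (auto simp: P_def)
  have least: "\<not> P m" if "m < l" for m using that not_less_Least unfolding l_def by blast
  have l3: "l \<ge> 3"
  proof (rule ccontr)
    assume "\<not> l \<ge> 3"
    with i have "l = 1 \<or> l = 2" by linarith
    thus False
    proof
      assume "l = 1" thus False using e[of i] i loop by auto
    next
      assume "l = 2" thus False using nb i by (auto simp: nonback_def)
    qed
  qed
  define c where "c = take l (drop i ws)"
  have len: "length c = l" using i by (simp add: c_def)
  have nth: "c ! t = ws ! (i + t)" if "t < l" for t using that i by (simp add: c_def)
  show ?thesis
  proof
    have "distinct c"
      unfolding distinct_conv_nth
    proof (intro allI impI notI)
      fix s t assume st: "s < length c" "t < length c" "s \<noteq> t" "c ! s = c ! t"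
      have "P (max s t - min s t)"
        unfolding P_def using st i len nth
        by (intro conjI exI[of _ "i + min s t"]) (auto simp: max_def min_def)
      moreover have "max s t - min s t < l" using st len by auto
      ultimately show False using least by blast
    qed
    moreover have "walk E c"
      unfolding successively_conv_nth using e i by (auto simp: len nth)
    moreover have "last c = ws ! (i + l - 1)" "hd c = ws ! i"
    proof -
      have "c \<noteq> []" using len l3 by auto
      thus "last c = ws ! (i + l - 1)" "hd c = ws ! i"
        using nth[of "l - 1"] nth[of 0] len l3 by (simp_all add: last_conv_nth hd_conv_nth)
    qed
    moreover have "{ws ! (i + l - 1), ws ! i} \<in> E" using e[of "i + l - 1"] i l3 by simp
    ultimately show "cyc E c" using len l3 by (simp add: cyc_def)
    show "set c \<subseteq> set ws" unfolding c_def by (meson order_trans set_drop_subset set_take_subset)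
    show "length c < length ws" using len i l3 by simp
  qed
qed

lemma nonback_join:
  assumes a: "nonback (u # xs)" and b: "nonback (u # ys)" and h: "xs \<noteq> [] \<Longrightarrow> ys \<noteq> [] \<Longrightarrow> hd xs \<noteq> hd ys"
  shows "nonback (rev xs @ u # ys)"
  unfolding nonback_def
proof (intro allI impI)
  fix i let ?w = "rev xs @ u # ys" and ?m = "length xs"
  assume i: "Suc (Suc i) < length ?w"
  have n1: "?w ! j = (u # xs) ! (?m - j)" if "j \<le> ?m" for j
    using that by (cases "?m - j") (auto simp: nth_append rev_nth Suc_diff_Suc le_imp_diff_is_add)
  have n2: "?w ! j = (u # ys) ! (j - ?m)" if "j \<ge> ?m" for j
    using that by (auto simp: nth_append)
  consider "Suc (Suc i) \<le> ?m" | "i \<ge> ?m" | "Suc i = ?m" by linarith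
  thus "?w ! i \<noteq> ?w ! Suc (Suc i)"
  proof cases
    case 1
    define t where "t = ?m - Suc (Suc i)"
    have "?m - i = Suc (Suc t)" "Suc (Suc t) < length (u # xs)" using 1 by (auto simp: t_def)
    with a have "(u # xs) ! t \<noteq> (u # xs) ! (?m - i)" by (simp add: nonback_def)
    thus ?thesis using n1[of i] n1[of "Suc (Suc i)"] 1 by (simp add: t_def)
  next
    case 2
    have *: "Suc (Suc i) - ?m = Suc (Suc (i - ?m))" "Suc (Suc (i - ?m)) < length (u # ys)"
      using 2 i by auto
    with b have "(u # ys) ! (i - ?m) \<noteq> (u # ys) ! Suc (Suc (i - ?m))" by (simp add: nonback_def)
    thus ?thesis using n2[of i] n2[of "Suc (Suc i)"] 2 * by simp
  next
    case 3
    have "ys \<noteq> []" "xs \<noteq> []" using 3 i by auto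
    moreover have "?w ! i = hd xs" using n1[of i] 3 \<open>xs \<noteq> []\<close> by (simp add: hd_conv_nth)
    moreover have "?w ! Suc (Suc i) = hd ys" using n2[of "Suc (Suc i)"] 3 \<open>ys \<noteq> []\<close>
      by (simp add: hd_conv_nth)
    ultimately show ?thesis using h by simp
  qed
qed

text \<open>A state is a pair of the previous and the current vertex; the letter \<open>i\<close> selects the
  \<open>i\<close>-th neighbour of the current vertex other than the previous one.\<close>

definition step :: "nat set set \<Rightarrow> nat \<times> nat \<Rightarrow> nat \<Rightarrow> nat \<times> nat" where
  "step E s i = (snd s, sorted_list_of_set (nbrs E (snd s) - {fst s}) ! i)"

fun valid :: "nat set set \<Rightarrow> nat \<times> nat \<Rightarrow> nat list \<Rightarrow> bool" where
  "valid E s [] = True"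
| "valid E s (i # xs) = (i < card (nbrs E (snd s) - {fst s}) \<and> valid E (step E s i) xs)"

fun track :: "nat set set \<Rightarrow> nat \<times> nat \<Rightarrow> nat list \<Rightarrow> nat list" where
  "track E s [] = [snd s]"
| "track E s (i # xs) = snd s # track E (step E s i) xs"

abbreviation endpt :: "nat set set \<Rightarrow> nat \<times> nat \<Rightarrow> nat list \<Rightarrow> nat" where
  "endpt E s xs \<equiv> snd (foldl (step E) s xs)"

lemma length_track [simp]: "length (track E s xs) = Suc (length xs)"
  by (induction xs arbitrary: s) auto

lemma hd_track [simp]: "hd (track E s xs) = snd s"
  by (cases xs) auto

lemma track_nonempty [simp]: "track E s xs \<noteq> []"
  by (cases xs) auto

lemma last_track: "last (track E s xs) = endpt E s xs"
  by (induction xs arbitrary: s) auto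

lemma fst_step [simp]: "fst (step E s i) = snd s"
  by (simp add: step_def)

lemma step_nbr:
  assumes "finite E" "i < card (nbrs E (snd s) - {fst s})"
  shows "snd (step E s i) \<in> nbrs E (snd s) - {fst s}"
proof -
  have "finite (nbrs E (snd s) - {fst s})" using assms(2) card_gt_0_iff by fastforce
  thus ?thesis using assms(2)
    by (metis length_sorted_list_of_set nth_mem set_sorted_list_of_set snd_conv step_def)
qed

lemma step_inj:
  assumes "i < card (nbrs E (snd s) - {fst s})" "j < card (nbrs E (snd s) - {fst s})" "i \<noteq> j"
  shows "snd (step E s i) \<noteq> snd (step E s j)"
  using assms nth_eq_iff_index_eq[OF distinct_sorted_list_of_set, of i "nbrs E (snd s) - {fst s}" j]
  by (simp add: step_def)

lemma step_surj:
  assumes "finite (nbrs E (snd s))" "w \<in> nbrs E (snd s) - {fst s}"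
  obtains i where "i < card (nbrs E (snd s) - {fst s})" "snd (step E s i) = w"
proof -
  have "w \<in> set (sorted_list_of_set (nbrs E (snd s) - {fst s}))" using assms by simp
  then obtain i where "i < card (nbrs E (snd s) - {fst s})"
    "sorted_list_of_set (nbrs E (snd s) - {fst s}) ! i = w"
    by (auto simp: in_set_conv_nth)
  thus ?thesis using that by (simp add: step_def)
qed

lemma valid_snoc:
  "valid E s (xs @ [i]) \<longleftrightarrow> valid E s xs \<and>
     i < card (nbrs E (endpt E s xs) - {fst (foldl (step E) s xs)})"
  by (induction xs arbitrary: s) auto

lemma track_walk:
  assumes "finite E" "valid E s xs"
  shows "walk E (track E s xs)"
  using assms(2)
proof (induction xs arbitrary: s)
  case (Cons i xs)
  have "{snd s, snd (step E s i)} \<in> E" using step_nbr[OF assms(1), of i s] Cons.prems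
    by (auto simp: nbrs_def)
  moreover have "walk E (track E (step E s i) xs)" using Cons by simp
  ultimately show ?case by (simp add: successively_Cons)
qed simp

lemma track_nonback:
  assumes "finite E" "valid E s xs"
  shows "nonback (fst s # track E s xs)"
  using assms(2)
proof (induction xs arbitrary: s)
  case Nil thus ?case by (simp add: nonback_def)
next
  case (Cons i xs)
  let ?t = "track E (step E s i) xs"
  have IH: "nonback (snd s # ?t)" using Cons.IH[of "step E s i"] Cons.prems by simp
  have "snd (step E s i) \<noteq> fst s" using step_nbr[OF assms(1), of i s] Cons.prems by auto
  moreover have "?t ! 0 = snd (step E s i)" using hd_conv_nth[of ?t] by simp
  ultimately have "fst s \<noteq> ?t ! 0" by simp
  show ?case
    unfolding nonback_def
  proof (intro allI impI)
    fix j assume j: "Suc (Suc j) < length (fst s # track E s (i # xs))"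
    show "(fst s # track E s (i # xs)) ! j \<noteq> (fst s # track E s (i # xs)) ! Suc (Suc j)"
    proof (cases j)
      case 0 thus ?thesis using \<open>fst s \<noteq> ?t ! 0\<close> by simp
    next
      case (Suc j')
      thus ?thesis using IH j by (auto simp: nonback_def)
    qed
  qed
qed

lemma nonback_tl: "nonback (x # xs) \<Longrightarrow> nonback xs"
  by (auto simp: nonback_def)

lemma track_in_ball:
  assumes "finite E" "valid E s xs" "u \<in> set (track E s xs)"
  shows "u \<in> nbhd_verts E (length xs) (snd s)"
proof -
  have "\<exists>k\<le>length xs. (snd s, u) \<in> adj_rel E ^^ k"
    using assms(2,3)
  proof (induction xs arbitrary: s)
    case Nil thus ?case by auto
  next
    case (Cons i xs)
    show ?case
    proof (cases "u = snd s")
      case True thus ?thesis by (intro exI[of _ 0]) auto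
    next
      case False
      then obtain k where k: "k \<le> length xs" "(snd (step E s i), u) \<in> adj_rel E ^^ k"
        using Cons.IH[of "step E s i"] Cons.prems by auto
      have "(snd s, snd (step E s i)) \<in> adj_rel E"
        using step_nbr[OF assms(1), of i s] Cons.prems by (auto simp: nbrs_def adj_rel_def)
      from relpow_Suc_I2[OF this k(2)] k(1) show ?thesis by (intro exI[of _ "Suc k"]) simp
    qed
  qed
  thus ?thesis by (simp add: nbhd_verts_def)
qed

text \<open>A common first letter is stripped by induction. At the first divergence the tracks leave
  through different neighbours, so running one backwards and then the other does not backtrack; the
  common endpoint is repeated, and \<open>nonback_cycle\<close> applies. If one word is exhausted,
  the other track is closed.\<close>

lemma two_tracks_cycle:
  assumes E: "finite E" "\<And>a. {a} \<notin> E"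
    and "valid E s xs" "valid E s ys" "xs \<noteq> ys" "endpt E s xs = endpt E s ys"
  shows "\<exists>c. cyc E c \<and> length c \<le> length xs + length ys \<and> set c \<subseteq> set (track E s xs) \<union> set (track E s ys)"
  using assms(3-)
proof (induction xs arbitrary: s ys)
  case Nil
  hence ne: "ys \<noteq> []" by auto
  define B where "B = track E s ys"
  have "walk E B" "nonback B"
    using track_walk[OF E(1) Nil.prems(2)] nonback_tl[OF track_nonback[OF E(1) Nil.prems(2)]]
      by (auto simp: B_def)
  moreover have "\<not> distinct B"
  proof -
    have "hd B = last B" using Nil.prems by (simp add: B_def last_track)
    moreover have "B \<noteq> []" "tl B \<noteq> []" using ne by (cases ys; simp add: B_def)+
    ultimately show ?thesis by (metis distinct.simps(2) last_in_set last_tl list.collapse)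
  qed
  ultimately obtain c where "cyc E c" "set c \<subseteq> set B" "length c < length B"
    using nonback_cycle[of E B] E(2) by blast
  thus ?case by (intro exI[of _ c]) (auto simp: B_def)
next
  case (Cons i xs)
  show ?case
  proof (cases "\<exists>ys'. ys = i # ys'")
    case True
    then obtain ys' where ys: "ys = i # ys'" by auto
    from Cons.IH[of "step E s i" ys'] Cons.prems ys obtain c where "cyc E c"
      "length c \<le> length xs + length ys'"
      "set c \<subseteq> set (track E (step E s i) xs) \<union> set (track E (step E s i) ys')" by auto
    thus ?thesis by (intro exI[of _ c]) (auto simp: ys)
  next
    case False
    define A where "A = track E (step E s i) xs"
    define B where "B = track E s ys"
    define W where "W = rev A @ snd s # tl B"
    have B: "B = snd s # tl B" by (metis B_def hd_track list.collapse track_nonempty)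
    have vA: "walk E (snd s # A)" "nonback (snd s # A)"
      using track_walk[OF E(1) Cons.prems(1)] nonback_tl[OF track_nonback[OF E(1) Cons.prems(1)]]
        by (auto simp: A_def)
    have vB: "walk E (snd s # tl B)" "nonback (snd s # tl B)"
      using track_walk[OF E(1) Cons.prems(2)] nonback_tl[OF track_nonback[OF E(1) Cons.prems(2)]] B
      by (auto simp: B_def)
    have "nonback W"
      unfolding W_def
    proof (rule nonback_join[OF vA(2) vB(2)])
      assume "tl B \<noteq> []"
      then obtain j ys' where ys: "ys = j # ys'" by (cases ys) (auto simp: B_def)
      have "i \<noteq> j" using False ys by auto
      thus "hd A \<noteq> hd (tl B)" using step_inj[of i E s j] Cons.prems ys by (simp add: A_def B_def)
    qed
    moreover have "walk E W"
    proof -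
      have sym: "(\<lambda>a b. {b, a} \<in> E) = (\<lambda>a b. {a, b} \<in> E)" by (auto simp: insert_commute)
      have "walk E (rev (snd s # A))" unfolding successively_rev sym by (rule vA(1))
      hence "walk E (rev A @ [snd s])" by simp
      thus ?thesis using vB(1) unfolding W_def
        by (auto simp: successively_append_iff successively_Cons)
    qed
    moreover have "\<not> distinct W"
    proof -
      have "last A = last B" using Cons.prems by (simp add: A_def B_def last_track)
      moreover have "last A \<in> set (rev A)" "last B \<in> set (snd s # tl B)" using B
        by (auto simp: A_def B_def)
      ultimately show ?thesis unfolding W_def distinct_append by auto
    qed
    ultimately obtain c where c: "cyc E c" "set c \<subseteq> set W" "length c < length W"
      using nonback_cycle[of E W] E(2) by blast
    have "set W \<subseteq> set A \<union> set B" unfolding W_def by (subst (2) B) auto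
    moreover have "length W = Suc (length xs) + Suc (length ys)" by (simp add: W_def A_def B_def)
    ultimately show ?thesis using c by (intro exI[of _ c]) (auto simp: A_def B_def)
  qed
qed

section \<open>Short cycles and tree-like balls\<close>

lemma rooted_iso_sym:
  assumes "rooted_iso V E x V' E' x'" "x \<in> V"
  shows "rooted_iso V' E' x' V E x"
proof -
  from assms obtain f where f: "bij_betw f V V'" "f x = x'"
    and iso: "\<forall>u\<in>V. \<forall>v\<in>V. {u, v} \<in> E \<longleftrightarrow> {f u, f v} \<in> E'"
    by (auto simp: rooted_iso_def)
  define g where "g = the_inv_into V f"
  have inj: "inj_on f V" and im: "f ` V = V'" using f by (auto simp: bij_betw_def)
  have "bij_betw g V' V" unfolding g_def by (rule bij_betw_the_inv_into[OF f(1)])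
  moreover have "g x' = x" unfolding g_def f(2)[symmetric]
    by (rule the_inv_into_f_f[OF inj assms(2)])
  moreover have "{u, v} \<in> E' \<longleftrightarrow> {g u, g v} \<in> E" if "u \<in> V'" "v \<in> V'" for u v
  proof -
    have "g u \<in> V" "g v \<in> V" "f (g u) = u" "f (g v) = v"
      using that im by (auto simp: g_def the_inv_into_into[OF inj] f_the_inv_into_f[OF inj])
    thus ?thesis using iso by metis
  qed
  ultimately show ?thesis unfolding rooted_iso_def by blast
qed

lemma rooted_iso_trans:
  assumes "rooted_iso V E x V' E' x'" "rooted_iso V' E' x' V'' E'' x''"
  shows "rooted_iso V E x V'' E'' x''"
proof -
  from assms obtain f g where f: "bij_betw f V V'" "f x = x'" "bij_betw g V' V''" "g x' = x''"
    and iso: "\<forall>u\<in>V. \<forall>v\<in>V. {u, v} \<in> E \<longleftrightarrow> {f u, f v} \<in> E'"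
      "\<forall>u\<in>V'. \<forall>v\<in>V'. {u, v} \<in> E' \<longleftrightarrow> {g u, g v} \<in> E''"
    by (auto simp: rooted_iso_def)
  have "bij_betw (g \<circ> f) V V''" using f bij_betw_trans by blast
  moreover have "\<forall>u\<in>V. \<forall>v\<in>V. {u, v} \<in> E \<longleftrightarrow> {(g \<circ> f) u, (g \<circ> f) v} \<in> E''"
    using iso f(1) by (auto simp: bij_betw_def)
  ultimately show ?thesis unfolding rooted_iso_def using f by (intro exI[of _ "g \<circ> f"]) auto
qed

lemma nbhd_verts_mono: "k \<le> l \<Longrightarrow> nbhd_verts E k v \<subseteq> nbhd_verts E l v"
  unfolding nbhd_verts_def by (auto dest: order_trans)

lemma adj_rel_sym: "(u, w) \<in> adj_rel E \<longleftrightarrow> (w, u) \<in> adj_rel E"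
  by (simp add: adj_rel_def insert_commute)

lemma adj_relpow_sym: "(u, w) \<in> adj_rel E ^^ k \<Longrightarrow> (w, u) \<in> adj_rel E ^^ k"
proof (induction k arbitrary: w)
  case (Suc k)
  then obtain y where "(u, y) \<in> adj_rel E ^^ k" "(y, w) \<in> adj_rel E" by auto
  hence "(w, y) \<in> adj_rel E" "(y, u) \<in> adj_rel E ^^ k"
    using Suc.IH adj_rel_sym[of w y E] by blast+
  thus ?case by (rule relpow_Suc_I2)
qed auto

lemma tree_verts_snocD: "xs @ [i] \<in> tree_verts d \<Longrightarrow> xs \<in> tree_verts d"
proof -
  assume a: "xs @ [i] \<in> tree_verts d"
  have "xs ! j < (if j = 0 then d else d - 1)" if "j < length xs" for j
  proof -
    have "(xs @ [i]) ! j < (if j = 0 then d else d - 1)" using a that by (simp add: tree_verts_def)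
    thus ?thesis using that by (simp add: nth_append)
  qed
  thus ?thesis by (simp add: tree_verts_def)
qed

lemma tree_ball: "nbhd_verts (tree_edges d) r [] = {xs \<in> tree_verts d. length xs \<le> r}"
proof (intro equalityI subsetI)
  fix u assume "u \<in> nbhd_verts (tree_edges d) r []"
  then obtain k where k: "k \<le> r" "([], u) \<in> adj_rel (tree_edges d) ^^ k"
    by (auto simp: nbhd_verts_def)
  have "u \<in> tree_verts d \<and> length u \<le> k" using k(2)
  proof (induction k arbitrary: u)
    case 0 thus ?case by (simp add: tree_verts_def)
  next
    case (Suc k)
    then obtain y where y: "([], y) \<in> adj_rel (tree_edges d) ^^ k" "(y, u) \<in> adj_rel (tree_edges d)"
      by auto
    from y(2) obtain xs i where "{y, u} = {xs, xs @ [i]}" "xs @ [i] \<in> tree_verts d"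
      by (auto simp: adj_rel_def tree_edges_def)
    thus ?case using Suc.IH[OF y(1)] tree_verts_snocD by (auto simp: doubleton_eq_iff)
  qed
  thus "u \<in> {xs \<in> tree_verts d. length xs \<le> r}" using k by simp
next
  fix u assume "u \<in> {xs \<in> tree_verts d. length xs \<le> r}"
  hence u: "u \<in> tree_verts d" "length u \<le> r" by auto
  from u(1) have "([], u) \<in> adj_rel (tree_edges d) ^^ length u"
  proof (induction u rule: rev_induct)
    case (snoc i xs)
    hence "([], xs) \<in> adj_rel (tree_edges d) ^^ length xs" using tree_verts_snocD by blast
    moreover have "(xs, xs @ [i]) \<in> adj_rel (tree_edges d)" using snoc.prems
      by (auto simp: adj_rel_def tree_edges_def)
    ultimately show ?case by auto
  qed auto
  thus "u \<in> nbhd_verts (tree_edges d) r []" using u by (auto simp: nbhd_verts_def)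
qed

context
  fixes d n :: nat and E :: "nat set set"
  assumes E: "E \<in> regular_graphs d n"
begin

lemma finE: "finite E" using regular_graphsD(1)[OF E] .

lemma noloop: "{a} \<notin> E"
  using regular_graphsD(2)[OF E] by fastforce

lemma nbrs_subset: "nbrs E u \<subseteq> {..<n}"
  using regular_graphsD(2)[OF E] by (auto simp: nbrs_def)

lemma nbrs_sym: "w \<in> nbrs E u \<longleftrightarrow> u \<in> nbrs E w"
  by (simp add: nbrs_def insert_commute)

lemma finite_nbrs: "finite (nbrs E u)"
  using nbrs_subset finite_subset by blast

lemma card_nbrs: "u < n \<Longrightarrow> card (nbrs E u) = d"
proof -
  assume u: "u < n"
  have "bij_betw (\<lambda>w. {u, w}) (nbrs E u) {e \<in> E. u \<in> e}"
  proof (rule bij_betw_imageI)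
    show "inj_on (\<lambda>w. {u, w}) (nbrs E u)" by (auto simp: inj_on_def doubleton_eq_iff)
    show "(\<lambda>w. {u, w}) ` nbrs E u = {e \<in> E. u \<in> e}"
    proof (intro equalityI subsetI)
      fix e assume e: "e \<in> {e \<in> E. u \<in> e}"
      then obtain x y where "e = {x, y}" using regular_graphsD(2)[OF E] by (auto simp: card_2_iff)
      with e show "e \<in> (\<lambda>w. {u, w}) ` nbrs E u" by (auto simp: nbrs_def insert_commute)
    qed (auto simp: nbrs_def)
  qed
  from bij_betw_same_card[OF this] regular_graphsD(3)[OF E u] show ?thesis by simp
qed

lemma card_ball: 
  assumes u: "u < n"
  shows "card (nbhd_verts E r u) \<le> (\<Sum>k\<le>r. d ^ k)"
proof -
  define S where "S k = {w. (u, w) \<in> adj_rel E ^^ k}" for k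
  have SV: "S k \<subseteq> {..<n}" for k
    using nbhd_verts_subset[of E "{..<n}" u k] regular_graphsD(2)[OF E] u
      by (auto simp: nbhd_verts_def S_def)
  have "card (S k) \<le> d ^ k" for k
  proof (induction k)
    case 0 thus ?case by (simp add: S_def)
  next
    case (Suc k)
    have fin: "finite (S k)" using SV finite_subset by blast
    have "S (Suc k) = (\<Union>w\<in>S k. nbrs E w)" by (auto simp: S_def adj_rel_def nbrs_def)
    also have "card \<dots> \<le> (\<Sum>w\<in>S k. card (nbrs E w))" by (rule card_UN_le[OF fin])
    also have "\<dots> = card (S k) * d" using SV[of k] card_nbrs by (simp add: subset_iff)
    also have "\<dots> \<le> d ^ k * d" using Suc by (intro mult_right_mono) auto
    finally show ?case by (simp add: mult.commute)
  qed
  note S = this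
  have "nbhd_verts E r u = (\<Union>k\<in>{..r}. S k)" by (auto simp: nbhd_verts_def S_def)
  also have "card \<dots> \<le> (\<Sum>k\<in>{..r}. card (S k))" by (rule card_UN_le) simp
  also have "\<dots> \<le> (\<Sum>k\<le>r. d ^ k)" by (intro sum_mono S)
  finally show ?thesis .
qed

lemma valid_nonroot:
  assumes "snd s < n" "fst s \<in> nbrs E (snd s)"
  shows "valid E s xs \<longleftrightarrow> (\<forall>x\<in>set xs. x < d - 1)"
  using assms
proof (induction xs arbitrary: s)
  case (Cons i xs)
  have c: "card (nbrs E (snd s) - {fst s}) = d - 1"
    using Cons.prems card_nbrs finite_nbrs by simp
  show ?case
  proof (cases "i < d - 1")
    case True
    have "snd (step E s i) \<in> nbrs E (snd s) - {fst s}" using step_nbr[OF finE, of i s] True c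
      by simp
    hence "snd (step E s i) < n" "snd s \<in> nbrs E (snd (step E s i))" using nbrs_subset nbrs_sym
      by auto
    with Cons.IH[of "step E s i"] c True show ?thesis by simp
  qed (use c in auto)
qed simp

text \<open>The fictitious predecessor \<open>n\<close> is not a vertex, so at the root no neighbour
  is excluded and all \<open>d\<close> letters are allowed; afterwards each vertex has
  \<open>d - 1\<close> continuations.\<close>

lemma valid_root:
  assumes v: "v < n"
  shows "valid E (n, v) xs \<longleftrightarrow> xs \<in> tree_verts d"
proof (cases xs)
  case Nil thus ?thesis by (simp add: tree_verts_def)
next
  case (Cons i ys)
  have c: "nbrs E v - {n} = nbrs E v" "card (nbrs E v) = d" using nbrs_subset card_nbrs[OF v]
    by auto
  have t: "xs \<in> tree_verts d \<longleftrightarrow> i < d \<and> (\<forall>x\<in>set ys. x < d - 1)"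
    unfolding tree_verts_def Cons
      by (auto simp: all_set_conv_all_nth nth_Cons less_Suc_eq_0_disj split: nat.splits)
  show ?thesis
  proof (cases "i < d")
    case True
    have "snd (step E (n, v) i) \<in> nbrs E v" using step_nbr[OF finE, of i "(n, v)"] True c by simp
    hence "snd (step E (n, v) i) < n" "v \<in> nbrs E (snd (step E (n, v) i))"
      using nbrs_subset nbrs_sym by auto
    with valid_nonroot[of "step E (n, v) i" ys] c True t show ?thesis by (simp add: Cons)
  qed (use c t Cons in auto)
qed

text \<open>Words of the tree are sent to the endpoints of the walks that they code. Every vertex of
  the ball is reached, and two words with the same endpoint would create a cycle no longer than the
  sum of their lengths. The bound \<open>2 * r + 1\<close> and the radius \<open>r + 1\<close> arise
  when edges are compared: a word of length \<open>r\<close> is extended by one letter and compared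
  with another of length \<open>r\<close>.\<close>

lemma no_short_cycle_good:
  assumes v: "v < n"
    and nc: "\<And>c. cyc E c \<Longrightarrow> length c \<le> 2 * r + 1 \<Longrightarrow> \<not> set c \<subseteq> nbhd_verts E (r + 1) v"
  shows "good d r E v"
proof -
  define f where "f xs = endpt E (n, v) xs" for xs
  define par where "par xs = fst (foldl (step E) (n, v) xs)" for xs
  define TB where "TB = nbhd_verts (tree_edges d) r []"
  have TB: "xs \<in> TB \<longleftrightarrow> xs \<in> tree_verts d \<and> length xs \<le> r" for xs
    unfolding TB_def tree_ball by simp
  have ball: "f xs \<in> nbhd_verts E k v" "set (track E (n, v) xs) \<subseteq> nbhd_verts E k v"
    if "xs \<in> tree_verts d" "length xs \<le> k" for xs k
  proof -
    show *: "set (track E (n, v) xs) \<subseteq> nbhd_verts E k v"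
    proof
      fix u assume "u \<in> set (track E (n, v) xs)"
      moreover have "valid E (n, v) xs" using that valid_root[OF v] by simp
      ultimately have "u \<in> nbhd_verts E (length xs) (snd (n, v))" by (intro track_in_ball[OF finE])
      thus "u \<in> nbhd_verts E k v" using nbhd_verts_mono[OF that(2), of E v] by auto
    qed
    show "f xs \<in> nbhd_verts E k v"
      using * last_in_set[OF track_nonempty, of E "(n, v)" xs] unfolding last_track f_def by auto
  qed
  have inj: "xs = ys"
    if h: "xs \<in> tree_verts d" "ys \<in> tree_verts d" "length xs \<le> r + 1" "length ys \<le> r + 1"
      "length xs + length ys \<le> 2 * r + 1" "f xs = f ys" for xs ys
  proof (rule ccontr)
    assume "xs \<noteq> ys"
    then obtain c where "cyc E c" "length c \<le> length xs + length ys"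
      "set c \<subseteq> set (track E (n, v) xs) \<union> set (track E (n, v) ys)"
      using two_tracks_cycle[OF finE noloop, of "(n, v)" xs ys] h valid_root[OF v] f_def by metis
    moreover have "set (track E (n, v) xs) \<subseteq> nbhd_verts E (r + 1) v"
      "set (track E (n, v) ys) \<subseteq> nbhd_verts E (r + 1) v"
      using ball(2) h by auto
    ultimately show False using nc[of c] h(5) by (meson Un_least order_trans)
  qed
  have par_snoc: "par (xs @ [i]) = f xs" for xs i by (simp add: par_def f_def)
  have f_snoc: "f (xs @ [i]) \<in> nbrs E (f xs)" if "xs @ [i] \<in> tree_verts d" for xs i
  proof -
    have "valid E (n, v) (xs @ [i])" using that valid_root[OF v] by simp
    hence "i < card (nbrs E (f xs) - {par xs})" unfolding valid_snoc f_def par_def by simp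
    thus ?thesis using step_nbr[OF finE, of i "foldl (step E) (n, v) xs"]
      by (simp add: f_def par_def)
  qed
  \<comment> \<open>A neighbour of an endpoint is reached either by one more letter or by dropping
    the last one. The fictitious predecessor of the root is excluded by
    \<open>w < n\<close>.\<close>
  have nbr_cases: "(\<exists>i. xs @ [i] \<in> tree_verts d \<and> w = f (xs @ [i])) \<or>
      (\<exists>ys i. xs = ys @ [i] \<and> w = f ys)"
    if xs: "xs \<in> tree_verts d" and w: "w \<in> nbrs E (f xs)" for xs w
  proof (cases "w = par xs")
    case True
    have "w < n" using w nbrs_subset[of "f xs"] by auto
    hence "xs \<noteq> []" using True by (auto simp: par_def)
    then obtain ys i where "xs = ys @ [i]" by (cases xs rule: rev_cases) auto
    thus ?thesis using True par_snoc by auto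
  next
    case False
    then obtain i where i: "i < card (nbrs E (f xs) - {par xs})"
      "snd (step E (foldl (step E) (n, v) xs) i) = w"
      using step_surj[of E "foldl (step E) (n, v) xs" w] w finite_nbrs unfolding f_def par_def
        by blast
    have "valid E (n, v) (xs @ [i])" unfolding valid_snoc using i xs valid_root[OF v]
      by (simp add: f_def par_def)
    thus ?thesis using i valid_root[OF v] by (auto simp: f_def)
  qed
  have onto: "\<exists>xs. xs \<in> tree_verts d \<and> length xs \<le> k \<and> f xs = u"
    if "(v, u) \<in> adj_rel E ^^ k" for u k
    using that
  proof (induction k arbitrary: u)
    case 0 thus ?case by (intro exI[of _ "[]"]) (auto simp: tree_verts_def f_def)
  next
    case (Suc k)
    then obtain y where y: "(v, y) \<in> adj_rel E ^^ k" "(y, u) \<in> adj_rel E" by auto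
    from Suc.IH[OF y(1)] obtain xs where xs: "xs \<in> tree_verts d" "length xs \<le> k" "f xs = y" by auto
    have "u \<in> nbrs E (f xs)" using y xs by (simp add: adj_rel_def nbrs_def)
    from nbr_cases[OF xs(1) this] show ?case
    proof
      assume "\<exists>i. xs @ [i] \<in> tree_verts d \<and> u = f (xs @ [i])"
      then obtain i where "xs @ [i] \<in> tree_verts d" "u = f (xs @ [i])" by auto
      thus ?thesis using xs by (intro exI[of _ "xs @ [i]"]) auto
    next
      assume "\<exists>ys i. xs = ys @ [i] \<and> u = f ys"
      then obtain ys i where "xs = ys @ [i]" "u = f ys" by auto
      thus ?thesis using xs tree_verts_snocD by (intro exI[of _ ys]) auto
    qed
  qed
  have "bij_betw f TB (nbhd_verts E r v)"
  proof (rule bij_betw_imageI)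
    show "inj_on f TB" by (rule inj_onI, rule inj) (auto simp: TB)
    show "f ` TB = nbhd_verts E r v"
    proof (intro equalityI subsetI)
      fix u assume "u \<in> nbhd_verts E r v"
      then obtain k where "k \<le> r" "(v, u) \<in> adj_rel E ^^ k" by (auto simp: nbhd_verts_def)
      with onto[of u k] obtain xs where "xs \<in> tree_verts d" "length xs \<le> k" "f xs = u" by auto
      thus "u \<in> f ` TB" using \<open>k \<le> r\<close> TB by force
    qed (use ball TB in auto)
  qed
  moreover have "f [] = v" by (simp add: f_def)
  moreover have "{xs, ys} \<in> nbhd_edges (tree_edges d) r [] \<longleftrightarrow> {f xs, f ys} \<in> nbhd_edges E r v"
    if xs: "xs \<in> TB" and ys: "ys \<in> TB" for xs ys
  proof -
    have "{xs, ys} \<in> tree_edges d \<longleftrightarrow> {f xs, f ys} \<in> E"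
    proof
      assume "{xs, ys} \<in> tree_edges d"
      then obtain zs i where "{xs, ys} = {zs, zs @ [i]}" "zs @ [i] \<in> tree_verts d"
        by (auto simp: tree_edges_def)
      thus "{f xs, f ys} \<in> E" using f_snoc[of zs i]
        by (auto simp: doubleton_eq_iff nbrs_def insert_commute)
    next
      assume "{f xs, f ys} \<in> E"
      hence "f ys \<in> nbrs E (f xs)" by (simp add: nbrs_def)
      from nbr_cases[OF _ this] xs TB
      consider i where "xs @ [i] \<in> tree_verts d" "f ys = f (xs @ [i])" | zs i where "xs = zs @ [i]"
        "f ys = f zs"
        by blast
      thus "{xs, ys} \<in> tree_edges d"
      proof cases
        case 1
        have "ys = xs @ [i]" by (rule inj) (use 1 xs ys TB in auto)
        thus ?thesis using 1 by (auto simp: tree_edges_def)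
      next
        case 2
        have "ys = zs" by (rule inj) (use 2 xs ys TB tree_verts_snocD in auto)
        thus ?thesis using 2 xs TB by (auto simp: tree_edges_def)
      qed
    qed
    moreover have "f xs \<in> nbhd_verts E r v" "f ys \<in> nbhd_verts E r v" using ball xs ys TB by auto
    ultimately show ?thesis using xs ys by (simp add: nbhd_edges_def TB_def)
  qed
  ultimately have
    "rooted_iso TB (nbhd_edges (tree_edges d) r []) [] (nbhd_verts E r v) (nbhd_edges E r v) v"
    unfolding rooted_iso_def by blast
  from rooted_iso_sym[OF this] show ?thesis
    unfolding good_def nbhd_iso_def TB_def by (simp add: self_in_nbhd)
qed

end

text \<open>The list is ordered: its head is the cycle that a switching destroys next, and the
  number of orderings supplies a factorial in the end. Disjointness lets a switching at one cycle
  leave the others intact.\<close>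

definition cycle_family :: "nat \<Rightarrow> nat set set \<Rightarrow> nat \<Rightarrow> nat list list \<Rightarrow> bool" where
  "cycle_family n E K cs \<longleftrightarrow> distinct cs \<and>
     (\<forall>c\<in>set cs. cyc E c \<and> length c \<le> K \<and> set c \<subseteq> {..<n}) \<and>
     (\<forall>c\<in>set cs. \<forall>c'\<in>set cs. c \<noteq> c' \<longrightarrow> set c \<inter> set c' = {})"

lemma cycle_family_length:
  assumes "cycle_family n E K cs"
  shows "length cs \<le> n"
proof -
  have fin: "finite (set cs)" by simp
  have "length cs = card (set cs)" using assms by (simp add: cycle_family_def distinct_card)
  also have "\<dots> = (\<Sum>c\<in>set cs. 1)" by simp
  also have "\<dots> \<le> (\<Sum>c\<in>set cs. card (set c))"
    using assms by (intro sum_mono) (auto simp: cycle_family_def cyc_def distinct_card)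
  also have "\<dots> = card (\<Union>c\<in>set cs. set c)"
    using assms by (intro card_UN_disjoint[symmetric]) (auto simp: cycle_family_def)
  also have "\<dots> \<le> card {..<n}"
    using assms by (intro card_mono) (auto simp: cycle_family_def)
  finally show ?thesis by simp
qed

lemma cycle_family_take: "cycle_family n E K cs \<Longrightarrow> cycle_family n E K (take m cs)"
  unfolding cycle_family_def by (meson distinct_take in_set_takeD)

lemma cycle_family_verts:
  assumes "cycle_family n E K cs"
  shows "card (\<Union>c\<in>set cs. set c) \<le> length cs * K"
proof -
  have "card (\<Union>c\<in>set cs. set c) \<le> (\<Sum>c\<in>set cs. card (set c))" by (rule card_UN_le) simp
  also have "\<dots> \<le> (\<Sum>c\<in>set cs. K)"
    using assms by (intro sum_mono) (auto simp: cycle_family_def intro: order_trans[OF card_length])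
  also have "\<dots> = card (set cs) * K" by simp
  also have "\<dots> \<le> length cs * K" by (intro mult_right_mono card_length) auto
  finally show ?thesis .
qed

text \<open>A family of maximal length meets every short cycle. A bad vertex has a short cycle
  inside its ball of radius \<open>r + 1\<close>, hence lies within distance \<open>r + 1\<close> of
  a vertex of the family, and the sizes of balls bound the number of such vertices.\<close>

lemma nbad_le_family:
  assumes E: "E \<in> regular_graphs d n"
  obtains cs where "cycle_family n E (2 * r + 1) cs"
    "nbad d r n E \<le> length cs * (2 * r + 1) * (\<Sum>k\<le>r + 1. d ^ k)"
proof -
  let ?P = "cycle_family n E (2 * r + 1)"
  have "?P []" by (simp add: cycle_family_def)
  then obtain cs where cs: "?P cs" and max: "\<And>cs'. ?P cs' \<Longrightarrow> length cs' \<le> length cs"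
    using ex_has_greatest_nat[of ?P "[]" length "Suc n"] cycle_family_length
      by (metis le_imp_less_Suc)
  define U where "U = (\<Union>c\<in>set cs. set c)"
  have Un: "U \<subseteq> {..<n}" using cs by (auto simp: U_def cycle_family_def)
  have finU: "finite U" by (simp add: U_def)
  have "{v. v < n \<and> \<not> good d r E v} \<subseteq> (\<Union>u\<in>U. nbhd_verts E (r + 1) u)"
  proof
    fix v assume "v \<in> {v. v < n \<and> \<not> good d r E v}"
    hence v: "v < n" "\<not> good d r E v" by auto
    then obtain c where c: "cyc E c" "length c \<le> 2 * r + 1" "set c \<subseteq> nbhd_verts E (r + 1) v"
      using no_short_cycle_good[OF E v(1), of r] by blast
    have cn: "set c \<subseteq> {..<n}"
      using c(3) nbhd_verts_subset[of E "{..<n}" v "r + 1"] regular_graphsD(2)[OF E] v by auto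
    have "set c \<inter> U \<noteq> {}"
    proof
      assume *: "set c \<inter> U = {}"
      have "c \<noteq> []" using c by (auto simp: cyc_def)
      hence "c \<notin> set cs" using * by (metis UN_upper U_def inf.absorb_iff1 set_empty)
      moreover have "\<forall>c'\<in>set cs. set c \<inter> set c' = {} \<and> set c' \<inter> set c = {}" using *
        by (auto simp: U_def)
      ultimately have "?P (c # cs)" using cs c cn by (auto simp: cycle_family_def)
      from max[OF this] show False by simp
    qed
    then obtain u where u: "u \<in> U" "u \<in> nbhd_verts E (r + 1) v" using c by auto
    then obtain k where k: "k \<le> r + 1" "(v, u) \<in> adj_rel E ^^ k" by (auto simp: nbhd_verts_def)
    from adj_relpow_sym[OF k(2)] k(1) have "v \<in> nbhd_verts E (r + 1) u"
      unfolding nbhd_verts_def by blast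
    thus "v \<in> (\<Union>u\<in>U. nbhd_verts E (r + 1) u)" using u by auto
  qed
  moreover have sub: "nbhd_verts E (r + 1) u \<subseteq> {..<n}" if "u \<in> U" for u
    using nbhd_verts_subset[of E "{..<n}" u "r + 1"] regular_graphsD(2)[OF E] Un that by auto
  have "finite (\<Union>u\<in>U. nbhd_verts E (r + 1) u)"
    by (rule finite_subset[of _ "{..<n}"]) (use sub in auto)
  ultimately have "nbad d r n E \<le> card (\<Union>u\<in>U. nbhd_verts E (r + 1) u)"
    unfolding nbad_def by (intro card_mono)
  also have "\<dots> \<le> (\<Sum>u\<in>U. card (nbhd_verts E (r + 1) u))" by (rule card_UN_le[OF finU])
  also have "\<dots> \<le> (\<Sum>u\<in>U. \<Sum>k\<le>r + 1. d ^ k)" using Un by (intro sum_mono card_ball[OF E]) auto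
  also have "\<dots> = card U * (\<Sum>k\<le>r + 1. d ^ k)" by simp
  also have "\<dots> \<le> length cs * (2 * r + 1) * (\<Sum>k\<le>r + 1. d ^ k)"
    using cycle_family_verts[OF cs] unfolding U_def by (intro mult_right_mono) auto
  finally show ?thesis using that cs by blast
qed

section \<open>Switchings\<close>

definition walks :: "nat \<Rightarrow> nat set set \<Rightarrow> nat \<Rightarrow> nat list set" where
  "walks n E l = {ws. length ws = Suc l \<and> set ws \<subseteq> {..<n} \<and> walk E ws}"

lemma finite_walks: "finite (walks n E l)"
  by (rule finite_subset[OF _ finite_lists_length_eq[of "{..<n}" "Suc l"]]) (auto simp: walks_def)

lemma card_walks:
  assumes E: "E \<in> regular_graphs d n"
  shows "card (walks n E l) \<le> n * d ^ l"
proof (induction l)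
  case 0
  have "walks n E 0 = (\<lambda>u. [u]) ` {..<n}" by (auto simp: walks_def length_Suc_conv)
  thus ?case using card_image_le[of "{..<n}" "\<lambda>u. [u]"] by simp
next
  case (Suc l)
  have "walks n E (Suc l) \<subseteq> (\<Union>ws\<in>walks n E l. (\<lambda>u. u # ws) ` nbrs E (hd ws))"
  proof
    fix ws assume ws: "ws \<in> walks n E (Suc l)"
    then obtain u vs where w: "ws = u # vs" by (cases ws) (auto simp: walks_def)
    have "vs \<noteq> []" using ws w by (auto simp: walks_def)
    hence "{u, hd vs} \<in> E" "vs \<in> walks n E l" using ws w by (auto simp: walks_def successively_Cons)
    thus "ws \<in> (\<Union>ws\<in>walks n E l. (\<lambda>u. u # ws) ` nbrs E (hd ws))"
      using w by (auto simp: nbrs_def insert_commute)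
  qed
  hence "card (walks n E (Suc l)) \<le> card (\<Union>ws\<in>walks n E l. (\<lambda>u. u # ws) ` nbrs E (hd ws))"
    using finite_walks finite_nbrs[OF E] by (intro card_mono) auto
  also have "\<dots> \<le> (\<Sum>ws\<in>walks n E l. card ((\<lambda>u. u # ws) ` nbrs E (hd ws)))"
    by (rule card_UN_le[OF finite_walks])
  also have "\<dots> \<le> (\<Sum>ws\<in>walks n E l. d)"
  proof (rule sum_mono)
    fix ws assume "ws \<in> walks n E l"
    hence "ws \<noteq> []" "set ws \<subseteq> {..<n}" by (auto simp: walks_def)
    hence "hd ws < n" using hd_in_set[of ws] by blast
    thus "card ((\<lambda>u. u # ws) ` nbrs E (hd ws)) \<le> d"
      using card_image_le[OF finite_nbrs[OF E], of "\<lambda>u. u # ws" "hd ws"] card_nbrs[OF E] by simp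
  qed
  also have "\<dots> = card (walks n E l) * d" by simp
  also have "\<dots> \<le> n * d ^ l * d" using Suc by (intro mult_right_mono) auto
  finally show ?case by (simp add: mult_ac)
qed

definition switch :: "'a set set \<Rightarrow> 'a \<Rightarrow> 'a \<Rightarrow> 'a \<Rightarrow> 'a \<Rightarrow> 'a set set" where
  "switch E x y p q = (E - {{x, y}, {p, q}}) \<union> {{x, p}, {y, q}}"

lemma switch_switch:
  assumes "{x, y} \<in> E" "{p, q} \<in> E" "{x, p} \<notin> E" "{y, q} \<notin> E"
  shows "switch (switch E x y p q) x p y q = E"
  unfolding switch_def using assms by auto

lemma switch_regular:
  assumes E: "E \<in> regular_graphs d n"
    and e: "{x, y} \<in> E" "{p, q} \<in> E" "{x, p} \<notin> E" "{y, q} \<notin> E"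
    and ne: "x \<noteq> y" "p \<noteq> q" "x \<noteq> p" "x \<noteq> q" "y \<noteq> p" "y \<noteq> q"
  shows "switch E x y p q \<in> regular_graphs d n"
proof -
  note r = regular_graphsD[OF E]
  have n: "x < n" "y < n" "p < n" "q < n" using r(2) e by auto
  have "card {f \<in> switch E x y p q. v \<in> f} = d" if v: "v < n" for v
  proof -
    define A where "A = {f \<in> E. v \<in> f}"
    have fin: "finite A" using r(1) by (simp add: A_def)
    have exch: "card (insert b (A - {a})) = card A" if "a \<in> A" "b \<notin> A" for a b
      using that fin card.remove[OF fin that(1)] by simp
    define R where "R = {f \<in> {{x, y}, {p, q}}. v \<in> f}"
    define I where "I = {f \<in> {{x, p}, {y, q}}. v \<in> f}"
    have eq: "{f \<in> switch E x y p q. v \<in> f} = (A - R) \<union> I"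
      unfolding switch_def A_def R_def I_def by blast
    consider "v = x" | "v = y" | "v = p" | "v = q" | "v \<notin> {x, y, p, q}" by auto
    hence "card ((A - R) \<union> I) = card A"
    proof cases
      case 1
      have "R = {{x, y}}" "I = {{x, p}}" using ne unfolding R_def I_def 1 by auto
      thus ?thesis using exch[of "{x, y}" "{x, p}"] e 1 by (simp add: A_def)
    next
      case 2
      have "R = {{x, y}}" "I = {{y, q}}" using ne unfolding R_def I_def 2 by auto
      thus ?thesis using exch[of "{x, y}" "{y, q}"] e 2 by (simp add: A_def)
    next
      case 3
      have "R = {{p, q}}" "I = {{x, p}}" using ne unfolding R_def I_def 3 by auto
      thus ?thesis using exch[of "{p, q}" "{x, p}"] e 3 by (simp add: A_def)
    next
      case 4
      have "R = {{p, q}}" "I = {{y, q}}" using ne unfolding R_def I_def 4 by auto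
      thus ?thesis using exch[of "{p, q}" "{y, q}"] e 4 by (simp add: A_def)
    next
      case 5
      hence "R = {}" "I = {}" unfolding R_def I_def by auto
      thus ?thesis by simp
    qed
    hence "card {f \<in> switch E x y p q. v \<in> f} = card A" unfolding eq .
    thus ?thesis using r(3)[OF v] by (simp add: A_def)
  qed
  moreover have "\<forall>f\<in>switch E x y p q. f \<subseteq> {..<n} \<and> card f = 2"
    using r(2) n ne by (auto simp: switch_def)
  ultimately show ?thesis by (auto simp: regular_graphs_def simple_graph_def)
qed

definition marked :: "nat \<Rightarrow> nat \<Rightarrow> nat \<Rightarrow> nat \<Rightarrow> (nat set set \<times> nat list list) set" where
  "marked d n K m = {(E, cs). E \<in> regular_graphs d n \<and> cycle_family n E K cs \<and> length cs = m}"

lemma finite_regular_graphs: "finite (regular_graphs d n)"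
proof (rule finite_subset)
  show "regular_graphs d n \<subseteq> Pow (Pow {..<n})" using regular_graphsD(2) by blast
qed simp

lemma finite_marked: "finite (marked d n K m)"
proof -
  define L where "L = {c. set c \<subseteq> {..<n} \<and> length c \<le> K}"
  have "finite L" unfolding L_def by (rule finite_lists_length_le) simp
  hence "finite {cs. set cs \<subseteq> L \<and> length cs = m}" by (rule finite_lists_length_eq)
  moreover have "marked d n K m \<subseteq> regular_graphs d n \<times> {cs. set cs \<subseteq> L \<and> length cs = m}"
    by (auto simp: marked_def cycle_family_def L_def)
  ultimately show ?thesis using finite_regular_graphs finite_subset by blast
qed

text \<open>Ordered pairs, since both orientations of an edge can be used. Avoiding the vertices of
  the family protects the other cycles, and the two non-adjacencies make the switched edges
  new.\<close>

definition switchable :: "nat set set \<times> nat list list \<Rightarrow> (nat \<times> nat) set" where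
  "switchable = (\<lambda>(E, cs). {(p, q). {p, q} \<in> E \<and> p \<notin> (\<Union>c\<in>set cs. set c) \<and> q \<notin> (\<Union>c\<in>set cs. set c) \<and>
     {hd (hd cs), p} \<notin> E \<and> {last (hd cs), q} \<notin> E})"

lemma cyc_ends:
  assumes "cyc E c" "set c \<subseteq> {..<n}"
  shows "hd c < n" "last c < n" "hd c \<noteq> last c" "{hd c, last c} \<in> E" "hd c \<in> set c" "last c \<in> set c"
    "c \<noteq> []"
proof -
  show ne: "c \<noteq> []" using assms by (auto simp: cyc_def)
  show "hd c \<in> set c" "last c \<in> set c" using ne by auto
  thus "hd c < n" "last c < n" using assms by auto
  show "{hd c, last c} \<in> E" using assms by (simp add: cyc_def insert_commute)
  have "c ! 0 \<noteq> c ! (length c - 1)"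
    using assms by (subst nth_eq_iff_index_eq) (auto simp: cyc_def)
  thus "hd c \<noteq> last c" using ne by (simp add: hd_conv_nth last_conv_nth)
qed

text \<open>Of the \<open>n * d\<close> oriented edges, at most \<open>2 * (Suc m * K * d)\<close>
  touch the family and at most \<open>2 * (d * d)\<close> are spoiled by an adjacency. The two
  bounds on \<open>n\<close> keep these losses below \<open>n * d / 2\<close> and
  \<open>n / 2\<close>, and for \<open>d \<ge> 3\<close> at least \<open>n\<close> pairs
  remain.\<close>

lemma card_switchable:
  assumes EC: "(E, cs) \<in> marked d n K (Suc m)" and d: "d \<ge> 3" and n: "n \<ge> 4 * d\<^sup>2"
    "n \<ge> 4 * (Suc m * K)"
  shows "card (switchable (E, cs)) \<ge> n"
proof -
  from EC have E: "E \<in> regular_graphs d n" and F: "cycle_family n E K cs" and l: "length cs = Suc m"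
    by (auto simp: marked_def)
  define U where "U = (\<Union>c\<in>set cs. set c)"
  have finU: "finite U" by (simp add: U_def)
  have cU: "card U \<le> Suc m * K" using cycle_family_verts[OF F] l by (simp add: U_def)
  have Un: "U \<subseteq> {..<n}" using F by (auto simp: U_def cycle_family_def)
  obtain c cs' where cs: "cs = c # cs'" using l by (cases cs) auto
  define x y where "x = hd c" and "y = last c"
  have "cyc E c" "set c \<subseteq> {..<n}" using F cs by (auto simp: cycle_family_def)
  from cyc_ends[OF this] have xy: "x < n" "y < n" by (auto simp: x_def y_def)
  define D where "D = Sigma {..<n} (nbrs E)"
  define D1 where "D1 = Sigma U (nbrs E)"
  define D2 where "D2 = Sigma (nbrs E x) (nbrs E)"
  define D3 where "D3 = Sigma (nbrs E y) (nbrs E)"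
  note fn = finite_nbrs[OF E] and cn = card_nbrs[OF E] and sn = nbrs_subset[OF E]
  have cD: "card D = n * d" unfolding D_def using fn cn by (subst card_SigmaI) auto
  have cS: "card (Sigma A (nbrs E)) = card A * d" if "A \<subseteq> {..<n}" for A
    using fn cn that finite_subset[OF that] by (subst card_SigmaI) (auto simp: subset_iff)
  have fS: "finite (Sigma A (nbrs E))" if "A \<subseteq> {..<n}" for A
    using fn finite_subset[OF that] by auto
  have fin: "finite D1" "finite D2" "finite D3" "finite D"
    unfolding D1_def D2_def D3_def D_def using fS Un sn by auto
  have c1: "card D1 \<le> Suc m * K * d" unfolding D1_def using cS[OF Un] cU
    by (simp add: mult_right_mono)
  have c2: "card D2 = d * d" "card D3 = d * d" unfolding D2_def D3_def using cS sn cn xy by simp_all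
  have "D \<subseteq> switchable (E, cs) \<union> D1 \<union> prod.swap ` D1 \<union> D2 \<union> prod.swap ` D3"
  proof
    fix e assume "e \<in> D"
    then obtain p q where e: "e = (p, q)" "p < n" "{p, q} \<in> E" by (auto simp: D_def nbrs_def)
    have m: "(p, q) \<in> prod.swap ` S \<longleftrightarrow> (q, p) \<in> S" for S by force
    show "e \<in> switchable (E, cs) \<union> D1 \<union> prod.swap ` D1 \<union> D2 \<union> prod.swap ` D3"
      using e unfolding e(1) Un_iff m switchable_def
      by (auto simp: D1_def D2_def D3_def nbrs_def U_def cs x_def y_def insert_commute)
  qed
  moreover have fsw: "finite (switchable (E, cs))"
  proof (rule finite_subset)
    show "switchable (E, cs) \<subseteq> {..<n} \<times> {..<n}"
      using regular_graphsD(2)[OF E] by (auto simp: switchable_def)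
  qed simp
  ultimately have "card D \<le> card (switchable (E, cs) \<union> D1 \<union> prod.swap ` D1 \<union> D2 \<union> prod.swap ` D3)"
    using fin by (intro card_mono) auto
  also have
    "\<dots> \<le> card (switchable (E, cs)) + card D1 + card (prod.swap ` D1) + card D2 + card (prod.swap ` D3)"
    by (intro order_trans[OF card_Un_le] add_right_mono order_refl)
  also have "\<dots> \<le> card (switchable (E, cs)) + card D1 + card D1 + card D2 + card D3"
    using card_image_le[OF fin(1), of prod.swap] card_image_le[OF fin(3), of prod.swap] by simp
  finally have "n * d \<le> card (switchable (E, cs)) + 2 * (Suc m * K * d) + 2 * (d * d)"
    using c1 c2 cD by simp
  moreover have "4 * (Suc m * K * d) \<le> n * d" using n(2) mult_right_mono[OF n(2), of d]
    by (simp add: mult_ac)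
  moreover have "4 * (d * d) \<le> n" using n(1) by (simp add: power2_eq_square)
  moreover have "n * 3 \<le> n * d" using d by simp
  ultimately show ?thesis by linarith
qed

text \<open>The second component records the destroyed cycle together with \<open>p\<close> and
  \<open>q\<close> as one walk of the new graph. It contains all the data for undoing the switching,
  and by regularity the number of such walks is linear in \<open>n\<close>.\<close>

definition cut_cycle ::
  "(nat set set \<times> nat list list) \<times> nat \<times> nat \<Rightarrow> (nat set set \<times> nat list list) \<times> nat list" where
  "cut_cycle = (\<lambda>((E, cs), (p, q)).
     ((switch E (hd (hd cs)) (last (hd cs)) p q, tl cs), p # hd cs @ [q]))"

lemma walk_cong_on:
  assumes "walk E ws" "\<And>a b. a \<in> set ws \<Longrightarrow> b \<in> set ws \<Longrightarrow> {a, b} \<in> E \<Longrightarrow> {a, b} \<in> E'"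
  shows "walk E' ws"
  by (rule successively_mono[OF assms(1)]) (rule assms(2))

text \<open>Of the edges of the cycle only the closing one is removed, so the rest becomes a path,
  which the two new edges extend to \<open>p\<close> and \<open>q\<close>.\<close>

lemma cut_cycle_mem:
  assumes EC: "(E, cs) \<in> marked d n K (Suc m)" and pq: "(p, q) \<in> switchable (E, cs)"
  shows "cut_cycle ((E, cs), (p, q)) \<in> Sigma (marked d n K m) (\<lambda>(E', cs'). \<Union>l\<le>K + 1. walks n E' l)"
    and "switch (fst (fst (cut_cycle ((E, cs), (p, q))))) (hd (hd cs)) p (last (hd cs)) q = E"
proof -
  from EC have E: "E \<in> regular_graphs d n" and F: "cycle_family n E K cs" and l: "length cs = Suc m"
    by (auto simp: marked_def)
  obtain c cs' where cs: "cs = c # cs'" using l by (cases cs) auto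
  define x y where "x = hd c" and "y = last c"
  have c: "cyc E c" "set c \<subseteq> {..<n}" "length c \<le> K" using F cs by (auto simp: cycle_family_def)
  note xy = cyc_ends[OF c(1,2), folded x_def y_def]
  define E' where "E' = switch E x y p q"
  from pq have e: "{p, q} \<in> E" "{x, p} \<notin> E" "{y, q} \<notin> E" and out: "p \<notin> set c" "q \<notin> set c"
    "\<And>c'. c' \<in> set cs' \<Longrightarrow> p \<notin> set c' \<and> q \<notin> set c'"
    by (auto simp: switchable_def cs x_def y_def)
  have pqn: "p < n" "q < n" "p \<noteq> q" using regular_graphsD(2)[OF E] e(1) by auto
  have ne: "x \<noteq> p" "x \<noteq> q" "y \<noteq> p" "y \<noteq> q" using out xy by auto
  have E': "E' \<in> regular_graphs d n" unfolding E'_def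
    by (rule switch_regular[OF E xy(4) e xy(3) pqn(3) ne])
  have keep: "{a, b} \<in> E'" if "{a, b} \<in> E" "{a, b} \<noteq> {x, y}" "{a, b} \<noteq> {p, q}" for a b
    using that by (auto simp: E'_def switch_def)
  have F': "cycle_family n E' K cs'"
  proof -
    have "cyc E' c'" if c': "c' \<in> set cs'" for c'
    proof -
      have "cyc E c'" using F c' cs by (auto simp: cycle_family_def)
      moreover have "c \<noteq> c'" using F c' cs by (auto simp: cycle_family_def)
      hence disj: "set c \<inter> set c' = {}" using F c' cs by (auto simp: cycle_family_def)
      have k: "{a, b} \<in> E'" if "a \<in> set c'" "b \<in> set c'" "{a, b} \<in> E" for a b
        using that disj xy out(3)[OF c'] by (intro keep) (auto simp: doubleton_eq_iff)
      moreover have "c' \<noteq> []" using \<open>cyc E c'\<close> by (auto simp: cyc_def)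
      ultimately show ?thesis unfolding cyc_def using walk_cong_on[of E c' E'] by auto
    qed
    thus ?thesis using F cs by (auto simp: cycle_family_def)
  qed
  have "walk E' c"
    unfolding successively_conv_nth
  proof (intro allI impI)
    fix i assume i: "Suc i < length c"
    have d: "distinct c" "length c \<ge> 3" using c by (auto simp: cyc_def)
    have "{c ! i, c ! Suc i} \<in> E" using c(1) i by (auto simp: cyc_def successively_conv_nth)
    \<comment> \<open>Distinctness and length at least 3 separate the closing edge from the edges
      between consecutive entries.\<close>
    moreover have "{c ! i, c ! Suc i} \<noteq> {x, y}"
    proof -
      have "x = c ! 0" "y = c ! (length c - 1)" using xy(7)
        by (simp_all add: x_def y_def hd_conv_nth last_conv_nth)
      thus ?thesis using d i xy(7) by (auto simp: doubleton_eq_iff nth_eq_iff_index_eq)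
    qed
    moreover have "c ! i \<in> set c" using i by simp
    ultimately show "{c ! i, c ! Suc i} \<in> E'" using out
      by (intro keep) (auto simp: doubleton_eq_iff)
  qed
  moreover have "{x, p} \<in> E'" "{y, q} \<in> E'" by (auto simp: E'_def switch_def)
  ultimately have "walk E' (p # c @ [q])"
    using xy(7) by (auto simp: successively_Cons successively_append_iff x_def y_def insert_commute)
  hence "p # c @ [q] \<in> walks n E' (length c + 1)" using c pqn by (auto simp: walks_def)
  hence "p # c @ [q] \<in> (\<Union>l\<le>K + 1. walks n E' l)"
    using c(3) by (intro UN_I[of "length c + 1"]) auto
  moreover have "(E', cs') \<in> marked d n K m" using E' F' l cs by (simp add: marked_def)
  moreover have *: "cut_cycle ((E, cs), (p, q)) = ((E', cs'), p # c @ [q])"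
    by (simp add: cut_cycle_def cs E'_def x_def y_def)
  ultimately show
    "cut_cycle ((E, cs), (p, q)) \<in> Sigma (marked d n K m) (\<lambda>(E', cs'). \<Union>l\<le>K + 1. walks n E' l)"
    by simp
  show "switch (fst (fst (cut_cycle ((E, cs), (p, q))))) (hd (hd cs)) p (last (hd cs)) q = E"
    unfolding * using switch_switch[OF xy(4) e] by (simp add: cs E'_def x_def y_def)
qed

text \<open>Destroying the first marked cycle by a switching costs a factor of order \<open>n\<close> in both
  directions: the cycle can be recovered from its starting vertex and a walk of bounded length.\<close>

lemma card_marked_Suc:
  assumes d: "d \<ge> 3" and n: "n \<ge> 4 * d\<^sup>2" "n \<ge> 4 * (Suc m * K)"
  shows "card (marked d n K (Suc m)) \<le> card (marked d n K m) * (\<Sum>l\<le>K + 1. d ^ l)"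
proof -
  define D where "D = Sigma (marked d n K (Suc m)) switchable"
  define R where "R = Sigma (marked d n K m) (\<lambda>(E', cs'). \<Union>l\<le>K + 1. walks n E' l)"
  have fsw: "finite (switchable X)" if "X \<in> marked d n K (Suc m)" for X
  proof (rule finite_subset)
    show "switchable X \<subseteq> {..<n} \<times> {..<n}"
      using that regular_graphsD(2) by (fastforce simp: switchable_def marked_def)
  qed simp
  have "card (marked d n K (Suc m)) * n \<le> card D"
  proof -
    have "card (marked d n K (Suc m)) * n = (\<Sum>X\<in>marked d n K (Suc m). n)" by simp
    also have "\<dots> \<le> (\<Sum>X\<in>marked d n K (Suc m). card (switchable X))"
      using card_switchable[OF _ d n] by (intro sum_mono) auto
    also have "\<dots> = card D" unfolding D_def using fsw finite_marked by (subst card_SigmaI) auto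
    finally show ?thesis .
  qed
  also have "card D \<le> card R"
  proof (rule card_inj_on_le)
    show "cut_cycle ` D \<subseteq> R" using cut_cycle_mem(1) unfolding D_def R_def by fastforce
    show "finite R" unfolding R_def using finite_marked finite_walks by auto
    show "inj_on cut_cycle D"
    proof (rule inj_onI)
      fix X Y assume XY: "X \<in> D" "Y \<in> D" and eq: "cut_cycle X = cut_cycle Y"
      obtain E cs p q where X: "X = ((E, cs), (p, q))" by (metis surj_pair)
      obtain E' cs' p' q' where Y: "Y = ((E', cs'), (p', q'))" by (metis surj_pair)
      have ne: "cs \<noteq> []" "cs' \<noteq> []" using XY X Y by (auto simp: D_def marked_def)
      from eq have "tl cs = tl cs'" "hd cs = hd cs'" and pq: "p = p'" "q = q'"
        by (auto simp: X Y cut_cycle_def)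
      hence cs: "cs = cs'" using ne by (metis list.collapse)
      have "E = E'"
      proof -
        have "(E, cs) \<in> marked d n K (Suc m)" "(p, q) \<in> switchable (E, cs)" using XY(1)
          by (auto simp: D_def X)
        from cut_cycle_mem(2)[OF this]
        have "switch (fst (fst (cut_cycle X))) (hd (hd cs)) p (last (hd cs)) q = E" unfolding X .
        moreover have "(E', cs') \<in> marked d n K (Suc m)" "(p', q') \<in> switchable (E', cs')"
          using XY(2) by (auto simp: D_def Y)
        from cut_cycle_mem(2)[OF this]
        have "switch (fst (fst (cut_cycle Y))) (hd (hd cs')) p' (last (hd cs')) q' = E'"
          unfolding Y .
        ultimately show ?thesis unfolding eq cs pq by (rule trans[OF sym])
      qed
      thus "X = Y" using X Y cs pq by simp
    qed
  qed
  also have "card R \<le> (\<Sum>X\<in>marked d n K m. n * (\<Sum>l\<le>K + 1. d ^ l))"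
  proof -
    have "card R = (\<Sum>(E, cs)\<in>marked d n K m. card (\<Union>l\<le>K + 1. walks n E l))"
      unfolding R_def using finite_marked finite_walks
        by (subst card_SigmaI) (auto simp: case_prod_beta)
    also have "\<dots> \<le> (\<Sum>X\<in>marked d n K m. n * (\<Sum>l\<le>K + 1. d ^ l))"
    proof (rule sum_mono, clarify)
      fix E cs assume "(E, cs) \<in> marked d n K m"
      hence E: "E \<in> regular_graphs d n" by (simp add: marked_def)
      have "card (\<Union>l\<le>K + 1. walks n E l) \<le> (\<Sum>l\<le>K + 1. card (walks n E l))" by (rule card_UN_le) simp
      also have "\<dots> \<le> (\<Sum>l\<le>K + 1. n * d ^ l)" by (intro sum_mono card_walks[OF E])
      finally show "card (\<Union>l\<le>K + 1. walks n E l) \<le> n * (\<Sum>l\<le>K + 1. d ^ l)"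
        by (simp only: sum_distrib_left)
    qed
    finally show ?thesis .
  qed
  finally have "card (marked d n K (Suc m)) * n \<le> (card (marked d n K m) * (\<Sum>l\<le>K + 1. d ^ l)) * n"
    by (simp add: mult_ac)
  moreover have "n > 0" using n d
    by (metis less_le_trans mult_pos_pos power_not_zero not_gr_zero zero_less_numeral not_numeral_le_zero zero_less_power)
  ultimately show ?thesis by simp
qed

lemma card_marked:
  assumes d: "d \<ge> 3" and n: "n \<ge> 4 * d\<^sup>2" "n \<ge> 4 * (m * K)"
  shows "card (marked d n K m) \<le> card (regular_graphs d n) * (\<Sum>l\<le>K + 1. d ^ l) ^ m"
  using n(2)
proof (induction m)
  case 0
  have "marked d n K 0 \<subseteq> (\<lambda>E. (E, [])) ` regular_graphs d n" by (auto simp: marked_def)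
  hence "card (marked d n K 0) \<le> card ((\<lambda>E. (E, [] :: nat list list)) ` regular_graphs d n)"
    using finite_regular_graphs by (intro card_mono) auto
  also have "\<dots> \<le> card (regular_graphs d n)" by (rule card_image_le[OF finite_regular_graphs])
  finally show ?case by simp
next
  case (Suc m)
  have "card (marked d n K (Suc m)) \<le> card (marked d n K m) * (\<Sum>l\<le>K + 1. d ^ l)"
    by (rule card_marked_Suc[OF d n(1) Suc.prems])
  also have "\<dots> \<le> card (regular_graphs d n) * (\<Sum>l\<le>K + 1. d ^ l) ^ m * (\<Sum>l\<le>K + 1. d ^ l)"
    using Suc by (intro mult_right_mono Suc.IH) auto
  finally show ?case by (simp add: mult_ac)
qed

text \<open>A graph with \<open>m\<close> disjoint short cycles occurs in \<open>marked\<close> once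
  for every ordering of them, hence at least \<open>fact m\<close> times. This gain beats the
  bounded factor per switching.\<close>

lemma card_many_cycles:
  assumes d: "d \<ge> 3" and n: "n \<ge> 4 * d\<^sup>2" "n \<ge> 4 * (m * K)"
  shows "card {E \<in> regular_graphs d n. \<exists>cs. cycle_family n E K cs \<and> length cs = m} * fact m
     \<le> card (regular_graphs d n) * (\<Sum>l\<le>K + 1. d ^ l) ^ m"
proof -
  define B where "B = {E \<in> regular_graphs d n. \<exists>cs. cycle_family n E K cs \<and> length cs = m}"
  define F where "F E = {cs. (E, cs) \<in> marked d n K m}" for E
  have finB: "finite B" unfolding B_def using finite_regular_graphs by auto
  have finF: "finite (F E)" for E
  proof (rule finite_subset)
    show "F E \<subseteq> snd ` marked d n K m"
    proof
      fix cs assume "cs \<in> F E"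
      hence "(E, cs) \<in> marked d n K m" by (simp add: F_def)
      from imageI[OF this, of snd] show "cs \<in> snd ` marked d n K m" by simp
    qed
  qed (use finite_marked in auto)
  have "fact m \<le> card (F E)" if "E \<in> B" for E
  proof -
    from that obtain cs where cs: "cycle_family n E K cs" "length cs = m" "E \<in> regular_graphs d n"
      by (auto simp: B_def)
    have "permutations_of_set (set cs) \<subseteq> F E"
    proof
      fix cs' assume "cs' \<in> permutations_of_set (set cs)"
      hence "set cs' = set cs" "distinct cs'" by (auto simp: permutations_of_set_def)
      moreover from this have "length cs' = m" using cs by (metis cycle_family_def distinct_card)
      ultimately show "cs' \<in> F E" using cs by (auto simp: F_def marked_def cycle_family_def)
    qed
    from card_mono[OF finF this] show ?thesis
      using cs by (simp add: cycle_family_def distinct_card)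
  qed
  hence "card B * fact m \<le> (\<Sum>E\<in>B. card (F E))"
    using sum_mono[of B "\<lambda>_. fact m" "\<lambda>E. card (F E)"] by simp
  also have "\<dots> = card (Sigma B F)" using finB finF by (subst card_SigmaI) auto
  also have "\<dots> \<le> card (marked d n K m)"
    by (rule card_mono[OF finite_marked]) (auto simp: F_def)
  also have "\<dots> \<le> card (regular_graphs d n) * (\<Sum>l\<le>K + 1. d ^ l) ^ m" by (rule card_marked[OF d n])
  finally show ?thesis unfolding B_def .
qed

section \<open>Random regular graphs have few short cycles\<close>

lemma eventually_admissible: "eventually P sequentially \<Longrightarrow> eventually P (admissible d)"
  unfolding admissible_def by (rule filter_leD[OF inf_le1])

lemma eventually_admissible_even: "eventually (\<lambda>n. even (n * d)) (admissible d)"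
  unfolding admissible_def by (auto simp: eventually_inf_principal)

lemma admissible_neq_bot: "admissible d \<noteq> bot"
proof
  assume "admissible d = bot"
  hence "eventually (\<lambda>n. False) (admissible d)" by simp
  then obtain N where N: "\<And>n. n \<ge> N \<Longrightarrow> \<not> even (n * d)"
    unfolding admissible_def eventually_inf_principal eventually_sequentially by auto
  from N[of "2 * N"] show False by simp
qed

section \<open>Existence of regular graphs\<close>

definition circulant :: "nat \<Rightarrow> nat set \<Rightarrow> nat set set" where
  "circulant n S = {{i, (i + s) mod n} | i s. i < n \<and> s \<in> S}"

lemma add_mod_cases: "i < n \<Longrightarrow> s < n \<Longrightarrow> (i + s) mod n = (if i + s < n then i + s else i + s - n)"
  for n :: nat by (simp add: mod_if)

lemma circulant_regular:
  assumes S: "S \<subseteq> {1..<n}" and sym: "\<And>s. s \<in> S \<Longrightarrow> n - s \<in> S"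
  shows "circulant n S \<in> regular_graphs (card S) n"
proof -
  have ne: "(i + s) mod n \<noteq> i" "(i + s) mod n < n" if "i < n" "s \<in> S" for i s
  proof -
    have s: "0 < s" "s < n" using S that by auto
    show "(i + s) mod n \<noteq> i" using add_mod_cases[OF that(1) s(2)] s that by (auto split: if_splits)
    show "(i + s) mod n < n" using that by simp
  qed
  have "card {e \<in> circulant n S. v \<in> e} = card S" if v: "v < n" for v
  proof -
    have "bij_betw (\<lambda>s. {v, (v + s) mod n}) S {e \<in> circulant n S. v \<in> e}"
    proof (rule bij_betw_imageI)
      show "inj_on (\<lambda>s. {v, (v + s) mod n}) S"
      proof (rule inj_onI)
        fix s t assume st: "s \<in> S" "t \<in> S" "{v, (v + s) mod n} = {v, (v + t) mod n}"
        hence "(v + s) mod n = (v + t) mod n" using ne v by (metis doubleton_eq_iff)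
        moreover have "s < n" "t < n" using st S by auto
        ultimately show "s = t" using v by (auto simp: add_mod_cases split: if_splits)
      qed
      show "(\<lambda>s. {v, (v + s) mod n}) ` S = {e \<in> circulant n S. v \<in> e}"
      proof (intro equalityI subsetI)
        fix e assume "e \<in> {e \<in> circulant n S. v \<in> e}"
        then obtain i s where e: "e = {i, (i + s) mod n}" "i < n" "s \<in> S" "v \<in> e"
          by (auto simp: circulant_def)
        show "e \<in> (\<lambda>s. {v, (v + s) mod n}) ` S"
        proof (cases "v = i")
          case True thus ?thesis using e by auto
        next
          case False
          hence vi: "v = (i + s) mod n" using e by auto
          have s: "0 < s" "s < n" using e S by auto
          have "(v + (n - s)) mod n = i"
            using vi v s e(2) by (auto simp: add_mod_cases split: if_splits)
          thus ?thesis using e sym[OF e(3)] vi by (intro image_eqI[of _ _ "n - s"]) auto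
        qed
      qed (use v in \<open>auto simp: circulant_def\<close>)
    qed
    from bij_betw_same_card[OF this] show ?thesis by simp
  qed
  moreover have "\<forall>e\<in>circulant n S. e \<subseteq> {..<n} \<and> card e = 2"
    using ne by (auto simp: circulant_def card_2_iff)
  ultimately show ?thesis by (auto simp: regular_graphs_def simple_graph_def)
qed

text \<open>A circulant graph joins each vertex to those at cyclic distance at most
  \<open>k = d div 2\<close>. For odd \<open>d\<close> the number \<open>n\<close> is even, and the
  antipodal vertex at distance \<open>n div 2\<close> adds one to the degree.\<close>

lemma regular_graphs_nonempty:
  assumes "d < n" "even (n * d)"
  shows "regular_graphs d n \<noteq> {}"
proof -
  define k where "k = d div 2"
  define M where "M = (if odd d then {n div 2} else {})"
  define S where "S = {1..k} \<union> {n - k..<n} \<union> M"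
  have k: "2 * k < n" "d = 2 * k + (if odd d then 1 else 0)" using assms by (auto simp: k_def)
  have M: "odd d \<Longrightarrow> even n" using assms by auto
  have "S \<subseteq> {1..<n}" using k M by (auto simp: S_def M_def split: if_splits)
  moreover have "n - s \<in> S" if "s \<in> S" for s
    using that k M by (auto simp: S_def M_def split: if_splits)
  ultimately have "circulant n S \<in> regular_graphs (card S) n" by (rule circulant_regular)
  moreover have "card S = d"
  proof -
    have kk: "k < n div 2" if "odd d" using that M[OF that] k by (auto elim!: evenE)
    have "card S = card ({1..k} \<union> {n - k..<n}) + card M"
      unfolding S_def
    proof (rule card_Un_disjoint)
      show "({1..k} \<union> {n - k..<n}) \<inter> M = {}" using kk M by (auto simp: M_def elim!: evenE)
    qed (auto simp: M_def)
    also have "card ({1..k} \<union> {n - k..<n}) = k + k"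
      using k by (subst card_Un_disjoint) auto
    finally show ?thesis using k by (auto simp: M_def)
  qed
  ultimately show ?thesis by auto
qed

lemma eventually_regular_graphs_nonempty: "eventually (\<lambda>n. regular_graphs d n \<noteq> {}) (admissible d)"
  using eventually_admissible_even[of d] eventually_admissible[OF eventually_gt_at_top[of d]]
  by eventually_elim (rule regular_graphs_nonempty)

text \<open>With \<open>m = nat \<lfloor>c * real n\<rfloor>\<close>, the factor
  \<open>exp (\<bar>M\<bar> * real n)\<close> is at most \<open>L ^ Suc m\<close>, while
  \<open>(A * L) ^ m / fact m\<close> tends to 0; eventually it is below \<open>1 / L\<close>, which
  absorbs the extra factor due to rounding.\<close>

lemma superexponential_factorial:
  fixes A c M :: real
  assumes c: "c > 0" and A: "A > 0"
  shows "eventually (\<lambda>n. A ^ nat \<lfloor>c * real n\<rfloor> / fact (nat \<lfloor>c * real n\<rfloor>) \<le> exp (- M * real n)) sequentially"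
proof -
  define L where "L = exp (\<bar>M\<bar> / c)"
  have "(\<lambda>m. inverse (fact m) * (A * L) ^ m) \<longlonglongrightarrow> 0"
    using summable_LIMSEQ_zero[OF summable_exp[of "A * L"]] .
  hence "eventually (\<lambda>m. inverse (fact m) * (A * L) ^ m < 1 / L) sequentially"
    by (rule order_tendstoD) (simp add: L_def)
  then obtain m0 where m0: "\<And>m. m \<ge> m0 \<Longrightarrow> inverse (fact m) * (A * L) ^ m < 1 / L"
    by (auto simp: eventually_sequentially)
  have "filterlim (\<lambda>n. c * real n) at_top sequentially"
    using c by (intro filterlim_tendsto_pos_mult_at_top[OF tendsto_const] filterlim_real_sequentially)
  hence "eventually (\<lambda>n. c * real n \<ge> real m0 + 1) sequentially"
    by (simp add: filterlim_at_top)
  thus ?thesis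
  proof eventually_elim
    case (elim n)
    define m where "m = nat \<lfloor>c * real n\<rfloor>"
    have m: "m \<ge> m0" "c * real n < real m + 1" unfolding m_def using elim by linarith+
    have "exp (\<bar>M\<bar> * real n) \<le> L ^ Suc m"
    proof -
      have "\<bar>M\<bar> * real n \<le> (real m + 1) * (\<bar>M\<bar> / c)"
        using mult_left_mono[of "c * real n" "real m + 1" "\<bar>M\<bar>"] m(2) c by (simp add: field_simps)
      also have "exp \<dots> = L ^ Suc m" unfolding L_def exp_of_nat_mult[symmetric] by simp
      finally show ?thesis by simp
    qed
    have L: "L > 0" by (simp add: L_def)
    have "inverse (fact m) * (A * L) ^ m * L < 1" using m0[OF m(1)] L by (simp add: field_simps)
    hence "A ^ m / fact m * L ^ Suc m \<le> 1" by (simp add: power_mult_distrib field_simps)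
    hence "A ^ m / fact m * exp (\<bar>M\<bar> * real n) \<le> 1"
      using \<open>exp (\<bar>M\<bar> * real n) \<le> L ^ Suc m\<close> A
      by (meson divide_nonneg_nonneg fact_ge_zero less_imp_le mult_left_mono order_trans zero_le_power)
    hence "A ^ m / fact m \<le> exp (- (\<bar>M\<bar> * real n))" by (simp add: exp_minus field_simps)
    also have "\<dots> \<le> exp (- M * real n)" by (simp add: mult_right_mono)
    finally show ?case by (simp add: m_def)
  qed
qed

text \<open>More than \<open>\<epsilon> * real n\<close> bad vertices force linearly many disjoint
  short cycles, and \<open>m\<close> of these already have probability at most
  \<open>C ^ m / fact m\<close>.\<close>

lemma few_bad_vertices:
  assumes d: "d \<ge> 3" and e: "\<epsilon> > 0"
  shows "eventually (\<lambda>n. measure_pmf.prob (random_regular_graph d n) {E. real (nbad d r n E) > \<epsilon> * real n}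
     \<le> exp (- M * real n)) (admissible d)"
proof -
  define K where "K = 2 * r + 1"
  define D where "D = (\<Sum>k\<le>r + 1. d ^ k)"
  define C where "C = real (\<Sum>l\<le>K + 1. d ^ l)"
  have Dp: "D > 0" unfolding D_def by (rule sum_pos2[of _ 0]) auto
  have Cp: "C > 0" unfolding C_def of_nat_0_less_iff by (rule sum_pos2[of _ 0]) auto
  have Kp: "K > 0" by (simp add: K_def)
  \<comment> \<open>The first bound makes \<open>m\<close> at most the number of disjoint cycles
    forced by the bad vertices; the second ensures \<open>4 * (m * K) \<le> n\<close>, so that
    enough edges remain to switch with.\<close>
  define c where "c = min (\<epsilon> / (K * D)) (1 / (4 * K))"
  have cle: "c \<le> \<epsilon> / (K * D)" "c \<le> 1 / (4 * K)" unfolding c_def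
    by (rule min.cobounded1, rule min.cobounded2)
  have c: "c > 0" using e Dp Kp by (simp add: c_def)
  have "eventually (\<lambda>n. C ^ nat \<lfloor>c * real n\<rfloor> / fact (nat \<lfloor>c * real n\<rfloor>) \<le> exp (- M * real n)) (admissible d)"
    by (intro eventually_admissible superexponential_factorial c Cp)
  moreover have "eventually (\<lambda>n. n \<ge> 4 * d\<^sup>2) (admissible d)"
    by (intro eventually_admissible eventually_ge_at_top)
  ultimately show ?thesis
    using eventually_regular_graphs_nonempty[of d]
  proof eventually_elim
    case (elim n)
    define m where "m = nat \<lfloor>c * real n\<rfloor>"
    have mc: "real m \<le> c * real n" using c by (simp add: m_def)
    define B where "B = {E \<in> regular_graphs d n. \<exists>cs. cycle_family n E K cs \<and> length cs = m}"
    have "real m \<le> 1 / (4 * K) * real n" using mc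
      by (rule order_trans) (intro mult_right_mono cle, simp)
    hence "real (4 * (m * K)) \<le> real n" using Kp by (simp add: field_simps)
    hence mK: "4 * (m * K) \<le> n" by (simp only: of_nat_le_iff)
    have "regular_graphs d n \<inter> {E. real (nbad d r n E) > \<epsilon> * real n} \<subseteq> B"
    proof
      fix E assume "E \<in> regular_graphs d n \<inter> {E. real (nbad d r n E) > \<epsilon> * real n}"
      hence E: "E \<in> regular_graphs d n" and b: "real (nbad d r n E) > \<epsilon> * real n" by auto
      from nbad_le_family[OF E, of r] obtain cs where cs: "cycle_family n E K cs"
        "nbad d r n E \<le> length cs * K * D" unfolding K_def D_def by blast
      have "\<epsilon> * real n < real (length cs * K * D)" using b cs(2) by linarith
      hence "\<epsilon> / (K * D) * real n < real (length cs)" using Kp Dp by (simp add: field_simps)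
      moreover have "c * real n \<le> \<epsilon> / (K * D) * real n" by (intro mult_right_mono cle) simp
      ultimately have "m \<le> length cs" using mc by linarith
      thus "E \<in> B" unfolding B_def using E cycle_family_take[OF cs(1), of m] by force
    qed
    hence "card (regular_graphs d n \<inter> {E. real (nbad d r n E) > \<epsilon> * real n}) \<le> card B"
      using finite_regular_graphs by (intro card_mono) (auto simp: B_def)
    moreover have "card B * fact m \<le> card (regular_graphs d n) * (\<Sum>l\<le>K + 1. d ^ l) ^ m"
      unfolding B_def by (rule card_many_cycles[OF d elim(2) mK])
    hence "real (card B * fact m) \<le> real (card (regular_graphs d n) * (\<Sum>l\<le>K + 1. d ^ l) ^ m)"
      by (simp only: of_nat_le_iff)
    hence "real (card B) \<le> real (card (regular_graphs d n)) * (C ^ m / fact m)"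
      by (simp add: C_def field_simps)
    moreover have N: "card (regular_graphs d n) > 0"
      using elim(3) finite_regular_graphs by (simp add: card_gt_0_iff)
    ultimately have "card (regular_graphs d n \<inter> {E. real (nbad d r n E) > \<epsilon> * real n}) / card (regular_graphs d n)
      \<le> C ^ m / fact m"
      by (simp add: divide_le_eq mult.commute)
    also have "\<dots> \<le> exp (- M * real n)" using elim(1) by (simp add: m_def)
    finally show ?case
      unfolding random_regular_graph_def using elim(3) finite_regular_graphs
      by (simp add: measure_pmf_of_set)
  qed
qed

section \<open>The random cluster model and the two-spin model\<close>

lemma sum_prod_Pow:
  fixes f :: "'a \<Rightarrow> 'b::comm_ring_1"
  assumes "finite A"
  shows "(\<Sum>F\<in>Pow A. \<Prod>e\<in>F. f e) = (\<Prod>e\<in>A. 1 + f e)"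
  using prod_add[OF assms, of f "\<lambda>_. 1"] by (simp add: add.commute)

lemma sum_PiE_indicator:
  assumes "finite E" "a \<noteq> b"
  shows "(\<Sum>\<omega>\<in>E \<rightarrow>\<^sub>E {a, b}. g {e \<in> E. \<omega> e = b}) = (\<Sum>F\<in>Pow E. g F)"
proof (rule sum.reindex_bij_witness[where i = "\<lambda>F. \<lambda>e\<in>E. if e \<in> F then b else a"
      and j = "\<lambda>\<omega>. {e \<in> E. \<omega> e = b}"])
  fix \<omega> assume "\<omega> \<in> E \<rightarrow>\<^sub>E {a, b}"
  thus "(\<lambda>e\<in>E. if e \<in> {e \<in> E. \<omega> e = b} then b else a) = \<omega>"
    by (intro ext) (auto simp: PiE_iff extensional_def restrict_def)
qed (use assms in \<open>auto split: if_splits\<close>)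

lemma rc_partition_altdef:
  assumes "finite E"
  shows "rc_partition V E q w B =
    (\<Sum>F\<in>Pow E. w ^ card F * (\<Prod>C\<in>clusters V F. 1 + (q - 1) * exp (- B * real (card C))))"
proof -
  have "(\<Prod>e\<in>E. w ^ \<omega> e) = w ^ card {e \<in> E. \<omega> e = 1}" if "\<omega> \<in> E \<rightarrow>\<^sub>E {0, 1 :: nat}" for \<omega>
  proof -
    have "(\<Prod>e\<in>E. w ^ \<omega> e) = (\<Prod>e\<in>E. if \<omega> e = 1 then w else 1)"
      using that by (intro prod.cong) (auto simp: PiE_iff)
    thus ?thesis using assms by (simp add: prod.If_cases Int_def)
  qed
  thus ?thesis
    unfolding rc_partition_def
    by (subst sum_PiE_indicator[OF assms, of 0 "1::nat", symmetric]) (auto intro!: sum.cong)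
qed

section \<open>Clusters, their unions and their edges\<close>

context
  fixes V :: "'a set" and F :: "'a set set"
  assumes V: "finite V" and F: "\<forall>e\<in>F. e \<subseteq> V \<and> card e = 2"
begin

lemma cluster_equiv: "equiv V {(u, v) \<in> V \<times> V. (u, v) \<in> (adj_rel F)\<^sup>*}"
proof (rule equivI)
  have "sym (adj_rel F)" by (auto simp: sym_def adj_rel_def insert_commute)
  hence "sym ((adj_rel F)\<^sup>*)" by (rule sym_rtrancl)
  thus "sym {(u, v) \<in> V \<times> V. (u, v) \<in> (adj_rel F)\<^sup>*}" by (auto simp: sym_def)
qed (auto simp: refl_on_def trans_def)

lemma clusters_Union: "\<Union>(clusters V F) = V"
  unfolding clusters_def by (rule Union_quotient[OF cluster_equiv])

lemma clusters_disjoint: "C \<in> clusters V F \<Longrightarrow> C' \<in> clusters V F \<Longrightarrow> C \<noteq> C' \<Longrightarrow> C \<inter> C' = {}"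
  unfolding clusters_def using quotient_disj[OF cluster_equiv] by blast

lemma clusters_subset: "C \<in> clusters V F \<Longrightarrow> C \<subseteq> V"
  using clusters_Union by blast

lemma finite_clusters: "finite (clusters V F)"
  by (rule finite_subset[of _ "Pow V"]) (use clusters_subset V in auto)

lemma finite_cluster: "C \<in> clusters V F \<Longrightarrow> finite C"
  using clusters_subset V finite_subset by blast

lemma cluster_eq: "C \<in> clusters V F \<Longrightarrow> v \<in> C \<Longrightarrow> C = {u \<in> V. (v, u) \<in> (adj_rel F)\<^sup>*}"
proof -
  assume C: "C \<in> clusters V F" and v: "v \<in> C"
  let ?R = "{(u, v) \<in> V \<times> V. (u, v) \<in> (adj_rel F)\<^sup>*}"
  have vV: "v \<in> V" using clusters_subset[OF C] v by auto
  have "?R `` {v} \<in> V // ?R" using vV by (rule quotientI)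
  moreover have "v \<in> ?R `` {v}" using vV by auto
  ultimately have "C = ?R `` {v}" using clusters_disjoint[OF C, of "?R `` {v}"] v
    unfolding clusters_def by blast
  thus ?thesis using vV by auto
qed

lemma cluster_nonempty: "C \<in> clusters V F \<Longrightarrow> C \<noteq> {}"
  unfolding clusters_def using in_quotient_imp_non_empty[OF cluster_equiv] .

lemma cluster_edge:
  assumes "C \<in> clusters V F" "e \<in> F" "u \<in> e" "u \<in> C"
  shows "e \<subseteq> C"
proof
  fix w assume w: "w \<in> e"
  have "w \<in> V" using F assms w by auto
  moreover have "(u, w) \<in> (adj_rel F)\<^sup>*"
  proof (cases "u = w")
    case False
    from F assms(2) obtain x y where "e = {x, y}" by (auto simp: card_2_iff)
    hence "e = {u, w}" using w assms(3) False by auto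
    thus ?thesis using assms(2) by (auto simp: adj_rel_def)
  qed auto
  ultimately show "w \<in> C" using cluster_eq[OF assms(1,4)] by auto
qed

lemma finite_F: "finite F"
proof (rule finite_subset)
  show "F \<subseteq> Pow V" using F by auto
qed (use V in simp)

text \<open>Unions of clusters are exactly the vertex sets not separated by an edge.\<close>

lemma prod_clusters:
  fixes y t :: real
  shows "(\<Prod>C\<in>clusters V F. 1 + y ^ card C * t ^ edges_in F C) =
    (\<Sum>S\<in>{S. S \<subseteq> V \<and> (\<forall>e\<in>F. e \<subseteq> S \<or> e \<subseteq> V - S)}. y ^ card S * t ^ edges_in F S)"
proof -
  let ?g = "\<lambda>C. y ^ card C * t ^ edges_in F C"
  have prodD: "(\<Prod>C\<in>D. ?g C) = ?g (\<Union>D)" if D: "D \<subseteq> clusters V F" for D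
  proof -
    have finD: "finite D" using D finite_clusters finite_subset by blast
    have "card (\<Union>D) = (\<Sum>C\<in>D. card C)"
    proof (rule card_Union_disjoint)
      show "pairwise disjnt D" unfolding pairwise_def disjnt_def using D clusters_disjoint
        by (meson subsetD)
    qed (use D finite_cluster in auto)
    moreover have "edges_in F (\<Union>D) = (\<Sum>C\<in>D. edges_in F C)"
    proof -
      have "{e \<in> F. e \<subseteq> \<Union>D} = (\<Union>C\<in>D. {e \<in> F. e \<subseteq> C})"
      proof (intro equalityI subsetI)
        fix e assume e: "e \<in> {e \<in> F. e \<subseteq> \<Union>D}"
        hence "e \<noteq> {}" using F by auto
        then obtain u where "u \<in> e" by auto
        with e obtain C where "C \<in> D" "u \<in> C" by auto
        thus "e \<in> (\<Union>C\<in>D. {e \<in> F. e \<subseteq> C})" using cluster_edge[of C e u] D e \<open>u \<in> e\<close> by auto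
      qed auto
      moreover have "card (\<Union>C\<in>D. {e \<in> F. e \<subseteq> C}) = (\<Sum>C\<in>D. card {e \<in> F. e \<subseteq> C})"
      proof (rule card_UN_disjoint[OF finD])
        show "\<forall>C\<in>D. \<forall>C'\<in>D. C \<noteq> C' \<longrightarrow> {e \<in> F. e \<subseteq> C} \<inter> {e \<in> F. e \<subseteq> C'} = {}"
        proof (intro ballI impI)
          fix C C' assume CC: "C \<in> D" "C' \<in> D" "C \<noteq> C'"
          hence disj: "C \<inter> C' = {}" using clusters_disjoint D by blast
          have "False" if "e \<in> F" "e \<subseteq> C" "e \<subseteq> C'" for e
          proof -
            have "e = {}" using that disj by blast
            thus False using F that by auto
          qed
          thus "{e \<in> F. e \<subseteq> C} \<inter> {e \<in> F. e \<subseteq> C'} = {}" by auto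
        qed
      qed (use finite_F in auto)
      ultimately show ?thesis unfolding edges_in_def by simp
    qed
    ultimately show ?thesis by (simp add: prod.distrib power_sum)
  qed
  have "(\<Prod>C\<in>clusters V F. 1 + ?g C) = (\<Sum>D\<in>Pow (clusters V F). \<Prod>C\<in>D. ?g C)"
    by (rule sum_prod_Pow[OF finite_clusters, symmetric])
  also have "\<dots> = (\<Sum>D\<in>Pow (clusters V F). ?g (\<Union>D))"
    by (intro sum.cong refl prodD) auto
  also have "\<dots> = (\<Sum>S\<in>{S. S \<subseteq> V \<and> (\<forall>e\<in>F. e \<subseteq> S \<or> e \<subseteq> V - S)}. ?g S)"
  proof (rule sum.reindex_bij_witness[where i = "\<lambda>S. {C \<in> clusters V F. C \<subseteq> S}" and j = Union])
    fix D assume D: "D \<in> Pow (clusters V F)"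
    show "{C \<in> clusters V F. C \<subseteq> \<Union>D} = D"
    proof (intro equalityI subsetI)
      fix C assume C: "C \<in> {C \<in> clusters V F. C \<subseteq> \<Union>D}"
      then obtain u where "u \<in> C" using cluster_nonempty by blast
      with C obtain C' where "C' \<in> D" "u \<in> C'" by auto
      thus "C \<in> D" using clusters_disjoint[of C C'] C D \<open>u \<in> C\<close> by auto
    qed (use D in auto)
    show "\<Union>D \<in> {S. S \<subseteq> V \<and> (\<forall>e\<in>F. e \<subseteq> S \<or> e \<subseteq> V - S)}"
    proof (intro CollectI conjI ballI)
      show "\<Union>D \<subseteq> V" using D clusters_subset by blast
      fix e assume e: "e \<in> F"
      show "e \<subseteq> \<Union>D \<or> e \<subseteq> V - \<Union>D"
      proof (cases "e \<inter> \<Union>D = {}")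
        case True thus ?thesis using F e by auto
      next
        case False
        then obtain u C where "u \<in> e" "u \<in> C" "C \<in> D" by auto
        thus ?thesis using cluster_edge[of C e u] D e by auto
      qed
    qed
  next
    fix S assume S: "S \<in> {S. S \<subseteq> V \<and> (\<forall>e\<in>F. e \<subseteq> S \<or> e \<subseteq> V - S)}"
    show "\<Union>{C \<in> clusters V F. C \<subseteq> S} = S"
    proof (intro equalityI subsetI)
      fix u assume u: "u \<in> S"
      hence "u \<in> \<Union>(clusters V F)" unfolding clusters_Union using S by auto
      then obtain C where C: "C \<in> clusters V F" "u \<in> C" by auto
      have "w \<in> S" if "(u, w) \<in> (adj_rel F)\<^sup>*" for w
        using that
      proof (induction rule: rtrancl_induct)
        case (step y z)
        thus ?case using S by (auto simp: adj_rel_def)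
      qed (use u in simp)
      hence "C \<subseteq> S" using cluster_eq[OF C] by auto
      thus "u \<in> \<Union>{C \<in> clusters V F. C \<subseteq> S}" using C by auto
    qed auto
  qed auto
  finally show ?thesis .
qed

text \<open>With distances \<open>dd\<close> from \<open>v\<close>, every other vertex of the
  cluster is the farther end of an edge to a vertex closer to \<open>v\<close>, so the map
  \<open>g\<close> from edges to farther ends covers \<open>C - {v}\<close>.\<close>

lemma cluster_edges_ge:
  assumes C: "C \<in> clusters V F"
  shows "card C \<le> edges_in F C + 1"
proof -
  from cluster_nonempty[OF C] obtain v where v: "v \<in> C" by auto
  define dd where "dd u = (LEAST k. (v, u) \<in> adj_rel F ^^ k)" for u
  define g where "g e = (SOME x. x \<in> e \<and> (\<forall>z\<in>e. dd z \<le> dd x))" for e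
  have "C - {v} \<subseteq> g ` {e \<in> F. e \<subseteq> C}"
  proof
    fix u assume u: "u \<in> C - {v}"
    hence "(v, u) \<in> (adj_rel F)\<^sup>*" using cluster_eq[OF C v] by auto
    then obtain k where "(v, u) \<in> adj_rel F ^^ k" by (auto dest: rtrancl_imp_relpow)
    hence k: "(v, u) \<in> adj_rel F ^^ dd u" unfolding dd_def by (rule LeastI)
    obtain j where j: "dd u = Suc j" using k u by (cases "dd u") auto
    with k obtain y where y: "(v, y) \<in> adj_rel F ^^ j" "{y, u} \<in> F" by (auto simp: adj_rel_def)
    have "dd y \<le> j" unfolding dd_def using y(1) by (rule Least_le)
    hence lt: "dd y < dd u" using j by simp
    have "g {y, u} = u" unfolding g_def by (rule some_equality) (use lt in auto)
    moreover have "{y, u} \<subseteq> C" using cluster_edge[OF C y(2), of u] u by auto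
    ultimately show "u \<in> g ` {e \<in> F. e \<subseteq> C}" using y(2) by (intro image_eqI[of _ _ "{y, u}"]) auto
  qed
  hence "card (C - {v}) \<le> card {e \<in> F. e \<subseteq> C}"
    using finite_F by (intro surj_card_le) auto
  thus ?thesis using v finite_cluster[OF C] by (simp add: edges_in_def)
qed

end

text \<open>An edge of the tree is determined by its longer word, and a shortest word of
  \<open>S\<close> is never the longer end of an edge inside \<open>S\<close>.\<close>

lemma tree_edges_in:
  assumes "finite S" "S \<noteq> {}"
  shows "edges_in (tree_edges d) S < card S"
proof -
  obtain m where m: "m \<in> S" "\<And>x. x \<in> S \<Longrightarrow> length m \<le> length x"
    using ex_min_if_finite[of "length ` S"] assms
    by (metis arg_min_if_finite(1) arg_min_least)
  have "{e \<in> tree_edges d. e \<subseteq> S} \<subseteq> (\<lambda>x. {butlast x, x}) ` (S - {m})"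
  proof
    fix e assume e: "e \<in> {e \<in> tree_edges d. e \<subseteq> S}"
    then obtain xs i where x: "e = {xs, xs @ [i]}" by (auto simp: tree_edges_def)
    have "xs @ [i] \<noteq> m" using m(2)[of xs] e x by auto
    thus "e \<in> (\<lambda>x. {butlast x, x}) ` (S - {m})" using e x
      by (intro image_eqI[of _ _ "xs @ [i]"]) auto
  qed
  hence "edges_in (tree_edges d) S \<le> card (S - {m})"
    unfolding edges_in_def using assms by (intro surj_card_le) auto
  also have "\<dots> < card S" using m assms by (intro psubset_card_mono) auto
  finally show ?thesis .
qed

text \<open>A cluster of at most \<open>k\<close> vertices through \<open>v\<close> stays in the
  ball of radius \<open>k\<^sup>2\<close>, where the graph is a tree, and in a tree a nonempty
  finite set spans fewer edges than it has vertices.\<close>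

lemma good_cluster_tree:
  assumes V: "finite V" and E: "\<forall>e\<in>E. e \<subseteq> V \<and> card e = 2" and F: "F \<subseteq> E"
    and C: "C \<in> clusters V F" "card C \<le> k" and v: "v \<in> C" "good d (k\<^sup>2) E v"
  shows "edges_in F C < card C"
proof -
  have F2: "\<forall>e\<in>F. e \<subseteq> V \<and> card e = 2" using E F by auto
  note fC = finite_cluster[OF V F2 C(1)]
  define B where "B = nbhd_verts E (k\<^sup>2) v"
  \<comment> \<open>\<open>comp_subset_ball\<close> speaks of paths inside a set of at most
    \<open>k\<close> vertices, so the connecting paths have to be kept inside
    \<open>C\<close>.\<close>
  have "C \<subseteq> comp F C v"
  proof
    fix u assume "u \<in> C"
    hence "(v, u) \<in> (adj_rel F)\<^sup>*" using cluster_eq[OF V F2 C(1) v(1)] by auto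
    thus "u \<in> comp F C v"
    proof (induction rule: rtrancl_induct)
      case base thus ?case by (simp add: comp_def)
    next
      case (step y z)
      have yC: "y \<in> C" using step comp_subset[OF v(1)] by blast
      have yz: "{y, z} \<in> F" using step by (simp add: adj_rel_def)
      have "z \<in> C" using cluster_edge[OF V F2 C(1) yz, of y] yC by auto
      thus ?case using comp_closed[OF _ v(1) _ yz] step by auto
    qed
  qed
  also have "\<dots> \<subseteq> nbhd_verts F (k\<^sup>2) v" by (rule comp_subset_ball[OF fC C(2)])
  also have "\<dots> \<subseteq> B"
  proof -
    have "adj_rel F \<subseteq> adj_rel E" using F by (auto simp: adj_rel_def)
    hence "adj_rel F ^^ j \<subseteq> adj_rel E ^^ j" for j by (induction j) auto
    thus ?thesis unfolding nbhd_verts_def B_def by blast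
  qed
  finally have CB: "C \<subseteq> B" .
  from v(2) obtain f where f: "bij_betw f B (nbhd_verts (tree_edges d) (k\<^sup>2) [])"
    and iso:
      "\<forall>u\<in>B. \<forall>w\<in>B. {u, w} \<in> nbhd_edges E (k\<^sup>2) v \<longleftrightarrow> {f u, f w} \<in> nbhd_edges (tree_edges d) (k\<^sup>2) []"
    unfolding good_def nbhd_iso_def rooted_iso_def B_def by blast
  have finE: "finite E" by (rule finite_subset[of _ "Pow V"]) (use E V in auto)
  have "edges_in F C \<le> edges_in (nbhd_edges E (k\<^sup>2) v) C"
    unfolding edges_in_def nbhd_edges_def using F CB finE by (intro card_mono) (auto simp: B_def)
  also have "\<dots> = edges_in (nbhd_edges (tree_edges d) (k\<^sup>2) []) (f ` C)"
    by (rule edges_in_iso[OF f iso _ _ CB]) (use E tree_edges_card in \<open>auto simp: nbhd_edges_def\<close>)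
  also have "\<dots> \<le> edges_in (tree_edges d) (f ` C)"
  proof -
    have "finite {e \<in> tree_edges d. e \<subseteq> f ` C}"
      by (rule finite_subset[of _ "Pow (f ` C)"]) (use fC in auto)
    thus ?thesis unfolding edges_in_def nbhd_edges_def by (intro card_mono) auto
  qed
  also have "\<dots> < card (f ` C)" using fC v by (intro tree_edges_in) auto
  also have "card (f ` C) = card C"
    using f CB by (intro card_image) (auto simp: bij_betw_def intro: inj_on_subset)
  finally show ?thesis .
qed

text \<open>\<open>S\<close> collects the clusters that take the second summand of their weight.
  Dividing the weight \<open>w\<close> of open edges inside \<open>S\<close> by \<open>q - 1\<close>
  compensates, on a tree, all but one of the factors \<open>q - 1\<close> attached to its
  vertices.\<close>

definition two_spin :: "'a set \<Rightarrow> 'a set set \<Rightarrow> real \<Rightarrow> real \<Rightarrow> real \<Rightarrow> real" where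
  "two_spin V E q w B = (\<Sum>S\<in>Pow V. ((q - 1) * exp (- B)) ^ card S *
     (1 + w / (q - 1)) ^ edges_in E S * (1 + w) ^ edges_in E (V - S))"

text \<open>The product over clusters is expanded into a sum over unions \<open>S\<close> of
  clusters. After interchanging the sums, \<open>S\<close> is fixed and the open edges range freely
  over those inside \<open>S\<close> and those inside its complement, which yields one factor per
  edge.\<close>

lemma two_spin_clusters:
  assumes V: "finite V" and E: "\<forall>e\<in>E. e \<subseteq> V \<and> card e = 2"
  shows "two_spin V E q w B = (\<Sum>F\<in>Pow E. w ^ card F *
    (\<Prod>C\<in>clusters V F. 1 + ((q - 1) * exp (- B)) ^ card C * (1 / (q - 1)) ^ edges_in F C))"
proof -
  define y t where "y = (q - 1) * exp (- B)" and "t = 1 / (q - 1)"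
  have finE: "finite E" by (rule finite_subset[of _ "Pow V"]) (use E V in auto)
  have "(\<Sum>F\<in>Pow E. w ^ card F * (\<Prod>C\<in>clusters V F. 1 + y ^ card C * t ^ edges_in F C)) =
    (\<Sum>F\<in>Pow E. \<Sum>S\<in>{S \<in> Pow V. (\<forall>e\<in>F. e \<subseteq> S \<or> e \<subseteq> V - S)}. w ^ card F * (y ^ card S * t ^ edges_in F S))"
  proof (rule sum.cong[OF refl])
    fix F assume "F \<in> Pow E"
    hence F: "\<forall>e\<in>F. e \<subseteq> V \<and> card e = 2" using E by auto
    show "w ^ card F * (\<Prod>C\<in>clusters V F. 1 + y ^ card C * t ^ edges_in F C) =
      (\<Sum>S\<in>{S \<in> Pow V. (\<forall>e\<in>F. e \<subseteq> S \<or> e \<subseteq> V - S)}. w ^ card F * (y ^ card S * t ^ edges_in F S))"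
      unfolding prod_clusters[OF V F] sum_distrib_left by (intro sum.cong) auto
  qed
  also have
    "\<dots> = (\<Sum>S\<in>Pow V. \<Sum>F\<in>{F \<in> Pow E. (\<forall>e\<in>F. e \<subseteq> S \<or> e \<subseteq> V - S)}. w ^ card F * (y ^ card S * t ^ edges_in F S))"
    by (rule sum.swap_restrict) (use V finE in auto)
  also have "\<dots> = (\<Sum>S\<in>Pow V. y ^ card S * (1 + w * t) ^ edges_in E S * (1 + w) ^ edges_in E (V - S))"
  proof (rule sum.cong[OF refl])
    fix S assume S: "S \<in> Pow V"
    define A1 where "A1 = {e \<in> E. e \<subseteq> S}"
    define A2 where "A2 = {e \<in> E. e \<subseteq> V - S}"
    have disj: "A1 \<inter> A2 = {}"
    proof -
      have False if "e \<in> E" "e \<subseteq> S" "e \<subseteq> V - S" for e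
      proof -
        have "e = {}" using that by blast
        thus False using E that by auto
      qed
      thus ?thesis by (auto simp: A1_def A2_def)
    qed
    have fin: "finite A1" "finite A2" using finE by (auto simp: A1_def A2_def)
    define f where "f e = (if e \<subseteq> S then w * t else w)" for e
    have f2: "f e = w" if "e \<in> A2" for e using that disj by (auto simp: f_def A1_def A2_def)
    have fprod: "(\<Prod>e\<in>F. f e) = w ^ card F * t ^ edges_in F S" if "F \<subseteq> E" for F
    proof -
      have fF: "finite F" using that finE finite_subset by blast
      have "(\<Prod>e\<in>F. f e) = (\<Prod>e\<in>F. w * (if e \<subseteq> S then t else 1))"
        by (intro prod.cong) (auto simp: f_def)
      thus ?thesis using fF by (simp add: prod.distrib prod.If_cases Int_def edges_in_def)
    qed
    have "(\<Sum>F\<in>{F \<in> Pow E. (\<forall>e\<in>F. e \<subseteq> S \<or> e \<subseteq> V - S)}. w ^ card F * (y ^ card S * t ^ edges_in F S)) =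
      (\<Sum>F\<in>Pow (A1 \<union> A2). y ^ card S * (\<Prod>e\<in>F. f e))"
    proof (rule sum.cong)
      show "{F \<in> Pow E. (\<forall>e\<in>F. e \<subseteq> S \<or> e \<subseteq> V - S)} = Pow (A1 \<union> A2)"
        unfolding A1_def A2_def by blast
      fix F assume "F \<in> Pow (A1 \<union> A2)"
      hence "F \<subseteq> E" by (auto simp: A1_def A2_def)
      thus "w ^ card F * (y ^ card S * t ^ edges_in F S) = y ^ card S * (\<Prod>e\<in>F. f e)"
        by (simp add: fprod)
    qed
    also have "\<dots> = y ^ card S * (\<Prod>e\<in>A1 \<union> A2. 1 + f e)"
      using fin by (simp add: sum_distrib_left[symmetric] sum_prod_Pow)
    also have "(\<Prod>e\<in>A1 \<union> A2. 1 + f e) = (\<Prod>e\<in>A1. 1 + f e) * (\<Prod>e\<in>A2. 1 + f e)"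
      using fin disj by (rule prod.union_disjoint)
    also have "(\<Prod>e\<in>A1. 1 + f e) = (1 + w * t) ^ card A1" by (simp add: f_def A1_def)
    also have "(\<Prod>e\<in>A2. 1 + f e) = (1 + w) ^ card A2" by (simp add: f2)
    finally show "(\<Sum>F\<in>{F \<in> Pow E. (\<forall>e\<in>F. e \<subseteq> S \<or> e \<subseteq> V - S)}. w ^ card F * (y ^ card S * t ^ edges_in F S)) =
      y ^ card S * (1 + w * t) ^ edges_in E S * (1 + w) ^ edges_in E (V - S)"
      by (simp add: A1_def A2_def edges_in_def)
  qed
  finally show ?thesis by (simp add: two_spin_def y_def t_def)
qed

text \<open>The powers of \<open>q - 1\<close> combine to the exponent \<open>m - j\<close>, which
  is at most 1 for a connected cluster with \<open>m\<close> vertices and \<open>j\<close> edges and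
  equal to 1 for a tree; since \<open>q - 1 \<ge> 1\<close>, a smaller exponent means a smaller
  weight.\<close>

lemma cluster_weight:
  fixes q B :: real
  assumes q: "q \<ge> 2"
  shows "m \<le> j + 1 \<Longrightarrow> ((q - 1) * exp (- B)) ^ m * (1 / (q - 1)) ^ j \<le> (q - 1) * exp (- B * real m)"
    and "m = j + 1 \<Longrightarrow> ((q - 1) * exp (- B)) ^ m * (1 / (q - 1)) ^ j = (q - 1) * exp (- B * real m)"
proof -
  have e: "exp (- B) ^ m = exp (- B * real m)" for m
    by (simp add: exp_of_nat_mult[symmetric] mult.commute)
  have p: "(q - 1) ^ Suc j * (1 / (q - 1)) ^ j = q - 1"
    using q by (simp add: power_divide)
  show "m = j + 1 \<Longrightarrow> ((q - 1) * exp (- B)) ^ m * (1 / (q - 1)) ^ j = (q - 1) * exp (- B * real m)"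
    using p e[of "Suc j"] by (simp add: power_mult_distrib mult_ac)
  assume "m \<le> j + 1"
  hence "(q - 1) ^ m \<le> (q - 1) ^ Suc j" using q by (intro power_increasing) auto
  hence "(q - 1) ^ m * (1 / (q - 1)) ^ j \<le> (q - 1) ^ Suc j * (1 / (q - 1)) ^ j"
    using q by (intro mult_right_mono) auto
  hence "(q - 1) ^ m * (1 / (q - 1)) ^ j \<le> q - 1" unfolding p .
  hence "(q - 1) ^ m * (1 / (q - 1)) ^ j * exp (- B * real m) \<le> (q - 1) * exp (- B * real m)"
    by (rule mult_right_mono) simp
  thus "((q - 1) * exp (- B)) ^ m * (1 / (q - 1)) ^ j \<le> (q - 1) * exp (- B * real m)"
    using e[of m] by (simp add: power_mult_distrib mult_ac)
qed

lemma two_spin_le_rc: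
  assumes V: "finite V" and E: "\<forall>e\<in>E. e \<subseteq> V \<and> card e = 2" and q: "q \<ge> 2" and w: "w \<ge> 0"
  shows "two_spin V E q w B \<le> rc_partition V E q w B"
proof -
  have finE: "finite E" by (rule finite_subset[of _ "Pow V"]) (use E V in auto)
  show ?thesis
    unfolding two_spin_clusters[OF V E] rc_partition_altdef[OF finE]
  proof (intro sum_mono mult_left_mono prod_mono conjI)
    fix F C assume "F \<in> Pow E" and C: "C \<in> clusters V F"
    hence F: "\<forall>e\<in>F. e \<subseteq> V \<and> card e = 2" using E by auto
    show "1 + ((q - 1) * exp (- B)) ^ card C * (1 / (q - 1)) ^ edges_in F C \<le> 1 + (q - 1) * exp (- B * real (card C))"
      using cluster_weight(1)[OF q cluster_edges_ge[OF V F C], of B] by simp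
    show "0 \<le> 1 + ((q - 1) * exp (- B)) ^ card C * (1 / (q - 1)) ^ edges_in F C"
      using q by (intro add_nonneg_nonneg mult_nonneg_nonneg) auto
  qed (use w in auto)
qed

text \<open>The clusters are disjoint, so at most \<open>n / k\<close> of them have more than
  \<open>k\<close> vertices. A small cluster with a cycle consists of bad vertices, and choosing one
  from each counts these clusters injectively.\<close>

lemma card_cyclic_clusters:
  assumes E: "\<forall>e\<in>E. e \<subseteq> {..<n} \<and> card e = 2" and F: "F \<subseteq> E" and k: "k > 0"
  shows "real (card {C \<in> clusters {..<n} F. card C \<le> edges_in F C}) \<le> real n / real k + real (nbad d (k\<^sup>2) n E)"
proof -
  let ?V = "{..<n}"
  have F2: "\<forall>e\<in>F. e \<subseteq> ?V \<and> card e = 2" using E F by auto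
  note cl = finite_clusters[OF finite_lessThan F2] clusters_disjoint[OF finite_lessThan F2]
    clusters_subset[OF finite_lessThan F2] finite_cluster[OF finite_lessThan F2] cluster_nonempty[OF finite_lessThan F2]
  define X1 where "X1 = {C \<in> clusters ?V F. card C > k}"
  define X2 where "X2 = {C \<in> clusters ?V F. card C \<le> k \<and> card C \<le> edges_in F C}"
  have fin: "finite X1" "finite X2" using cl(1) by (auto simp: X1_def X2_def)
  have "card {C \<in> clusters ?V F. card C \<le> edges_in F C} \<le> card (X1 \<union> X2)"
    using fin by (intro card_mono) (auto simp: X1_def X2_def)
  also have "\<dots> \<le> card X1 + card X2" by (rule card_Un_le)
  finally have 1: "card {C \<in> clusters ?V F. card C \<le> edges_in F C} \<le> card X1 + card X2" .
  have "card X1 * k \<le> n"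
  proof -
    have "card X1 * k = (\<Sum>C\<in>X1. k)" by simp
    also have "\<dots> \<le> (\<Sum>C\<in>X1. card C)" by (intro sum_mono) (auto simp: X1_def)
    also have "\<dots> = card (\<Union>X1)"
      using cl by (intro card_Union_disjoint[symmetric]) (auto simp: X1_def pairwise_def disjnt_def)
    also have "\<dots> \<le> card ?V" using cl(3) by (intro card_mono) (auto simp: X1_def)
    finally show ?thesis by simp
  qed
  hence "real (card X1 * k) \<le> real n" by (simp only: of_nat_le_iff)
  hence 2: "real (card X1) \<le> real n / real k" using k by (simp add: field_simps)
  define g where "g C = (SOME v. v \<in> C)" for C :: "nat set"
  have g: "g C \<in> C" if "C \<in> X2" for C
    using cl(5)[of C] that unfolding g_def X2_def by (simp add: some_in_eq)
  have "card X2 \<le> nbad d (k\<^sup>2) n E"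
    unfolding nbad_def
  proof (rule card_inj_on_le[of g])
    show "inj_on g X2"
    proof (rule inj_onI)
      fix C C' assume C: "C \<in> X2" "C' \<in> X2" "g C = g C'"
      hence "C \<inter> C' \<noteq> {}" using g[of C] g[of C'] by auto
      thus "C = C'" using cl(2)[of C C'] C by (auto simp: X2_def)
    qed
    show "g ` X2 \<subseteq> {v. v < n \<and> \<not> good d (k\<^sup>2) E v}"
    proof
      fix v assume "v \<in> g ` X2"
      then obtain C where C: "C \<in> X2" "v \<in> C" using g by auto
      have "v < n" using cl(3)[of C] C by (auto simp: X2_def)
      moreover have "\<not> good d (k\<^sup>2) E v"
        using good_cluster_tree[OF finite_lessThan E F, of C k v d] C by (auto simp: X2_def)
      ultimately show "v \<in> {v. v < n \<and> \<not> good d (k\<^sup>2) E v}" by simp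
    qed
  qed simp
  with 1 2 show ?thesis by linarith
qed

text \<open>For a tree cluster the two weights agree. For any other cluster the random cluster
  weight is at most \<open>q\<close> since \<open>B \<ge> 0\<close>, while the two-spin weight is at
  least 1, so each cyclic cluster costs at most one factor \<open>q\<close>.\<close>

lemma rc_le_two_spin:
  assumes E: "\<forall>e\<in>E. e \<subseteq> {..<n} \<and> card e = 2" and q: "q \<ge> 2" and w: "w \<ge> 0" and B: "B \<ge> 0" and k:
    "k > 0"
  shows "rc_partition {..<n} E q w B \<le>
    q powr (real n / real k + real (nbad d (k\<^sup>2) n E)) * two_spin {..<n} E q w B"
proof -
  have finE: "finite E" by (rule finite_subset[of _ "Pow {..<n}"]) (use E in auto)
  define p where "p = q powr (real n / real k + real (nbad d (k\<^sup>2) n E))"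
  define h where "h F C = 1 + ((q - 1) * exp (- B)) ^ card C * (1 / (q - 1)) ^ edges_in F C"
    for F :: "nat set set" and C :: "nat set"
  have h1: "h F C \<ge> 1" for F C using q by (simp add: h_def)
  have main:
    "(\<Prod>C\<in>clusters {..<n} F. 1 + (q - 1) * exp (- B * real (card C))) \<le> p * (\<Prod>C\<in>clusters {..<n} F. h F C)"
    if "F \<in> Pow E" for F
  proof -
    have F: "\<forall>e\<in>F. e \<subseteq> {..<n} \<and> card e = 2" and FE: "F \<subseteq> E" using E that by auto
    note fc = finite_clusters[OF finite_lessThan F]
    have "(\<Prod>C\<in>clusters {..<n} F. 1 + (q - 1) * exp (- B * real (card C))) \<le>
      (\<Prod>C\<in>clusters {..<n} F. (if card C \<le> edges_in F C then q else 1) * h F C)"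
    proof (rule prod_mono, intro conjI)
      fix C assume C: "C \<in> clusters {..<n} F"
      show "0 \<le> 1 + (q - 1) * exp (- B * real (card C))" using q by simp
      show "1 + (q - 1) * exp (- B * real (card C)) \<le> (if card C \<le> edges_in F C then q else 1) * h F C"
      proof (cases "card C \<le> edges_in F C")
        case True
        have "exp (- B * real (card C)) \<le> 1" using B by simp
        hence "1 + (q - 1) * exp (- B * real (card C)) \<le> 1 + (q - 1) * 1" using q
          by (intro add_left_mono mult_left_mono) auto
        also have "\<dots> \<le> q * h F C" using h1[of F C] q by (simp add: mult_le_cancel_left1)
        finally show ?thesis using True by simp
      next
        case False
        hence "card C = edges_in F C + 1" using cluster_edges_ge[OF finite_lessThan F C] by linarith
        hence "h F C = 1 + (q - 1) * exp (- B * real (card C))"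
          unfolding h_def by (subst cluster_weight(2)[OF q]) auto
        thus ?thesis using False by simp
      qed
    qed
    also have
      "\<dots> = q ^ card {C \<in> clusters {..<n} F. card C \<le> edges_in F C} * (\<Prod>C\<in>clusters {..<n} F. h F C)"
      using fc by (simp add: prod.distrib prod.If_cases Int_def)
    also have "\<dots> \<le> p * (\<Prod>C\<in>clusters {..<n} F. h F C)"
    proof (rule mult_right_mono)
      show "q ^ card {C \<in> clusters {..<n} F. card C \<le> edges_in F C} \<le> p"
        using card_cyclic_clusters[OF E FE k, of d] q
        by (subst powr_realpow[symmetric]) (auto simp: p_def intro!: powr_mono)
      show "0 \<le> (\<Prod>C\<in>clusters {..<n} F. h F C)"
        using h1 order_trans[OF zero_le_one] by (intro prod_nonneg) blast
    qed
    finally show ?thesis .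
  qed
  have "w ^ card F * (\<Prod>C\<in>clusters {..<n} F. 1 + (q - 1) * exp (- B * real (card C))) \<le>
      p * (w ^ card F * (\<Prod>C\<in>clusters {..<n} F. h F C))" if "F \<in> Pow E" for F
    using mult_left_mono[OF main[OF that], of "w ^ card F"] w by (simp add: mult.left_commute)
  thus ?thesis
    unfolding rc_partition_altdef[OF finE] two_spin_clusters[OF finite_lessThan E] p_def[symmetric]
      h_def[symmetric] sum_distrib_left
    by (intro sum_mono) auto
qed

text \<open>Deterministic bounds to cover the exceptional graphs: there are at most \<open>n\<close>
  clusters, each of weight at most \<open>q\<close>, and the configuration without open edges alone
  contributes at least 1.\<close>

lemma rc_bounds:
  assumes E: "\<forall>e\<in>E. e \<subseteq> {..<n} \<and> card e = 2" and q: "q \<ge> 2" and w: "w \<ge> 0" and B: "B \<ge> 0"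
  shows "1 \<le> rc_partition {..<n} E q w B" "rc_partition {..<n} E q w B \<le> q ^ n * (1 + w) ^ card E"
proof -
  have finE: "finite E" by (rule finite_subset[of _ "Pow {..<n}"]) (use E in auto)
  define P where "P F = (\<Prod>C\<in>clusters {..<n} F. 1 + (q - 1) * exp (- B * real (card C)))" for F
  have P1: "1 \<le> P F" for F unfolding P_def using q by (intro prod_ge_1) auto
  have P2: "P F \<le> q ^ n" if "F \<subseteq> E" for F
  proof -
    have F: "\<forall>e\<in>F. e \<subseteq> {..<n} \<and> card e = 2" using E that by auto
    have "P F \<le> (\<Prod>C\<in>clusters {..<n} F. q)"
      unfolding P_def
    proof (rule prod_mono, intro conjI)
      fix C assume "C \<in> clusters {..<n} F"
      show "0 \<le> 1 + (q - 1) * exp (- B * real (card C))" using q by simp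
      have "exp (- B * real (card C)) \<le> 1" using B by simp
      hence "1 + (q - 1) * exp (- B * real (card C)) \<le> 1 + (q - 1) * 1" using q
        by (intro add_left_mono mult_left_mono) auto
      thus "1 + (q - 1) * exp (- B * real (card C)) \<le> q" by simp
    qed
    also have "\<dots> = q ^ card (clusters {..<n} F)" by simp
    also have "\<dots> \<le> q ^ n"
    proof (rule power_increasing)
      have "card (clusters {..<n} F) = (\<Sum>C\<in>clusters {..<n} F. 1)" by simp
      also have "\<dots> \<le> (\<Sum>C\<in>clusters {..<n} F. card C)"
        using cluster_nonempty[OF finite_lessThan F] finite_cluster[OF finite_lessThan F]
        by (intro sum_mono) (simp add: Suc_le_eq card_gt_0_iff)
      also have "\<dots> = card (\<Union>(clusters {..<n} F))"
        using clusters_disjoint[OF finite_lessThan F] finite_cluster[OF finite_lessThan F]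
        by (intro card_Union_disjoint[symmetric]) (auto simp: pairwise_def disjnt_def)
      also have "\<dots> = n" using clusters_Union[OF finite_lessThan F] by simp
      finally show "card (clusters {..<n} F) \<le> n" .
    qed (use q in auto)
    finally show ?thesis .
  qed
  have eq: "rc_partition {..<n} E q w B = (\<Sum>F\<in>Pow E. w ^ card F * P F)"
    unfolding rc_partition_altdef[OF finE] P_def ..
  have "(\<Sum>F\<in>{{}}. w ^ card F * P F) \<le> (\<Sum>F\<in>Pow E. w ^ card F * P F)"
    using finE w P1 order_trans[OF zero_le_one P1] by (intro sum_mono2) auto
  thus "1 \<le> rc_partition {..<n} E q w B" using P1[of "{}"] unfolding eq by simp
  have "rc_partition {..<n} E q w B \<le> (\<Sum>F\<in>Pow E. (\<Prod>e\<in>F. w) * q ^ n)"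
    unfolding eq using P2 w by (intro sum_mono) (auto intro!: mult_left_mono)
  also have "\<dots> = q ^ n * (1 + w) ^ card E"
    using sum_prod_Pow[OF finE, of "\<lambda>_. w"] by (simp add: sum_distrib_right[symmetric])
  finally show "rc_partition {..<n} E q w B \<le> q ^ n * (1 + w) ^ card E" .
qed

section \<open>The Ising pressure\<close>

text \<open>The exponential rate \<open>M\<close> is arbitrary. Such events can be intersected
  finitely often, and the complement stays negligible after multiplication by any exponentially
  large quantity.\<close>

definition typical :: "nat \<Rightarrow> (nat \<Rightarrow> nat set set \<Rightarrow> bool) \<Rightarrow> bool" where
  "typical d P \<longleftrightarrow> (\<forall>M. eventually (\<lambda>n. measure_pmf.prob (random_regular_graph d n) {E. \<not> P n E}
     \<le> exp (- M * real n)) (admissible d))"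

lemma typicalD:
  "typical d P \<Longrightarrow> eventually (\<lambda>n. measure_pmf.prob (random_regular_graph d n) {E. \<not> P n E}
     \<le> exp (- M * real n)) (admissible d)"
  unfolding typical_def by blast

text \<open>Both assumptions are used with rate \<open>M + 1\<close>; the surplus
  \<open>exp (- real n)\<close> absorbs the factor 2 of the union bound.\<close>

lemma typical_conj:
  assumes "typical d P" "typical d Q"
  shows "typical d (\<lambda>n E. P n E \<and> Q n E)"
  unfolding typical_def
proof
  fix M :: real
  have "eventually (\<lambda>n. n \<ge> 1) (admissible d)" by (intro eventually_admissible eventually_ge_at_top)
  with typicalD[OF assms(1), of "M + 1"] typicalD[OF assms(2), of "M + 1"]
  show "eventually (\<lambda>n. measure_pmf.prob (random_regular_graph d n) {E. \<not> (P n E \<and> Q n E)} \<le> exp (- M * real n)) (admissible d)"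
  proof eventually_elim
    case (elim n)
    have "{E. \<not> (P n E \<and> Q n E)} = {E. \<not> P n E} \<union> {E. \<not> Q n E}" by auto
    hence "measure_pmf.prob (random_regular_graph d n) {E. \<not> (P n E \<and> Q n E)} \<le>
      exp (- (M + 1) * real n) + exp (- (M + 1) * real n)"
      using measure_Un_le[of "{E. \<not> P n E}" "measure_pmf (random_regular_graph d n)"
        "{E. \<not> Q n E}"] elim
      by simp
    also have "\<dots> = 2 * exp (- real n) * exp (- M * real n)"
      by (simp add: exp_add[symmetric] algebra_simps)
    also have "\<dots> \<le> 1 * exp (- M * real n)"
    proof (rule mult_right_mono)
      have "2 \<le> exp (1::real)" using exp_ge_add_one_self[of 1] by simp
      also have "\<dots> \<le> exp (real n)" using elim by simp
      finally show "2 * exp (- real n) \<le> 1" by (simp add: exp_minus field_simps)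
    qed simp
    finally show ?case by simp
  qed
qed

lemma typical_mono: 
  assumes "typical d P" "\<And>n E. P n E \<Longrightarrow> Q n E"
  shows "typical d Q"
  unfolding typical_def
proof
  fix M :: real
  show "eventually (\<lambda>n. measure_pmf.prob (random_regular_graph d n) {E. \<not> Q n E} \<le> exp (- M * real n)) (admissible d)"
    using typicalD[OF assms(1), of M]
  proof eventually_elim
    case (elim n)
    have "measure_pmf.prob (random_regular_graph d n) {E. \<not> Q n E} \<le> measure_pmf.prob (random_regular_graph d n) {E. \<not> P n E}"
      by (rule measure_pmf.finite_measure_mono) (use assms(2) in auto)
    thus ?case using elim by linarith
  qed
qed

lemma typical_regular: "typical d (\<lambda>n E. E \<in> regular_graphs d n \<and> n > 0)"
  unfolding typical_def
proof
  fix M :: real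
  have "eventually (\<lambda>n. n > 0) (admissible d)" by (intro eventually_admissible eventually_gt_at_top)
  with eventually_regular_graphs_nonempty[of d]
  show "eventually (\<lambda>n. measure_pmf.prob (random_regular_graph d n) {E. \<not> (E \<in> regular_graphs d n \<and> n > 0)} \<le> exp (- M * real n)) (admissible d)"
  proof eventually_elim
    case (elim n)
    have "regular_graphs d n \<inter> {E. \<not> (E \<in> regular_graphs d n \<and> n > 0)} = {}" using elim by auto
    hence "measure_pmf.prob (random_regular_graph d n) {E. \<not> (E \<in> regular_graphs d n \<and> n > 0)} = 0"
      unfolding random_regular_graph_def using elim finite_regular_graphs
        by (simp add: measure_pmf_of_set)
    thus ?case by simp
  qed
qed

lemma typical_few_bad: "d \<ge> 3 \<Longrightarrow> \<epsilon> > 0 \<Longrightarrow> typical d (\<lambda>n E. real (nbad d r n E) \<le> \<epsilon> * real n)"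
  unfolding typical_def not_le using few_bad_vertices by blast

lemma typical_all:
  fixes P :: "nat \<Rightarrow> nat \<Rightarrow> nat set set \<Rightarrow> bool" and k :: nat
  assumes "\<And>j. typical d (P j)"
  shows "typical d (\<lambda>n E. \<forall>j<k. P j n E)"
proof (induction k)
  case 0 show ?case by (rule typical_mono[OF typical_regular]) auto
next
  case (Suc k)
  show ?case by (rule typical_mono[OF typical_conj[OF Suc assms[of k]]]) (auto simp: less_Suc_eq)
qed

text \<open>The exceptional probability is below 1 for some \<open>n\<close>. This turns probability
  estimates into the existence of tree-like graphs.\<close>

lemma typical_witness:
  assumes "typical d P"
  shows "\<exists>n E. n > 0 \<and> E \<in> regular_graphs d n \<and> P n E"
proof -
  let ?Q = "\<lambda>n E. P n E \<and> E \<in> regular_graphs d n \<and> n > 0"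
  have "typical d ?Q" by (rule typical_conj[OF assms typical_regular])
  from typicalD[OF this, of 1] eventually_admissible[OF eventually_gt_at_top[of 0]]
  have "eventually (\<lambda>n. \<exists>E. ?Q n E) (admissible d)"
  proof eventually_elim
    case (elim n)
    show ?case
    proof (rule ccontr)
      assume "\<nexists>E. ?Q n E"
      hence "{E. \<not> ?Q n E} = UNIV" by auto
      hence "1 \<le> exp (- 1 * real n)" using elim(1) by simp
      moreover have "exp (- 1 * real n) < 1" using elim(2) by simp
      ultimately show False by linarith
    qed
  qed
  from eventually_happens'[OF admissible_neq_bot this] show ?thesis by blast
qed

text \<open>Each tolerance \<open>inverse (real (Suc j))\<close> comes with a pair
  \<open>r j\<close>, \<open>\<epsilon> j\<close>. The graph \<open>G k\<close> meets the
  requirements for all \<open>j \<le> k\<close> at once, so the pressures of any two graphs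
  \<open>G k\<close> and \<open>G l\<close> are comparable at the level of the smaller index and
  form a Cauchy sequence. Its limit attracts every sufficiently tree-like graph.\<close>

lemma psi_limit:
  assumes d: "d \<ge> 3" and a: "0 \<le> a" "a \<le> 1" and z: "z > 0"
  obtains c where "\<And>\<eta>. \<eta> > 0 \<Longrightarrow> \<exists>r. \<exists>\<epsilon>::real. \<epsilon> > 0 \<and> (\<forall>n E. n > 0 \<longrightarrow> E \<in> regular_graphs d n \<longrightarrow>
     real (nbad d r n E) \<le> \<epsilon> * real n \<longrightarrow> \<bar>psi n E a z - c\<bar> \<le> \<eta>)"
proof -
  have "\<forall>k. \<exists>r. \<exists>\<epsilon>::real. \<epsilon> > 0 \<and> (\<forall>n E n' E'. n > 0 \<longrightarrow> E \<in> regular_graphs d n \<longrightarrow> real (nbad d r n E) \<le> \<epsilon> * real n \<longrightarrow>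
      n' > 0 \<longrightarrow> E' \<in> regular_graphs d n' \<longrightarrow> real (nbad d r n' E') \<le> \<epsilon> * real n' \<longrightarrow>
      \<bar>psi n E a z - psi n' E' a z\<bar> \<le> inverse (real (Suc k)))"
    by (intro allI psi_close[OF a z]) simp
  then obtain r \<epsilon> where \<epsilon>: "\<And>k::nat. \<epsilon> k > (0::real)"
    and close: "\<And>k n E n' E'. n > 0 \<Longrightarrow> E \<in> regular_graphs d n \<Longrightarrow> real (nbad d (r k) n E) \<le> \<epsilon> k * real n \<Longrightarrow>
      n' > 0 \<Longrightarrow> E' \<in> regular_graphs d n' \<Longrightarrow> real (nbad d (r k) n' E') \<le> \<epsilon> k * real n' \<Longrightarrow>
      \<bar>psi n E a z - psi n' E' a z\<bar> \<le> inverse (real (Suc k))"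
    by metis
  have "\<forall>k. \<exists>n E. n > 0 \<and> E \<in> regular_graphs d n \<and> (\<forall>j<Suc k. real (nbad d (r j) n E) \<le> \<epsilon> j * real n)"
    by (intro allI typical_witness typical_all typical_few_bad d \<epsilon>)
  then obtain N G where G: "\<And>k. N k > 0" "\<And>k. G k \<in> regular_graphs d (N k)"
    "\<And>k j. j \<le> k \<Longrightarrow> real (nbad d (r j) (N k) (G k)) \<le> \<epsilon> j * real (N k)"
    by (metis less_Suc_eq_le)
  define x where "x k = psi (N k) (G k) a z" for k
  have cl: "\<bar>x k - x l\<bar> \<le> inverse (real (Suc j))" if "j \<le> k" "j \<le> l" for j k l
    unfolding x_def using G that by (intro close) auto
  have "Cauchy x"
  proof (rule metric_CauchyI)
    fix e :: real assume "e > 0"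
    then obtain j where "inverse (real (Suc j)) < e" using reals_Archimedean by blast
    thus "\<exists>M. \<forall>m\<ge>M. \<forall>n\<ge>M. dist (x m) (x n) < e"
      using cl by (intro exI[of _ j]) (auto simp: dist_real_def intro: le_less_trans)
  qed
  then obtain c where c: "x \<longlonglongrightarrow> c" using Cauchy_convergent convergent_def by blast
  show ?thesis
  proof (rule that[of c])
    fix \<eta> :: real assume "\<eta> > 0"
    then obtain j where j: "inverse (real (Suc j)) < \<eta>" using reals_Archimedean by blast
    have "\<bar>psi n E a z - c\<bar> \<le> \<eta>"
      if h: "n > 0" "E \<in> regular_graphs d n" "real (nbad d (r j) n E) \<le> \<epsilon> j * real n" for n E
    proof (rule tendsto_upperbound)
      show "(\<lambda>k. \<bar>psi n E a z - x k\<bar>) \<longlonglongrightarrow> \<bar>psi n E a z - c\<bar>" by (intro tendsto_intros c)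
      show "eventually (\<lambda>k. \<bar>psi n E a z - x k\<bar> \<le> \<eta>) sequentially"
        using eventually_ge_at_top[of j]
      proof eventually_elim
        case (elim k)
        have "\<bar>psi n E a z - x k\<bar> \<le> inverse (real (Suc j))"
          unfolding x_def by (rule close[OF h G(1) G(2) G(3)[OF elim]])
        thus ?case using j by linarith
      qed
    qed simp
    thus "\<exists>r. \<exists>\<epsilon>::real. \<epsilon> > 0 \<and> (\<forall>n E. n > 0 \<longrightarrow> E \<in> regular_graphs d n \<longrightarrow>
     real (nbad d r n E) \<le> \<epsilon> * real n \<longrightarrow> \<bar>psi n E a z - c\<bar> \<le> \<eta>)"
      using \<epsilon> by blast
  qed
qed

lemma card_edges_regular:
  assumes E: "E \<in> regular_graphs d n"
  shows "2 * card E = d * n"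
proof -
  note r = regular_graphsD[OF E]
  have "{e \<in> E. e \<inter> {..<n} \<noteq> {} \<and> \<not> e \<subseteq> {..<n}} = {}" "{e \<in> E. e \<subseteq> {..<n}} = E" using r(2) by auto
  hence "cut E {..<n} = 0" "edges_in E {..<n} = card E" unfolding cut_def edges_in_def
    by (auto simp del: Collect_empty_eq)
  thus ?thesis using cut_regular[OF E order_refl] by simp
qed

text \<open>\<open>S\<close> is the set of minus spins. Relative to the all-plus configuration each
  cut edge costs \<open>exp (- 2 * \<beta>)\<close> and each minus spin
  \<open>exp (- 2 * b)\<close>; the prefactor is the all-plus weight, with \<open>d * n / 2\<close>
  edges.\<close>

lemma ising_partition_cutsum:
  assumes E: "E \<in> regular_graphs d n"
  shows "ising_partition {..<n} E \<beta> b =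
    exp (real n * (\<beta> * real d / 2 + b)) * cutsum E (exp (- 2 * \<beta>)) (Pow {..<n}) (exp (- 2 * b))"
proof -
  note r = regular_graphsD[OF E]
  have cE: "real (card E) = real d * real n / 2"
    using arg_cong[OF card_edges_regular[OF E], of real] by simp
  have "ising_partition {..<n} E \<beta> b = (\<Sum>\<sigma> \<in> {..<n} \<rightarrow>\<^sub>E {1, -1 :: real}.
     exp (\<beta> * (real (card E) - 2 * real (cut E {v \<in> {..<n}. \<sigma> v = -1})) + b * (real n - 2 * real (card {v \<in> {..<n}. \<sigma> v = -1}))))"
    unfolding ising_partition_def insert_commute[of "-1::real"]
  proof (rule sum.cong[OF refl])
    fix \<sigma> assume s: "\<sigma> \<in> {..<n} \<rightarrow>\<^sub>E {1, -1 :: real}"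
    define S where "S = {v \<in> {..<n}. \<sigma> v = -1}"
    have \<sigma>: "\<sigma> v = (if v \<in> S then -1 else 1)" if "v < n" for v
      using s that by (auto simp: S_def PiE_iff)
    have "(\<Sum>v<n. \<sigma> v) = (\<Sum>v<n. 1 - 2 * of_bool (v \<in> S))" by (intro sum.cong) (auto simp: \<sigma>)
    also have "\<dots> = real n - 2 * real (card S)"
    proof -
      have "{..<n} \<inter> S = S" by (auto simp: S_def)
      thus ?thesis by (simp add: sum_subtractf sum_distrib_left[symmetric] of_bool_def sum.If_cases)
    qed
    finally have 1: "(\<Sum>v<n. \<sigma> v) = real n - 2 * real (card S)" .
    have "(\<Sum>e\<in>E. \<Prod>x\<in>e. \<sigma> x) = (\<Sum>e\<in>E. 1 - 2 * of_bool (e \<inter> S \<noteq> {} \<and> \<not> e \<subseteq> S))"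
    proof (rule sum.cong[OF refl])
      fix e assume e: "e \<in> E"
      then obtain x y where "e = {x, y}" "x \<noteq> y" "x < n" "y < n" using r(2)
        by (fastforce simp: card_2_iff)
      thus "(\<Prod>x\<in>e. \<sigma> x) = 1 - 2 * of_bool (e \<inter> S \<noteq> {} \<and> \<not> e \<subseteq> S)" by (auto simp: \<sigma>)
    qed
    also have "\<dots> = real (card E) - 2 * real (cut E S)"
      using r(1) by (simp add: sum_subtractf sum_distrib_left[symmetric] cut_conv_sum)
    finally show "exp (\<beta> * (\<Sum>e\<in>E. \<Prod>x\<in>e. \<sigma> x) + b * (\<Sum>v<n. \<sigma> v)) =
      exp (\<beta> * (real (card E) - 2 * real (cut E {v \<in> {..<n}. \<sigma> v = -1})) + b * (real n - 2 * real (card {v \<in> {..<n}. \<sigma> v = -1})))"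
      using 1 by (simp add: S_def)
  qed
  also have
    "\<dots> = (\<Sum>S\<in>Pow {..<n}. exp (\<beta> * (real (card E) - 2 * real (cut E S)) + b * (real n - 2 * real (card S))))"
    by (rule sum_PiE_indicator) auto
  also have
    "\<dots> = exp (real n * (\<beta> * real d / 2 + b)) * cutsum E (exp (- 2 * \<beta>)) (Pow {..<n}) (exp (- 2 * b))"
    unfolding cutsum_def sum_distrib_left
  proof (rule sum.cong[OF refl])
    fix S
    have "\<beta> * (real (card E) - 2 * real (cut E S)) + b * (real n - 2 * real (card S)) =
      real n * (\<beta> * real d / 2 + b) + (real (cut E S) * (- 2 * \<beta>) + real (card S) * (- 2 * b))"
      unfolding cE by (simp add: algebra_simps)
    thus "exp (\<beta> * (real (card E) - 2 * real (cut E S)) + b * (real n - 2 * real (card S))) =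
      exp (real n * (\<beta> * real d / 2 + b)) * (of_real (exp (- 2 * \<beta>) ^ cut E S) * exp (- 2 * b) ^ card S)"
      unfolding of_real_eq_id id_def exp_of_nat_mult[symmetric] exp_add[symmetric]
        by (rule arg_cong)
  qed
  finally show ?thesis .
qed

lemma ln_ising_psi:
  assumes E: "E \<in> regular_graphs d n" and n: "n > 0"
  shows "ln (ising_partition {..<n} E \<beta> b) / real n = \<beta> * real d / 2 + b + psi n E (exp (- 2 * \<beta>)) (exp (- 2 * b))"
proof -
  have "cutsum E (exp (- 2 * \<beta>)) (Pow {..<n}) (exp (- 2 * b)) \<ge> 1" by (intro cutsum_ge_1) auto
  thus ?thesis using n unfolding ising_partition_cutsum[OF E] psi_def
    by (simp add: ln_mult add_divide_distrib)
qed

lemma rooted_iso_image: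
  assumes "inj f" "\<forall>e\<in>E. e \<subseteq> V"
  shows "rooted_iso V E x (f ` V) ((`) f ` E) (f x)"
  unfolding rooted_iso_def
proof (intro exI conjI ballI)
  show "bij_betw f V (f ` V)" using inj_on_subset[OF assms(1)] by (simp add: bij_betw_def)
  fix u v
  have "inj ((`) f)" using assms(1) by (simp add: inj_image_eq_iff inj_def)
  hence "f ` {u, v} \<in> (`) f ` E \<longleftrightarrow> {u, v} \<in> E" by (rule inj_image_mem_iff)
  thus "{u, v} \<in> E \<longleftrightarrow> {f u, f v} \<in> (`) f ` E" by simp
qed simp

lemma finite_tree_ball: "finite (nbhd_verts (tree_edges d) r [])"
proof -
  have "xs ! i < d" if "xs \<in> tree_verts d" "i < length xs" for xs i
    using that by (auto simp: tree_verts_def split: if_splits)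
  hence "set xs \<subseteq> {..<d}" if "xs \<in> tree_verts d" for xs
    using that by (auto simp: in_set_conv_nth)
  hence "nbhd_verts (tree_edges d) r [] \<subseteq> {xs. set xs \<subseteq> {..<d} \<and> length xs \<le> r}"
    unfolding tree_ball by blast
  thus ?thesis using finite_lists_length_le[of "{..<d}" r] finite_subset by blast
qed

text \<open>\<open>locally_tree_like\<close> tests against finite rooted graphs on natural numbers,
  whereas the vertices of the tree ball are words; an injection provides the copy to test
  with.\<close>

lemma nat_tree_ball:
  obtains H :: "nat set" and EH h where "finite H" "simple_graph H EH" "h \<in> H"
    "rooted_iso (nbhd_verts (tree_edges d) r []) (nbhd_edges (tree_edges d) r []) [] H EH h"
proof
  let ?V = "nbhd_verts (tree_edges d) r []" and ?E = "nbhd_edges (tree_edges d) r []"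
  let ?f = "to_nat :: nat list \<Rightarrow> nat"
  show "finite (?f ` ?V)" using finite_tree_ball by simp
  show "?f [] \<in> ?f ` ?V" using self_in_nbhd by (rule imageI)
  show "rooted_iso ?V ?E [] (?f ` ?V) ((`) ?f ` ?E) (?f [])"
    by (rule rooted_iso_image) (auto simp: nbhd_edges_def)
  show "simple_graph (?f ` ?V) ((`) ?f ` ?E)"
  proof -
    have "card (?f ` e) = 2" if "e \<in> ?E" for e
      using that tree_edges_card[of d] by (simp add: card_image nbhd_edges_def)
    thus ?thesis by (auto simp: simple_graph_def nbhd_edges_def)
  qed
qed

text \<open>Local convergence is applied to a single test graph, the tree ball of radius
  \<open>r\<close>, whose limiting proportion is 1. Outside an event of vanishing probability this
  bounds the number of bad vertices, and there the pressure differs from its limit by at most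
  \<open>\<eta>\<close>.\<close>

lemma is_ising_pressure_exists:
  assumes c: "\<And>\<eta>. \<eta> > 0 \<Longrightarrow> \<exists>r. \<exists>\<epsilon>::real. \<epsilon> > 0 \<and> (\<forall>n E. n > 0 \<longrightarrow> E \<in> regular_graphs d n \<longrightarrow>
     real (nbad d r n E) \<le> \<epsilon> * real n \<longrightarrow> \<bar>psi n E (exp (- 2 * \<beta>)) (exp (- 2 * b)) - c\<bar> \<le> \<eta>)"
  shows "is_ising_pressure d \<beta> b (\<beta> * real d / 2 + b + c)"
  unfolding is_ising_pressure_def tendsto_in_prob_def
proof (intro allI impI)
  fix G :: "nat \<Rightarrow> nat set set pmf" and \<eta> :: real
  assume reg: "\<forall>\<^sub>F n in admissible d. set_pmf (G n) \<subseteq> regular_graphs d n" and tree: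
    "locally_tree_like d G"
    and \<eta>: "\<eta> > 0"
  from c[OF \<eta>] obtain r and \<epsilon> :: real where \<epsilon>: "\<epsilon> > 0" and close: "\<And>n E. n > 0 \<Longrightarrow> E \<in> regular_graphs d n \<Longrightarrow>
     real (nbad d r n E) \<le> \<epsilon> * real n \<Longrightarrow> \<bar>psi n E (exp (- 2 * \<beta>)) (exp (- 2 * b)) - c\<bar> \<le> \<eta>" by blast
  obtain H :: "nat set" and EH h where H: "finite H" "simple_graph H EH" "h \<in> H"
    and iso:
      "rooted_iso (nbhd_verts (tree_edges d) r []) (nbhd_edges (tree_edges d) r []) [] H EH h"
    by (rule nat_tree_ball)
  define X where "X n E = real (card {v. v < n \<and> nbhd_iso E r v H EH h}) / real n" for n and E ::
    "nat set set"
  have "nbhd_iso (tree_edges d) r [] H EH h" using iso by (simp add: nbhd_iso_def)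
  moreover have "tendsto_in_prob G X (of_bool (nbhd_iso (tree_edges d) r [] H EH h)) (admissible d)"
    using tree H unfolding locally_tree_like_def X_def by blast
  ultimately have "tendsto_in_prob G X 1 (admissible d)" by simp
  hence lim: "((\<lambda>n. measure_pmf.prob (G n) {E. \<bar>X n E - 1\<bar> > \<epsilon>}) \<longlongrightarrow> 0) (admissible d)"
    using \<epsilon> unfolding tendsto_in_prob_def by blast
  show "((\<lambda>n. measure_pmf.prob (G n) {E. \<bar>ln (ising_partition {..<n} E \<beta> b) / real n - (\<beta> * real d / 2 + b + c)\<bar> > \<eta>}) \<longlongrightarrow> 0) (admissible d)"
  proof (rule tendsto_sandwich[OF _ _ tendsto_const lim])
    have "eventually (\<lambda>n. n > 0) (admissible d)"
      by (intro eventually_admissible eventually_gt_at_top)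
    with reg show "\<forall>\<^sub>F n in admissible d. measure_pmf.prob (G n) {E. \<bar>ln (ising_partition {..<n} E \<beta> b) / real n - (\<beta> * real d / 2 + b + c)\<bar> > \<eta>}
      \<le> measure_pmf.prob (G n) {E. \<bar>X n E - 1\<bar> > \<epsilon>}"
    proof eventually_elim
      case (elim n)
      have "\<bar>X n E - 1\<bar> > \<epsilon>"
        if h: "E \<in> set_pmf (G n)"
        "\<bar>ln (ising_partition {..<n} E \<beta> b) / real n - (\<beta> * real d / 2 + b + c)\<bar> > \<eta>" for E
      proof (rule ccontr)
        assume "\<not> \<bar>X n E - 1\<bar> > \<epsilon>"
        hence 1: "1 - \<epsilon> \<le> X n E" by linarith
        have E: "E \<in> regular_graphs d n" using h elim by auto
        define A where "A = {v. v < n \<and> nbhd_iso E r v H EH h}"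
        have "good d r E v" if "v \<in> A" for v
        proof -
          from that have "rooted_iso (nbhd_verts E r v) (nbhd_edges E r v) v H EH h"
            by (simp add: A_def nbhd_iso_def)
          from rooted_iso_trans[OF this rooted_iso_sym[OF iso self_in_nbhd]] show ?thesis
            by (simp add: good_def nbhd_iso_def)
        qed
        hence "{v. v < n \<and> \<not> good d r E v} \<subseteq> {..<n} - A" by auto
        hence "nbad d r n E \<le> card ({..<n} - A)" unfolding nbad_def by (intro card_mono) auto
        also have "\<dots> = n - card A" by (subst card_Diff_subset) (auto simp: A_def)
        finally have "nbad d r n E \<le> n - card A" .
        moreover have "A \<subseteq> {..<n}" by (auto simp: A_def)
        hence "card A \<le> n" using card_mono[OF finite_lessThan, of A n] by simp
        ultimately have "nbad d r n E + card A \<le> n" by linarith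
        hence "real (nbad d r n E) + real (card A) \<le> real n" by linarith
        moreover have "real (card A) \<ge> (1 - \<epsilon>) * real n" using 1 elim(2)
          by (simp add: X_def A_def field_simps)
        ultimately have "real (nbad d r n E) \<le> \<epsilon> * real n" by (simp add: algebra_simps)
        from close[OF elim(2) E this] h(2) show False unfolding ln_ising_psi[OF E elim(2)] by simp
      qed
      thus ?case by (intro measure_pmf.finite_measure_mono_AE) (auto simp: AE_measure_pmf_iff)
    qed
  qed auto
qed

section \<open>Local convergence of random regular graphs to the tree\<close>

lemma admissible_le: "admissible d \<le> sequentially"
  unfolding admissible_def by simp

lemma random_regular_graph_support:
  "\<forall>\<^sub>F n in admissible d. set_pmf (random_regular_graph d n) = regular_graphs d n"
  using eventually_regular_graphs_nonempty[of d]
  by eventually_elim (simp add: random_regular_graph_def finite_regular_graphs)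

text \<open>All good vertices answer the test against \<open>H\<close> in the same way as the root
  of the tree, so the proportion differs from its limit 0 or 1 by at most the fraction of bad
  vertices.\<close>

lemma random_regular_graph_tree_like:
  assumes d: "d \<ge> 3"
  shows "locally_tree_like d (random_regular_graph d)"
  unfolding locally_tree_like_def tendsto_in_prob_def
proof (intro allI impI)
  fix r and H :: "nat set" and EH h and \<epsilon> :: real
  assume \<epsilon>: "\<epsilon> > 0"
  define p where "p = (of_bool (nbhd_iso (tree_edges d) r [] H EH h) :: real)"
  define X where "X n E = real (card {v. v < n \<and> nbhd_iso E r v H EH h}) / real n" for n and E ::
    "nat set set"
  have 0: "((\<lambda>n. exp (- real n)) \<longlongrightarrow> 0) (admissible d)"
  proof (rule tendsto_mono[OF admissible_le])
    show "(\<lambda>n. exp (- real n)) \<longlonglongrightarrow> 0"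
      by (intro filterlim_compose[OF exp_at_bot] filterlim_compose[OF filterlim_uminus_at_bot_at_top] filterlim_real_sequentially)
  qed
  have same: "nbhd_iso E r v H EH h \<longleftrightarrow> nbhd_iso (tree_edges d) r [] H EH h"
    if "good d r E v" for E :: "nat set set" and v
  proof -
    have g: "rooted_iso (nbhd_verts E r v) (nbhd_edges E r v) v (nbhd_verts (tree_edges d) r []) (nbhd_edges (tree_edges d) r []) []"
      using that by (simp add: good_def nbhd_iso_def)
    show ?thesis
      unfolding nbhd_iso_def
    proof
      assume "rooted_iso (nbhd_verts E r v) (nbhd_edges E r v) v H EH h"
      from rooted_iso_trans[OF rooted_iso_sym[OF g self_in_nbhd] this]
      show "rooted_iso (nbhd_verts (tree_edges d) r []) (nbhd_edges (tree_edges d) r []) [] H EH h" .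
    qed (rule rooted_iso_trans[OF g])
  qed
  have le: "\<bar>X n E - p\<bar> \<le> real (nbad d r n E) / real n" if n: "n > 0" for n E
  proof -
    define A where "A = {v. v < n \<and> nbhd_iso E r v H EH h}"
    define N where "N = {v. v < n \<and> \<not> good d r E v}"
    have fin: "finite N" "finite A" by (auto simp: N_def A_def)
    have cA: "card A \<le> n" using card_mono[of "{..<n}" A] by (auto simp: A_def)
    show ?thesis
    proof (cases "nbhd_iso (tree_edges d) r [] H EH h")
      case True
      have "{..<n} \<subseteq> A \<union> N" using same True by (auto simp: A_def N_def)
      hence "n \<le> card (A \<union> N)" using fin card_mono[of "A \<union> N" "{..<n}"] by simp
      also have "\<dots> \<le> card A + card N" by (rule card_Un_le)
      finally have "(real n - real (card A)) / real n \<le> real (card N) / real n"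
        by (intro divide_right_mono) linarith+
      moreover have "X n E - 1 = - ((real n - real (card A)) / real n)"
        using n by (simp add: X_def A_def[symmetric] diff_divide_distrib)
      moreover have "0 \<le> (real n - real (card A)) / real n" using cA by simp
      ultimately have "\<bar>X n E - 1\<bar> \<le> real (card N) / real n" by linarith
      thus ?thesis using True by (simp add: p_def N_def nbad_def)
    next
      case False
      have "A \<subseteq> N" using same False by (auto simp: A_def N_def)
      hence "card A \<le> card N" using fin card_mono by blast
      thus ?thesis using False n
        by (simp add: p_def N_def[symmetric] nbad_def X_def A_def[symmetric] divide_right_mono)
    qed
  qed
  show "((\<lambda>n. measure_pmf.prob (random_regular_graph d n) {E. \<bar>real (card {v. v < n \<and> nbhd_iso E r v H EH h}) / real n -
      of_bool (nbhd_iso (tree_edges d) r [] H EH h)\<bar> > \<epsilon>}) \<longlongrightarrow> 0) (admissible d)"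
    unfolding X_def[symmetric] p_def[symmetric]
  proof (rule tendsto_sandwich[OF _ _ tendsto_const 0])
    have "eventually (\<lambda>n. n > 0) (admissible d)"
      by (intro eventually_admissible eventually_gt_at_top)
    with few_bad_vertices[OF d \<epsilon>, of r 1]
    show "\<forall>\<^sub>F n in admissible d. measure_pmf.prob (random_regular_graph d n) {E. \<bar>X n E - p\<bar> > \<epsilon>} \<le> exp (- real n)"
    proof eventually_elim
      case (elim n)
      have "{E. \<bar>X n E - p\<bar> > \<epsilon>} \<subseteq> {E. real (nbad d r n E) > \<epsilon> * real n}"
      proof
        fix E assume "E \<in> {E. \<bar>X n E - p\<bar> > \<epsilon>}"
        hence "\<epsilon> < real (nbad d r n E) / real n" using le[OF elim(2), of E] by simp
        thus "E \<in> {E. real (nbad d r n E) > \<epsilon> * real n}" using elim(2) by (simp add: field_simps)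
      qed
      hence "measure_pmf.prob (random_regular_graph d n) {E. \<bar>X n E - p\<bar> > \<epsilon>} \<le>
        measure_pmf.prob (random_regular_graph d n) {E. real (nbad d r n E) > \<epsilon> * real n}"
        by (rule measure_pmf.finite_measure_mono) simp
      thus ?case using elim(1) by simp
    qed
  qed auto
qed

text \<open>The random regular graph is itself a tree-like sequence, so that the condition defining the
  Ising pressure is not vacuous and the definite description denotes.\<close>

lemma is_ising_pressure_unique:
  assumes d: "d \<ge> 3" and c: "is_ising_pressure d \<beta> b c" "is_ising_pressure d \<beta> b c'"
  shows "c = c'"
proof (rule ccontr)
  assume ne: "c \<noteq> c'"
  define X where "X n E = ln (ising_partition {..<n} E \<beta> b) / real n" for n and E :: "nat set set"
  \<comment> \<open>A third of the gap: no value can be within \<open>\<epsilon>\<close> of both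
    candidates, so the two exceptional events cover the whole space.\<close>
  define \<epsilon> where "\<epsilon> = \<bar>c - c'\<bar> / 3"
  have \<epsilon>: "\<epsilon> > 0" using ne by (simp add: \<epsilon>_def)
  let ?P = "\<lambda>n c. measure_pmf.prob (random_regular_graph d n) {E. \<bar>X n E - c\<bar> > \<epsilon>}"
  have "\<forall>\<^sub>F n in admissible d. set_pmf (random_regular_graph d n) \<subseteq> regular_graphs d n"
    using random_regular_graph_support[of d] by eventually_elim simp
  hence "((\<lambda>n. ?P n c) \<longlongrightarrow> 0) (admissible d)" "((\<lambda>n. ?P n c') \<longlongrightarrow> 0) (admissible d)"
    using c random_regular_graph_tree_like[OF d] \<epsilon>
      unfolding is_ising_pressure_def tendsto_in_prob_def X_def by blast+
  hence "((\<lambda>n. ?P n c + ?P n c') \<longlongrightarrow> 0 + 0) (admissible d)" by (rule tendsto_add)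
  hence "eventually (\<lambda>n. ?P n c + ?P n c' < 1) (admissible d)" by (rule order_tendstoD) simp
  from eventually_happens'[OF admissible_neq_bot this] obtain n where n: "?P n c + ?P n c' < 1"
    by blast
  have "{E. \<bar>X n E - c\<bar> > \<epsilon>} \<union> {E. \<bar>X n E - c'\<bar> > \<epsilon>} = UNIV"
    using ne by (auto simp: \<epsilon>_def abs_if split: if_splits)
  hence "1 \<le> ?P n c + ?P n c'"
    using measure_Un_le[of "{E. \<bar>X n E - c\<bar> > \<epsilon>}" "measure_pmf (random_regular_graph d n)"
      "{E. \<bar>X n E - c'\<bar> > \<epsilon>}"]
    by simp
  with n show False by simp
qed

lemma ising_pressure_eq:
  assumes "d \<ge> 3" "is_ising_pressure d \<beta> b c"
  shows "ising_pressure d \<beta> b = c"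
  unfolding ising_pressure_def using assms is_ising_pressure_unique by blast

text \<open>On a regular graph the numbers of edges inside \<open>S\<close> and inside its
  complement are functions of \<open>card S\<close> and the cut. Substituting them leaves a weight
  per cut edge, the inverse square root of \<open>(1 + w) * (1 + w / (q - 1))\<close>, and a weight
  per vertex of \<open>S\<close>; these are the origin of \<open>beta_star\<close> and
  \<open>B_star\<close>, with \<open>S\<close> as the set of minus spins.\<close>

lemma two_spin_cutsum:
  assumes E: "E \<in> regular_graphs d n" and q: "q \<ge> 2" and w: "w \<ge> 0"
  shows "two_spin {..<n} E q w B = exp (real n * (real d / 2 * ln (1 + w))) *
    cutsum E (exp (- 2 * beta_star q w)) (Pow {..<n}) (exp (- 2 * B_star d q w B))"
proof -
  define L1 L2 y where "L1 = ln (1 + w)" and "L2 = ln (1 + w / (q - 1))" and "y = ln (q - 1) - B"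
  have p: "1 + w > 0" "1 + w / (q - 1) > 0" using q w by (auto intro: add_pos_nonneg)
  have e: "1 + w = exp L1" "1 + w / (q - 1) = exp L2" "(q - 1) * exp (- B) = exp y"
    using p q by (auto simp: L1_def L2_def y_def exp_diff exp_minus field_simps)
  have bs: "- 2 * beta_star q w = - (L1 + L2) / 2" unfolding beta_star_def using p
    by (simp add: ln_mult L1_def L2_def)
  have l: "ln ((1 + w) / (1 + w / (q - 1))) = L1 - L2" "ln (exp B / (q - 1)) = B - ln (q - 1)"
    unfolding L1_def L2_def using p q by (simp_all add: ln_div)
  have Bs: "- 2 * B_star d q w B = y - real d / 2 * (L1 - L2)"
    unfolding B_star_def l y_def by (simp add: field_simps)
  show ?thesis
    unfolding two_spin_def cutsum_def sum_distrib_left bs Bs e(3) e(2) L1_def[symmetric]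
  proof (rule sum.cong[OF refl])
    fix S assume "S \<in> Pow {..<n}"
    hence S: "S \<subseteq> {..<n}" by simp
    have fS: "finite S" using S finite_subset by blast
    have "card ({..<n} - S) = n - card S" using S fS by (simp add: card_Diff_subset)
    moreover have "card S \<le> n" using S card_mono[of "{..<n}" S] by simp
    ultimately have cc: "real (card ({..<n} - S)) = real n - real (card S)" by simp
    have 1: "real (cut E S) + 2 * real (edges_in E S) = real d * real (card S)"
      using arg_cong[OF cut_regular[OF E S], of real] by simp
    have 2: "real (cut E S) + 2 * real (edges_in E ({..<n} - S)) = real d * (real n - real (card S))"
      using arg_cong[OF cut_regular[OF E, of
        "{..<n} - S"], of real] cut_Compl[OF regular_graphsD(2)[OF E], of S] cc by auto
    have e1: "real (edges_in E S) = (real d * real (card S) - real (cut E S)) / 2" using 1 by simp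
    have e2:
      "real (edges_in E ({..<n} - S)) = (real d * (real n - real (card S)) - real (cut E S)) / 2"
      using 2 by simp
    have "real (card S) * y + real (edges_in E S) * L2 + real (edges_in E ({..<n} - S)) * L1 =
      real n * (real d / 2 * L1) + (real (cut E S) * (- (L1 + L2) / 2) + real (card S) * (y - real d / 2 * (L1 - L2)))"
      unfolding e1 e2 by (simp add: field_simps)
    hence "exp (real (card S) * y + real (edges_in E S) * L2 + real (edges_in E ({..<n} - S)) * L1) =
      exp (real n * (real d / 2 * L1) + (real (cut E S) * (- (L1 + L2) / 2) + real (card S) * (y - real d / 2 * (L1 - L2))))"
      by (rule arg_cong)
    thus "exp y ^ card S * exp L2 ^ edges_in E S * (1 + w) ^ edges_in E ({..<n} - S) =
      exp (real n * (real d / 2 * L1)) *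
        (of_real (exp (- (L1 + L2) / 2) ^ cut E S) * exp (y - real d / 2 * (L1 - L2)) ^ card S)"
      unfolding exp_add exp_of_nat_mult of_real_eq_id id_def e(1) .
  qed
qed

text \<open>The all-plus weight in the Ising pressure and the prefactors of
  \<open>rc_pressure\<close> combine; the terms with \<open>ln (1 + w / (q - 1))\<close> and
  \<open>B\<close> cancel, and what is left besides \<open>c\<close> is the prefactor in
  \<open>two_spin_cutsum\<close>.\<close>

lemma rc_pressure_eq:
  assumes d: "d \<ge> 3" and q: "q \<ge> 2" and w: "w \<ge> 0"
    and p: "is_ising_pressure d (beta_star q w) (B_star d q w B) (beta_star q w * real d / 2 + B_star d q w B + c)"
  shows "rc_pressure d q w B = real d / 2 * ln (1 + w) + c"
proof -
  have pos: "1 + w > 0" "1 + w / (q - 1) > 0" "exp (- B) * (q - 1) > 0" using q w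
    by (auto intro: add_pos_nonneg)
  have b: "beta_star q w = (ln (1 + w) + ln (1 + w / (q - 1))) / 4"
    unfolding beta_star_def using pos by (simp add: ln_mult)
  have B: "B_star d q w B = real d / 4 * (ln (1 + w) - ln (1 + w / (q - 1))) - ln (exp (- B) * (q - 1)) / 2"
  proof -
    have l: "ln ((1 + w) / (1 + w / (q - 1))) = ln (1 + w) - ln (1 + w / (q - 1))"
      "ln (exp B / (q - 1)) = B - ln (q - 1)" "ln (exp (- B) * (q - 1)) = ln (q - 1) - B"
      using pos q by (simp_all add: ln_div ln_mult)
    show ?thesis unfolding B_star_def l by (simp add: diff_divide_distrib)
  qed
  show ?thesis unfolding rc_pressure_def ising_pressure_eq[OF d p] unfolding b B
    by (simp add: field_simps)
qed

text \<open>The error has three equal parts: clusters with more than \<open>k\<close> vertices,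
  small clusters with a cycle, and the distance of the two-spin pressure from its limit. The second
  part asks for few bad vertices at radius \<open>k\<^sup>2\<close>, the third at the radius
  supplied by \<open>psi_limit\<close>.\<close>

lemma rc_pressure_typical:
  assumes d: "d \<ge> 3" and q: "q \<ge> 2" and w: "w \<ge> 0" and B: "B \<ge> 0" and \<eta>: "\<eta> > 0"
  shows "typical d (\<lambda>n E. \<bar>ln (rc_partition {..<n} E q w B) / real n - rc_pressure d q w B\<bar> \<le> \<eta>)"
proof -
  define a z where "a = exp (- 2 * beta_star q w)" and "z = exp (- 2 * B_star d q w B)"
  have "1 \<le> (1 + w) * (1 + w / (q - 1))"
    using mult_mono[of 1 "1 + w" 1 "1 + w / (q - 1)"] q w by simp
  hence "beta_star q w \<ge> 0" unfolding beta_star_def by simp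
  hence a: "0 \<le> a" "a \<le> 1" and z: "z > 0" by (auto simp: a_def z_def)
  obtain c where c: "\<And>\<eta>. \<eta> > 0 \<Longrightarrow> \<exists>r. \<exists>\<epsilon>::real. \<epsilon> > 0 \<and> (\<forall>n E. n > 0 \<longrightarrow> E \<in> regular_graphs d n \<longrightarrow>
     real (nbad d r n E) \<le> \<epsilon> * real n \<longrightarrow> \<bar>psi n E a z - c\<bar> \<le> \<eta>)"
    using psi_limit[OF d a z] by blast
  have rp: "rc_pressure d q w B = real d / 2 * ln (1 + w) + c"
    by (rule rc_pressure_eq[OF d q w is_ising_pressure_exists]) (use c in \<open>simp add: a_def z_def\<close>)
  have lq: "ln q > 0" using q by simp
  \<comment> \<open>There are at most \<open>real n / real k\<close> large clusters, each costing at
    most a factor \<open>q\<close>, hence a contribution of \<open>ln q / real k\<close> per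
    vertex.\<close>
  obtain k0 where k0: "inverse (real (Suc k0)) < \<eta> / (3 * ln q)"
    using reals_Archimedean[of "\<eta> / (3 * ln q)"] \<eta> lq by auto
  define k where "k = Suc k0"
  have k: "k > 0" "1 / real k * ln q \<le> \<eta> / 3" using k0 lq by (auto simp: k_def field_simps)
  define \<epsilon>1 where "\<epsilon>1 = \<eta> / (3 * ln q)"
  have \<epsilon>1: "\<epsilon>1 > 0" "\<epsilon>1 * ln q = \<eta> / 3" using \<eta> lq by (auto simp: \<epsilon>1_def)
  from c[of "\<eta> / 3"] \<eta> obtain r and \<epsilon> :: real where \<epsilon>: "\<epsilon> > 0" and close: "\<And>n E. n > 0 \<Longrightarrow> E \<in> regular_graphs d n \<Longrightarrow>
     real (nbad d r n E) \<le> \<epsilon> * real n \<Longrightarrow> \<bar>psi n E a z - c\<bar> \<le> \<eta> / 3" by auto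
  show ?thesis
  proof (rule typical_mono[OF typical_conj[OF typical_regular typical_conj[OF typical_few_bad[OF d \<epsilon>, of r] typical_few_bad[OF d \<epsilon>1(1), of "k\<^sup>2"]]]])
    fix n E
    assume h:
      "(E \<in> regular_graphs d n \<and> n > 0) \<and> real (nbad d r n E) \<le> \<epsilon> * real n \<and> real (nbad d (k\<^sup>2) n E) \<le> \<epsilon>1 * real n"
    hence E: "E \<in> regular_graphs d n" and n: "n > 0" by auto
    note r2 = regular_graphsD(2)[OF E]
    define Z where "Z = rc_partition {..<n} E q w B"
    define T where "T = two_spin {..<n} E q w B"
    have cs: "cutsum E a (Pow {..<n}) z \<ge> 1" using a z by (intro cutsum_ge_1) auto
    have T: "T = exp (real n * (real d / 2 * ln (1 + w))) * cutsum E a (Pow {..<n}) z"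
      unfolding T_def a_def z_def by (rule two_spin_cutsum[OF E q w])
    have Tp: "T > 0" using cs unfolding T by (intro mult_pos_pos) auto
    have lT: "ln T / real n = real d / 2 * ln (1 + w) + psi n E a z"
      using cs n unfolding T psi_def by (simp add: ln_mult add_divide_distrib)
    have 1: "T \<le> Z" unfolding T_def Z_def by (rule two_spin_le_rc[OF _ r2 q w]) simp
    hence l1: "ln T / real n \<le> ln Z / real n" using Tp by (intro divide_right_mono) auto
    have "Z \<le> q powr (real n / real k + real (nbad d (k\<^sup>2) n E)) * T"
      unfolding Z_def T_def by (rule rc_le_two_spin[OF r2 q w B k(1)])
    hence "ln Z \<le> ln (q powr (real n / real k + real (nbad d (k\<^sup>2) n E)) * T)"
      using 1 Tp by (intro ln_mono) auto
    also have "\<dots> = (real n / real k + real (nbad d (k\<^sup>2) n E)) * ln q + ln T"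
      using Tp q by (simp add: ln_mult ln_powr)
    also have "\<dots> \<le> (real n / real k + \<epsilon>1 * real n) * ln q + ln T"
      using h lq by (intro add_right_mono mult_right_mono) auto
    also have "\<dots> = real n * (1 / real k * ln q + \<epsilon>1 * ln q) + ln T" by (simp add: algebra_simps)
    also have "\<dots> \<le> real n * (\<eta> / 3 + \<eta> / 3) + ln T"
      using k(2) \<epsilon>1(2) by (intro add_right_mono mult_left_mono add_mono) auto
    finally have l2: "ln Z / real n \<le> 2 * \<eta> / 3 + ln T / real n" using n by (simp add: field_simps)
    have "\<bar>psi n E a z - c\<bar> \<le> \<eta> / 3" using close[OF n E] h by blast
    thus "\<bar>ln (rc_partition {..<n} E q w B) / real n - rc_pressure d q w B\<bar> \<le> \<eta>"
      using l1 l2 unfolding lT rp Z_def[symmetric] by linarith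
  qed
qed

section \<open>Quenched and annealed limits\<close>

lemma expectation_le:
  fixes f g :: "nat set set \<Rightarrow> real"
  assumes "regular_graphs d n \<noteq> {}" "\<And>E. E \<in> regular_graphs d n \<Longrightarrow> f E \<le> g E"
  shows "measure_pmf.expectation (random_regular_graph d n) f \<le> measure_pmf.expectation (random_regular_graph d n) g"
proof -
  have s: "set_pmf (random_regular_graph d n) = regular_graphs d n"
    using assms(1) by (simp add: random_regular_graph_def finite_regular_graphs)
  show ?thesis
    by (intro integral_mono_AE integrable_measure_pmf_finite)
       (use s assms(2) finite_regular_graphs in \<open>auto simp: AE_measure_pmf_iff\<close>)
qed

lemma expectation_affine_indicator:
  fixes a b :: real
  assumes "regular_graphs d n \<noteq> {}"
  shows "measure_pmf.expectation (random_regular_graph d n) (\<lambda>E. a + b * indicator A E) =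
    a + b * measure_pmf.prob (random_regular_graph d n) A"
proof -
  have s: "set_pmf (random_regular_graph d n) = regular_graphs d n"
    using assms(1) by (simp add: random_regular_graph_def finite_regular_graphs)
  have i: "integrable (measure_pmf (random_regular_graph d n)) f" for f :: "nat set set \<Rightarrow> real"
    by (rule integrable_measure_pmf_finite) (simp add: s finite_regular_graphs)
  show ?thesis by (subst Bochner_Integration.integral_add[OF i i]) simp
qed

text \<open>Exceptional graphs have probability at most \<open>exp (- M * real n)\<close> for any
  chosen \<open>M\<close>, which outweighs even the a priori bound \<open>exp (L * real n)\<close>.
  They influence neither the limit of the mean logarithm nor, on the exponential scale, the mean
  itself.\<close>

lemma quenched_annealed_limits:
  fixes Z :: "nat \<Rightarrow> nat set set \<Rightarrow> real"
  assumes near: "\<And>\<eta>. \<eta> > 0 \<Longrightarrow> typical d (\<lambda>n E. \<bar>ln (Z n E) / real n - \<phi>\<bar> \<le> \<eta>)"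
    and Z: "\<And>n E. E \<in> regular_graphs d n \<Longrightarrow> 1 \<le> Z n E \<and> Z n E \<le> exp (L * real n)"
  shows "((\<lambda>n. 1 / real n * measure_pmf.expectation (random_regular_graph d n) (\<lambda>E. ln (Z n E))) \<longlongrightarrow> \<phi>) (admissible d)"
    and "((\<lambda>n. 1 / real n * ln (measure_pmf.expectation (random_regular_graph d n) (Z n))) \<longlongrightarrow> \<phi>) (admissible d)"
proof -
  \<comment> \<open>Large enough that \<open>L - M \<le> \<phi>\<close>, so that exceptional graphs
    contribute no more than typical ones to the mean, and that \<open>ln (Z n E) / real n\<close> is
    within \<open>M\<close> of \<open>\<phi>\<close> on every regular graph.\<close>
  define M where "M = \<bar>L\<bar> + \<bar>\<phi>\<bar> + 1"
  have M: "M > 0" by (simp add: M_def)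
  have "eventually (\<lambda>n. \<bar>1 / real n * measure_pmf.expectation (random_regular_graph d n) (\<lambda>E. ln (Z n E)) - \<phi>\<bar> < e \<and>
      \<bar>1 / real n * ln (measure_pmf.expectation (random_regular_graph d n) (Z n)) - \<phi>\<bar> < e) (admissible d)"
    if e: "e > 0" for e
  proof -
    \<comment> \<open>The annealed bound spends \<open>\<eta>\<close> twice, on the typical range
      and on a factor 2, which leaves a strict margin below \<open>e\<close>.\<close>
    define \<eta> where "\<eta> = e / 3"
    have \<eta>: "\<eta> > 0" using e by (simp add: \<eta>_def)
    define A where "A n = {E. \<not> \<bar>ln (Z n E) / real n - \<phi>\<bar> \<le> \<eta>}" for n
    have lim: "((\<lambda>n. M * exp (- M * real n)) \<longlongrightarrow> M * 0) (admissible d)"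
    proof (intro tendsto_mult tendsto_const tendsto_mono[OF admissible_le])
      have "(\<lambda>n. exp (- M) ^ n) \<longlonglongrightarrow> 0" using M by (intro LIMSEQ_realpow_zero) auto
      thus "(\<lambda>n. exp (- M * real n)) \<longlonglongrightarrow> 0" by (simp add: exp_of_nat_mult[symmetric] mult.commute)
    qed
    hence small: "eventually (\<lambda>n. M * exp (- M * real n) < \<eta>) (admissible d)"
      by (rule order_tendstoD) (use \<eta> in simp)
    \<comment> \<open>This puts the exceptional probability below one half, so that the typical
      graphs alone bound the mean of \<open>Z\<close> from below.\<close>
    have half: "eventually (\<lambda>n. M * exp (- M * real n) < M / 2) (admissible d)"
      using lim by (rule order_tendstoD) (use M in simp)
    have "filterlim real at_top (admissible d)"
      using filterlim_real_sequentially admissible_le filterlim_mono by blast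
    hence large: "eventually (\<lambda>n. real n \<ge> (ln 2 + 1) / \<eta>) (admissible d)"
      by (simp add: filterlim_at_top)
    have np: "eventually (\<lambda>n. n > 0) (admissible d)"
      by (intro eventually_admissible eventually_gt_at_top)
    from typicalD[OF near[OF \<eta>], of M] eventually_regular_graphs_nonempty[of d] small half large np
    show ?thesis
    proof eventually_elim
      case (elim n)
      define p where "p = measure_pmf.prob (random_regular_graph d n) (A n)"
      have p: "0 \<le> p" "p \<le> exp (- M * real n)" using elim(1) by (auto simp: p_def A_def)
      have n: "real n > 0" using elim(6) by simp
      have Zp: "Z n E > 0" "0 \<le> ln (Z n E)" "ln (Z n E) \<le> L * real n"
        if "E \<in> regular_graphs d n" for E
      proof -
        have z: "1 \<le> Z n E" "Z n E \<le> exp (L * real n)" using Z that by auto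
        show "Z n E > 0" "0 \<le> ln (Z n E)" using z by auto
        have "ln (Z n E) \<le> ln (exp (L * real n))" using z by (intro ln_mono) auto
        thus "ln (Z n E) \<le> L * real n" by simp
      qed
      have gd: "real n * (\<phi> - \<eta>) \<le> ln (Z n E)" "ln (Z n E) \<le> real n * (\<phi> + \<eta>)" if "E \<notin> A n" for E
      proof -
        have "\<phi> - \<eta> \<le> ln (Z n E) / real n" "ln (Z n E) / real n \<le> \<phi> + \<eta>"
          using that unfolding A_def by (auto simp: abs_le_iff)
        thus "real n * (\<phi> - \<eta>) \<le> ln (Z n E)" "ln (Z n E) \<le> real n * (\<phi> + \<eta>)"
          using n by (simp_all add: pos_le_divide_eq pos_divide_le_eq mult.commute)
      qed
      have Mp: "M * p < \<eta>" using mult_left_mono[OF p(2), of M] M elim(3) by linarith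
      define EL where "EL = measure_pmf.expectation (random_regular_graph d n) (\<lambda>E. ln (Z n E))"
      define EZ where "EZ = measure_pmf.expectation (random_regular_graph d n) (Z n)"
      have "EL \<le> measure_pmf.expectation (random_regular_graph d n) (\<lambda>E. real n * (\<phi> + \<eta>) + real n * M * indicator (A n) E)"
        unfolding EL_def
      proof (rule expectation_le[OF elim(2)])
        fix E assume E: "E \<in> regular_graphs d n"
        have "L \<le> \<phi> + \<eta> + M" using \<eta> by (simp add: M_def)
        hence "real n * L \<le> real n * (\<phi> + \<eta> + M)" by (intro mult_left_mono) auto
        thus "ln (Z n E) \<le> real n * (\<phi> + \<eta>) + real n * M * indicator (A n) E"
          using Zp(3)[OF E] gd(2)[of E] by (cases "E \<in> A n") (auto simp: algebra_simps)
      qed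
      hence u: "EL \<le> real n * (\<phi> + \<eta>) + real n * M * p"
        by (simp add: expectation_affine_indicator[OF elim(2)] p_def)
      have "measure_pmf.expectation (random_regular_graph d n) (\<lambda>E. real n * (\<phi> - \<eta>) + (- real n * M) * indicator (A n) E) \<le> EL"
        unfolding EL_def
      proof (rule expectation_le[OF elim(2)])
        fix E assume E: "E \<in> regular_graphs d n"
        have "\<phi> - \<eta> - M \<le> 0" using \<eta> by (simp add: M_def)
        hence "real n * (\<phi> - \<eta> - M) \<le> 0" by (intro mult_nonneg_nonpos) auto
        thus "real n * (\<phi> - \<eta>) + (- real n * M) * indicator (A n) E \<le> ln (Z n E)"
          using Zp(2)[OF E] gd(1)[of E] by (cases "E \<in> A n") (auto simp: algebra_simps)
      qed
      hence l: "real n * (\<phi> - \<eta>) - real n * M * p \<le> EL"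
        unfolding expectation_affine_indicator[OF elim(2)] by (simp add: p_def)
      have "EL \<le> real n * (\<phi> + \<eta> + M * p)" "real n * (\<phi> - \<eta> - M * p) \<le> EL"
        using u l by (simp_all add: algebra_simps)
      hence "EL / real n \<le> \<phi> + \<eta> + M * p" "\<phi> - \<eta> - M * p \<le> EL / real n"
        using n by (simp_all add: pos_le_divide_eq pos_divide_le_eq mult.commute)
      hence 1: "\<bar>EL / real n - \<phi>\<bar> < e" using Mp \<eta> by (simp add: \<eta>_def abs_less_iff)
      have "EZ \<le> measure_pmf.expectation (random_regular_graph d n) (\<lambda>E. exp (real n * (\<phi> + \<eta>)) + exp (L * real n) * indicator (A n) E)"
        unfolding EZ_def
      proof (rule expectation_le[OF elim(2)])
        fix E assume E: "E \<in> regular_graphs d n"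
        show "Z n E \<le> exp (real n * (\<phi> + \<eta>)) + exp (L * real n) * indicator (A n) E"
        proof (cases "E \<in> A n")
          case True thus ?thesis using Z[OF E] by (simp add: add_increasing)
        next
          case False
          from gd(2)[OF this] have "exp (ln (Z n E)) \<le> exp (real n * (\<phi> + \<eta>))" by simp
          thus ?thesis using Zp(1)[OF E] False by simp
        qed
      qed
      hence "EZ \<le> exp (real n * (\<phi> + \<eta>)) + exp (L * real n) * p"
        unfolding expectation_affine_indicator[OF elim(2)] p_def .
      also have "exp (L * real n) * p \<le> exp (L * real n) * exp (- M * real n)" using p
        by (intro mult_left_mono) auto
      also have "\<dots> = exp (real n * (L - M))" by (simp add: exp_add[symmetric] algebra_simps)
      also have "\<dots> \<le> exp (real n * (\<phi> + \<eta>))"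
      proof -
        have "L - M \<le> \<phi> + \<eta>" using \<eta> by (simp add: M_def)
        thus ?thesis by (simp add: mult_left_mono)
      qed
      finally have EZu: "EZ \<le> 2 * exp (real n * (\<phi> + \<eta>))" by simp
      have "measure_pmf.expectation (random_regular_graph d n) (\<lambda>E. exp (real n * (\<phi> - \<eta>)) + (- exp (real n * (\<phi> - \<eta>))) * indicator (A n) E) \<le> EZ"
        unfolding EZ_def
      proof (rule expectation_le[OF elim(2)])
        fix E assume E: "E \<in> regular_graphs d n"
        show "exp (real n * (\<phi> - \<eta>)) + (- exp (real n * (\<phi> - \<eta>))) * indicator (A n) E \<le> Z n E"
        proof (cases "E \<in> A n")
          case True thus ?thesis using Zp(1)[OF E] by simp
        next
          case False
          from gd(1)[OF this] have "exp (real n * (\<phi> - \<eta>)) \<le> exp (ln (Z n E))" by simp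
          thus ?thesis using Zp(1)[OF E] False by simp
        qed
      qed
      hence i1: "exp (real n * (\<phi> - \<eta>)) * (1 - p) \<le> EZ"
        unfolding expectation_affine_indicator[OF elim(2)] by (simp add: p_def algebra_simps)
      have "1 / 2 \<le> 1 - p" using p(2) elim(4) M by simp
      hence i2: "exp (real n * (\<phi> - \<eta>)) * (1 / 2) \<le> exp (real n * (\<phi> - \<eta>)) * (1 - p)"
        by (intro mult_left_mono) auto
      from i1 i2 have EZl: "exp (real n * (\<phi> - \<eta>)) / 2 \<le> EZ" by linarith
      have EZp: "EZ > 0" using EZl less_le_trans[of 0 "exp (real n * (\<phi> - \<eta>)) / 2" EZ] by simp
      have "ln EZ \<le> ln (2 * exp (real n * (\<phi> + \<eta>)))" using EZu EZp by (intro ln_mono) auto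
      hence a: "ln EZ \<le> ln 2 + real n * (\<phi> + \<eta>)" by (simp add: ln_mult)
      have "ln (exp (real n * (\<phi> - \<eta>)) / 2) \<le> ln EZ" using EZl EZp by (intro ln_mono) auto
      hence b: "real n * (\<phi> - \<eta>) - ln 2 \<le> ln EZ" by (simp add: ln_div)
      have "ln 2 < real n * \<eta>" using elim(5) \<eta> by (simp add: field_simps)
      hence "ln EZ < real n * (\<phi> + 2 * \<eta>)" "real n * (\<phi> - 2 * \<eta>) < ln EZ" using a b
        by (simp_all add: algebra_simps)
      hence "ln EZ / real n < \<phi> + 2 * \<eta>" "\<phi> - 2 * \<eta> < ln EZ / real n"
        using n by (simp_all add: pos_less_divide_eq pos_divide_less_eq mult.commute)
      hence 2: "\<bar>ln EZ / real n - \<phi>\<bar> < e" using \<eta> by (simp add: \<eta>_def abs_less_iff)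
      from 1 2 show ?case by (simp add: EL_def EZ_def)
    qed
  qed
  note main = this
  show "((\<lambda>n. 1 / real n * measure_pmf.expectation (random_regular_graph d n) (\<lambda>E. ln (Z n E))) \<longlongrightarrow> \<phi>) (admissible d)"
    unfolding tendsto_iff dist_real_def by (intro allI impI, rule eventually_mono[OF main]) auto
  show "((\<lambda>n. 1 / real n * ln (measure_pmf.expectation (random_regular_graph d n) (Z n))) \<longlongrightarrow> \<phi>) (admissible d)"
    unfolding tendsto_iff dist_real_def by (intro allI impI, rule eventually_mono[OF main]) auto
qed

theorem theorem1p14:
  fixes d :: nat and q \<beta> B w :: real
  assumes "d \<ge> 3" and "q \<ge> 2" and "\<beta> \<ge> 0" and "B \<ge> 0" and "w = exp \<beta> - 1"
  shows "((\<lambda>n. 1 / real n *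
             measure_pmf.expectation (random_regular_graph d n)
               (\<lambda>E. ln (rc_partition {..<n} E q w B)))
           \<longlongrightarrow> rc_pressure d q w B) (admissible d) \<and>
         ((\<lambda>n. 1 / real n *
             ln (measure_pmf.expectation (random_regular_graph d n)
               (\<lambda>E. rc_partition {..<n} E q w B)))
           \<longlongrightarrow> rc_pressure d q w B) (admissible d)"
proof -
  have w: "w \<ge> 0" using assms by simp
  \<comment> \<open>Regularity fixes \<open>card E\<close> at \<open>d * n / 2\<close>, which turns
    the upper bound of \<open>rc_bounds\<close> into \<open>exp (L * real n)\<close>.\<close>
  define L where "L = ln q + real d / 2 * ln (1 + w)"
  have Z: "1 \<le> rc_partition {..<n} E q w B \<and> rc_partition {..<n} E q w B \<le> exp (L * real n)"
    if E: "E \<in> regular_graphs d n" for n E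
  proof -
    note b = rc_bounds[OF regular_graphsD(2)[OF E] assms(2) w assms(4)]
    have "real (card E) = real d / 2 * real n" using arg_cong[OF card_edges_regular[OF E], of real]
      by simp
    hence "exp (L * real n) = exp (real n * ln q) * exp (real (card E) * ln (1 + w))"
      unfolding L_def by (simp add: exp_add[symmetric] algebra_simps)
    also have "\<dots> = q ^ n * (1 + w) ^ card E"
      using assms(2) w by (simp add: exp_of_nat_mult)
    finally show ?thesis using b by simp
  qed
  show ?thesis
    using quenched_annealed_limits[where Z = "\<lambda>n E. rc_partition {..<n} E q w B" and L = L,
        OF rc_pressure_typical[OF assms(1,2) w assms(4)] Z]
    by simp
qed

end
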